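(* Let $\mathcal{A},\mathcal{B}$ be (strict) tensor categories over a field $k$ and let $\mathcal{U}:\mathcal{A}\to\mathcal{B}$ be a $k$-linear, exact, faithful monoidal functor which has a left adjoint. Let $V,W\in\mathcal{A}$ and let $$0\to K\xrightarrow{\,j\,}P\xrightarrow{\,\pi\,}\mathbf{1}\to0,\qquad 0\to L\xrightarrow{\,i\,}Q\xrightarrow{\,p\,}V\to0$$ be allowable short exact sequences in $\mathcal{A}$ where $P,Q$ are relatively projective objects. Then for all $n\ge1$, $$\mathrm{Ext}^n_{\mathcal{A},\mathcal{B}}(V,W)\cong\mathrm{Hom}_{\mathcal{A}}(K,M_n)\big/\mathrm{im}(j^* ),$$ where $M_n=W\otimes L^\vee\otimes(K^\vee)^{\otimes(n-2)}$ for $n\ge2$, $M_1=W\otimes V^\vee$, and $j^*$ is the pullback $\mathrm{Hom}_{\mathcal{A}}(P,M_n)\to\mathrm{Hom}_{\mathcal{A}}(K,M_n)$.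
   Context: A tensor category over $k$ is a $k$-linear abelian rigid monoidal category with $k$-bilinear tensor product whose unit $\mathbf{1}$ is simple with $\mathrm{End}(\mathbf{1})\cong k$. The dual $X^\vee$ comes with $\mathrm{ev}_X:X^\vee\otimes X\to\mathbf{1}$ and $\mathrm{coev}_X:\mathbf{1}\to X\otimes X^\vee$ satisfying the zig-zag identities. A morphism $f:X\to Y$ in $\mathcal{A}$ is allowable if there is $s\in\mathrm{Hom}_{\mathcal{B}}(\mathcal{U}(Y),\mathcal{U}(X))$ with $\mathcal{U}(f)s\,\mathcal{U}(f)=\mathcal{U}(f)$. An exact sequence is allowable if all its morphisms are. An object $P$ is relatively projective if every morphism $P\to Y$ lifts along every allowable epimorphism $X\to Y$. A relatively projective resolution of $V$ is an allowable exact sequence $\cdots\to P_1\to P_0\to V\to0$ with all $P_i$ relatively projective. $\mathrm{Ext}^n_{\mathcal{A},\mathcal{B}}(V,W)$ is the $n$-th cohomology of $0\to\mathrm{Hom}_{\mathcal{A}}(P_0,W)\to\mathrm{Hom}_{\mathcal{A}}(P_1,W)\to\cdots$, independent of the resolution. *)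

theory Defs
  imports "HOL-Algebra.Module" "HOL-Algebra.AbelCoset"
begin

section \<open>Modules: quotients and isomorphism\<close>

text \<open>
  The quotient of M by a submodule N.  Its elements are the additive cosets of N, and
  \<open>c \<odot> (N +> x) = N +> (c \<odot> x)\<close>.  The ring-multiplication fields of the record
  play no role in a module and are left unspecified.
\<close>

definition quot_module :: "('k, 'm, 'z) module_scheme \<Rightarrow> 'm set \<Rightarrow> ('k, 'm set) module"
  where "quot_module M N =
    \<lparr>carrier = a_rcosets\<^bsub>M\<^esub> N, mult = undefined, one = undefined,
     zero = N, add = set_add M,
     smult = (\<lambda>c S. N <+>\<^bsub>M\<^esub> (\<lambda>x. c \<odot>\<^bsub>M\<^esub> x) ` S)\<rparr>"

definition module_isomorphic ::
    "('k, 'r) ring_scheme \<Rightarrow> ('k, 'm, 'y) module_scheme \<Rightarrow> ('k, 'n, 'z) module_scheme \<Rightarrow> bool"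
  where "module_isomorphic R M N \<longleftrightarrow>
    (\<exists>h \<in> iso (add_monoid M) (add_monoid N).
       \<forall>c \<in> carrier R. \<forall>x \<in> carrier M. h (c \<odot>\<^bsub>M\<^esub> x) = c \<odot>\<^bsub>N\<^esub> h x)"

section \<open>Linear and abelian categories\<close>

text \<open>
  A category enriched in k-modules.  \<open>Hom C X Y\<close> is the module of morphisms from X to Y,
  meaningful for objects X, Y only.
\<close>

record ('k, 'o, 'm) lin_cat =
  Ob :: "'o set"
  Hom :: "'o \<Rightarrow> 'o \<Rightarrow> ('k, 'm) module"
  Idm :: "'o \<Rightarrow> 'm"
  Comp :: "'m \<Rightarrow> 'm \<Rightarrow> 'm"  (infixr "\<cdot>\<index>" 70)

abbreviation mor :: "('k, 'o, 'm, 'z) lin_cat_scheme \<Rightarrow> 'o \<Rightarrow> 'o \<Rightarrow> 'm set"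
  where "mor C X Y \<equiv> carrier (Hom C X Y)"

abbreviation zero_mor :: "('k, 'o, 'm, 'z) lin_cat_scheme \<Rightarrow> 'o \<Rightarrow> 'o \<Rightarrow> 'm"
  where "zero_mor C X Y \<equiv> \<zero>\<^bsub>Hom C X Y\<^esub>"

locale linear_category =
  fixes k :: "('k, 'r) ring_scheme" and C :: "('k, 'o, 'm, 'z) lin_cat_scheme" (structure)
  assumes base_field: "field k"
    and Hom_module: "\<lbrakk>X \<in> Ob C; Y \<in> Ob C\<rbrakk> \<Longrightarrow> module k (Hom C X Y)"
    and Hom_disjoint: "\<lbrakk>X \<in> Ob C; Y \<in> Ob C; X' \<in> Ob C; Y' \<in> Ob C;
          f \<in> mor C X Y; f \<in> mor C X' Y'\<rbrakk> \<Longrightarrow> X = X' \<and> Y = Y'"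
    and Id_closed: "X \<in> Ob C \<Longrightarrow> Idm C X \<in> mor C X X"
    and Comp_closed: "\<lbrakk>X \<in> Ob C; Y \<in> Ob C; Z \<in> Ob C; f \<in> mor C X Y; g \<in> mor C Y Z\<rbrakk>
          \<Longrightarrow> g \<cdot> f \<in> mor C X Z"
    and Comp_assoc: "\<lbrakk>X \<in> Ob C; Y \<in> Ob C; Z \<in> Ob C; T \<in> Ob C;
          f \<in> mor C X Y; g \<in> mor C Y Z; h \<in> mor C Z T\<rbrakk> \<Longrightarrow> (h \<cdot> g) \<cdot> f = h \<cdot> (g \<cdot> f)"
    and Id_left: "\<lbrakk>X \<in> Ob C; Y \<in> Ob C; f \<in> mor C X Y\<rbrakk> \<Longrightarrow> Idm C Y \<cdot> f = f"
    and Id_right: "\<lbrakk>X \<in> Ob C; Y \<in> Ob C; f \<in> mor C X Y\<rbrakk> \<Longrightarrow> f \<cdot> Idm C X = f"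
    and Comp_add_left: "\<lbrakk>X \<in> Ob C; Y \<in> Ob C; Z \<in> Ob C; f \<in> mor C X Y; g \<in> mor C Y Z; g' \<in> mor C Y Z\<rbrakk>
          \<Longrightarrow> (g \<oplus>\<^bsub>Hom C Y Z\<^esub> g') \<cdot> f = (g \<cdot> f) \<oplus>\<^bsub>Hom C X Z\<^esub> (g' \<cdot> f)"
    and Comp_add_right: "\<lbrakk>X \<in> Ob C; Y \<in> Ob C; Z \<in> Ob C; f \<in> mor C X Y; f' \<in> mor C X Y; g \<in> mor C Y Z\<rbrakk>
          \<Longrightarrow> g \<cdot> (f \<oplus>\<^bsub>Hom C X Y\<^esub> f') = (g \<cdot> f) \<oplus>\<^bsub>Hom C X Z\<^esub> (g \<cdot> f')"
    and Comp_smult_left: "\<lbrakk>X \<in> Ob C; Y \<in> Ob C; Z \<in> Ob C; c \<in> carrier k; f \<in> mor C X Y; g \<in> mor C Y Z\<rbrakk>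
          \<Longrightarrow> (c \<odot>\<^bsub>Hom C Y Z\<^esub> g) \<cdot> f = c \<odot>\<^bsub>Hom C X Z\<^esub> (g \<cdot> f)"
    and Comp_smult_right: "\<lbrakk>X \<in> Ob C; Y \<in> Ob C; Z \<in> Ob C; c \<in> carrier k; f \<in> mor C X Y; g \<in> mor C Y Z\<rbrakk>
          \<Longrightarrow> g \<cdot> (c \<odot>\<^bsub>Hom C X Y\<^esub> f) = c \<odot>\<^bsub>Hom C X Z\<^esub> (g \<cdot> f)"

definition zero_object :: "('k, 'o, 'm, 'z) lin_cat_scheme \<Rightarrow> 'o \<Rightarrow> bool"
  where "zero_object C Z \<longleftrightarrow> Z \<in> Ob C \<and>
    (\<forall>X \<in> Ob C. (\<exists>!f. f \<in> mor C X Z) \<and> (\<exists>!f. f \<in> mor C Z X))"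

definition monic :: "('k, 'o, 'm, 'z) lin_cat_scheme \<Rightarrow> 'o \<Rightarrow> 'o \<Rightarrow> 'm \<Rightarrow> bool"
  where "monic C X Y f \<longleftrightarrow> X \<in> Ob C \<and> Y \<in> Ob C \<and> f \<in> mor C X Y \<and>
    (\<forall>T \<in> Ob C. \<forall>g \<in> mor C T X. \<forall>h \<in> mor C T X. f \<cdot>\<^bsub>C\<^esub> g = f \<cdot>\<^bsub>C\<^esub> h \<longrightarrow> g = h)"

definition epic :: "('k, 'o, 'm, 'z) lin_cat_scheme \<Rightarrow> 'o \<Rightarrow> 'o \<Rightarrow> 'm \<Rightarrow> bool"
  where "epic C X Y f \<longleftrightarrow> X \<in> Ob C \<and> Y \<in> Ob C \<and> f \<in> mor C X Y \<and>
    (\<forall>T \<in> Ob C. \<forall>g \<in> mor C Y T. \<forall>h \<in> mor C Y T. g \<cdot>\<^bsub>C\<^esub> f = h \<cdot>\<^bsub>C\<^esub> f \<longrightarrow> g = h)"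

definition invertible :: "('k, 'o, 'm, 'z) lin_cat_scheme \<Rightarrow> 'o \<Rightarrow> 'o \<Rightarrow> 'm \<Rightarrow> bool"
  where "invertible C X Y f \<longleftrightarrow> X \<in> Ob C \<and> Y \<in> Ob C \<and> f \<in> mor C X Y \<and>
    (\<exists>g \<in> mor C Y X. g \<cdot>\<^bsub>C\<^esub> f = Idm C X \<and> f \<cdot>\<^bsub>C\<^esub> g = Idm C Y)"

definition is_kernel :: "('k, 'o, 'm, 'z) lin_cat_scheme \<Rightarrow> 'o \<Rightarrow> 'o \<Rightarrow> 'm \<Rightarrow> 'o \<Rightarrow> 'm \<Rightarrow> bool"
  where "is_kernel C X Y f N n \<longleftrightarrow>
    X \<in> Ob C \<and> Y \<in> Ob C \<and> f \<in> mor C X Y \<and> N \<in> Ob C \<and> n \<in> mor C N X \<and>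
    f \<cdot>\<^bsub>C\<^esub> n = zero_mor C N Y \<and>
    (\<forall>T \<in> Ob C. \<forall>t \<in> mor C T X. f \<cdot>\<^bsub>C\<^esub> t = zero_mor C T Y \<longrightarrow>
       (\<exists>!u. u \<in> mor C T N \<and> n \<cdot>\<^bsub>C\<^esub> u = t))"

definition is_cokernel :: "('k, 'o, 'm, 'z) lin_cat_scheme \<Rightarrow> 'o \<Rightarrow> 'o \<Rightarrow> 'm \<Rightarrow> 'o \<Rightarrow> 'm \<Rightarrow> bool"
  where "is_cokernel C X Y f Q q \<longleftrightarrow>
    X \<in> Ob C \<and> Y \<in> Ob C \<and> f \<in> mor C X Y \<and> Q \<in> Ob C \<and> q \<in> mor C Y Q \<and>
    q \<cdot>\<^bsub>C\<^esub> f = zero_mor C X Q \<and>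
    (\<forall>T \<in> Ob C. \<forall>t \<in> mor C Y T. t \<cdot>\<^bsub>C\<^esub> f = zero_mor C X T \<longrightarrow>
       (\<exists>!u. u \<in> mor C Q T \<and> u \<cdot>\<^bsub>C\<^esub> q = t))"

definition is_biproduct ::
    "('k, 'o, 'm, 'z) lin_cat_scheme \<Rightarrow> 'o \<Rightarrow> 'o \<Rightarrow> 'o \<Rightarrow> 'm \<Rightarrow> 'm \<Rightarrow> 'm \<Rightarrow> 'm \<Rightarrow> bool"
  where "is_biproduct C X Y S i\<^sub>1 i\<^sub>2 p\<^sub>1 p\<^sub>2 \<longleftrightarrow> S \<in> Ob C \<and>
    i\<^sub>1 \<in> mor C X S \<and> i\<^sub>2 \<in> mor C Y S \<and> p\<^sub>1 \<in> mor C S X \<and> p\<^sub>2 \<in> mor C S Y \<and>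
    p\<^sub>1 \<cdot>\<^bsub>C\<^esub> i\<^sub>1 = Idm C X \<and> p\<^sub>2 \<cdot>\<^bsub>C\<^esub> i\<^sub>2 = Idm C Y \<and>
    p\<^sub>2 \<cdot>\<^bsub>C\<^esub> i\<^sub>1 = zero_mor C X Y \<and> p\<^sub>1 \<cdot>\<^bsub>C\<^esub> i\<^sub>2 = zero_mor C Y X \<and>
    (i\<^sub>1 \<cdot>\<^bsub>C\<^esub> p\<^sub>1) \<oplus>\<^bsub>Hom C S S\<^esub> (i\<^sub>2 \<cdot>\<^bsub>C\<^esub> p\<^sub>2) = Idm C S"

locale abelian_category = linear_category +
  assumes has_zero_object: "\<exists>Z. zero_object C Z"
    and has_biproducts: "\<lbrakk>X \<in> Ob C; Y \<in> Ob C\<rbrakk> \<Longrightarrow> \<exists>S i\<^sub>1 i\<^sub>2 p\<^sub>1 p\<^sub>2. is_biproduct C X Y S i\<^sub>1 i\<^sub>2 p\<^sub>1 p\<^sub>2"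
    and has_kernels: "\<lbrakk>X \<in> Ob C; Y \<in> Ob C; f \<in> mor C X Y\<rbrakk> \<Longrightarrow> \<exists>N n. is_kernel C X Y f N n"
    and has_cokernels: "\<lbrakk>X \<in> Ob C; Y \<in> Ob C; f \<in> mor C X Y\<rbrakk> \<Longrightarrow> \<exists>Q q. is_cokernel C X Y f Q q"
    and monic_normal: "monic C X Y f \<Longrightarrow> \<exists>Z g. is_kernel C Y Z g X f"
    and epic_normal: "epic C X Y f \<Longrightarrow> \<exists>Z g. is_cokernel C Z X g Y f"

text \<open>The image of a morphism is the kernel of its cokernel.\<close>

definition is_image :: "('k, 'o, 'm, 'z) lin_cat_scheme \<Rightarrow> 'o \<Rightarrow> 'o \<Rightarrow> 'm \<Rightarrow> 'o \<Rightarrow> 'm \<Rightarrow> bool"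
  where "is_image C X Y f I m \<longleftrightarrow> (\<exists>Q q. is_cokernel C X Y f Q q \<and> is_kernel C Y Q q I m)"

text \<open>Exactness of \<open>X \<rightarrow> Y \<rightarrow> Z\<close> at Y: the image of f and the kernel of g agree.\<close>

definition exact_at :: "('k, 'o, 'm, 'z) lin_cat_scheme \<Rightarrow> 'o \<Rightarrow> 'o \<Rightarrow> 'o \<Rightarrow> 'm \<Rightarrow> 'm \<Rightarrow> bool"
  where "exact_at C X Y Z f g \<longleftrightarrow> (\<exists>I m. is_image C X Y f I m \<and> is_kernel C Y Z g I m)"

text \<open>
  Exactness of \<open>0 \<rightarrow> X \<rightarrow> Y\<close> at X and of \<open>Y \<rightarrow> Z \<rightarrow> 0\<close> at Z is expressed
  by f being monic and g being epic.
\<close>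

definition short_exact :: "('k, 'o, 'm, 'z) lin_cat_scheme \<Rightarrow> 'o \<Rightarrow> 'o \<Rightarrow> 'o \<Rightarrow> 'm \<Rightarrow> 'm \<Rightarrow> bool"
  where "short_exact C X Y Z f g \<longleftrightarrow> monic C X Y f \<and> exact_at C X Y Z f g \<and> epic C Y Z g"

text \<open>Every subobject of a simple object is either zero or the whole object.\<close>

definition simple_object :: "('k, 'o, 'm, 'z) lin_cat_scheme \<Rightarrow> 'o \<Rightarrow> bool"
  where "simple_object C S \<longleftrightarrow> S \<in> Ob C \<and> \<not> zero_object C S \<and>
    (\<forall>X m. monic C X S m \<longrightarrow> zero_object C X \<or> invertible C X S m)"

section \<open>Strict tensor categories\<close>

record ('k, 'o, 'm) mon_cat = "('k, 'o, 'm) lin_cat" +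
  Tob :: "'o \<Rightarrow> 'o \<Rightarrow> 'o"  (infixr "\<boxtimes>\<index>" 75)
  Tmor :: "'m \<Rightarrow> 'm \<Rightarrow> 'm"  (infixr "\<boxdot>\<index>" 75)
  Unit :: "'o"

text \<open>
  Y is the dual of X, with evaluation \<open>Y \<boxtimes> X \<rightarrow> 1\<close> and coevaluation
  \<open>1 \<rightarrow> X \<boxtimes> Y\<close> subject to the zig-zag identities (in strict form).
\<close>

definition is_dual :: "('k, 'o, 'm, 'z) mon_cat_scheme \<Rightarrow> 'o \<Rightarrow> 'o \<Rightarrow> bool"
  where "is_dual C X Y \<longleftrightarrow> X \<in> Ob C \<and> Y \<in> Ob C \<and>
    (\<exists>ev \<in> mor C (Y \<boxtimes>\<^bsub>C\<^esub> X) (Unit C). \<exists>coev \<in> mor C (Unit C) (X \<boxtimes>\<^bsub>C\<^esub> Y).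
       (Idm C X \<boxdot>\<^bsub>C\<^esub> ev) \<cdot>\<^bsub>C\<^esub> (coev \<boxdot>\<^bsub>C\<^esub> Idm C X) = Idm C X \<and>
       (ev \<boxdot>\<^bsub>C\<^esub> Idm C Y) \<cdot>\<^bsub>C\<^esub> (Idm C Y \<boxdot>\<^bsub>C\<^esub> coev) = Idm C Y)"

locale strict_tensor_category =
  abelian_category k C
  for k :: "('k, 'r) ring_scheme" and C :: "('k, 'o, 'm, 'z) mon_cat_scheme" (structure) +
  assumes Unit_Ob: "Unit C \<in> Ob C"
    and Tob_closed: "\<lbrakk>X \<in> Ob C; Y \<in> Ob C\<rbrakk> \<Longrightarrow> X \<boxtimes> Y \<in> Ob C"
    and Tmor_closed: "\<lbrakk>X \<in> Ob C; Y \<in> Ob C; X' \<in> Ob C; Y' \<in> Ob C; f \<in> mor C X Y; g \<in> mor C X' Y'\<rbrakk>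
          \<Longrightarrow> f \<boxdot> g \<in> mor C (X \<boxtimes> X') (Y \<boxtimes> Y')"
    and Tmor_Id: "\<lbrakk>X \<in> Ob C; Y \<in> Ob C\<rbrakk> \<Longrightarrow> Idm C X \<boxdot> Idm C Y = Idm C (X \<boxtimes> Y)"
    and Tmor_Comp: "\<lbrakk>X \<in> Ob C; Y \<in> Ob C; Z \<in> Ob C; X' \<in> Ob C; Y' \<in> Ob C; Z' \<in> Ob C;
          f \<in> mor C X Y; g \<in> mor C Y Z; f' \<in> mor C X' Y'; g' \<in> mor C Y' Z'\<rbrakk>
          \<Longrightarrow> (g \<cdot> f) \<boxdot> (g' \<cdot> f') = (g \<boxdot> g') \<cdot> (f \<boxdot> f')"
    and Tob_assoc: "\<lbrakk>X \<in> Ob C; Y \<in> Ob C; Z \<in> Ob C\<rbrakk> \<Longrightarrow> (X \<boxtimes> Y) \<boxtimes> Z = X \<boxtimes> (Y \<boxtimes> Z)"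
    and Tmor_assoc: "\<lbrakk>X \<in> Ob C; Y \<in> Ob C; X' \<in> Ob C; Y' \<in> Ob C; X'' \<in> Ob C; Y'' \<in> Ob C;
          f \<in> mor C X Y; g \<in> mor C X' Y'; h \<in> mor C X'' Y''\<rbrakk>
          \<Longrightarrow> (f \<boxdot> g) \<boxdot> h = f \<boxdot> (g \<boxdot> h)"
    and Tob_Unit_left: "X \<in> Ob C \<Longrightarrow> Unit C \<boxtimes> X = X"
    and Tob_Unit_right: "X \<in> Ob C \<Longrightarrow> X \<boxtimes> Unit C = X"
    and Tmor_Unit_left: "\<lbrakk>X \<in> Ob C; Y \<in> Ob C; f \<in> mor C X Y\<rbrakk> \<Longrightarrow> Idm C (Unit C) \<boxdot> f = f"
    and Tmor_Unit_right: "\<lbrakk>X \<in> Ob C; Y \<in> Ob C; f \<in> mor C X Y\<rbrakk> \<Longrightarrow> f \<boxdot> Idm C (Unit C) = f"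
    and Tmor_add_left: "\<lbrakk>X \<in> Ob C; Y \<in> Ob C; X' \<in> Ob C; Y' \<in> Ob C;
          f \<in> mor C X Y; f' \<in> mor C X Y; g \<in> mor C X' Y'\<rbrakk>
          \<Longrightarrow> (f \<oplus>\<^bsub>Hom C X Y\<^esub> f') \<boxdot> g = (f \<boxdot> g) \<oplus>\<^bsub>Hom C (X \<boxtimes> X') (Y \<boxtimes> Y')\<^esub> (f' \<boxdot> g)"
    and Tmor_add_right: "\<lbrakk>X \<in> Ob C; Y \<in> Ob C; X' \<in> Ob C; Y' \<in> Ob C;
          f \<in> mor C X Y; g \<in> mor C X' Y'; g' \<in> mor C X' Y'\<rbrakk>
          \<Longrightarrow> f \<boxdot> (g \<oplus>\<^bsub>Hom C X' Y'\<^esub> g') = (f \<boxdot> g) \<oplus>\<^bsub>Hom C (X \<boxtimes> X') (Y \<boxtimes> Y')\<^esub> (f \<boxdot> g')"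
    and Tmor_smult_left: "\<lbrakk>X \<in> Ob C; Y \<in> Ob C; X' \<in> Ob C; Y' \<in> Ob C; c \<in> carrier k;
          f \<in> mor C X Y; g \<in> mor C X' Y'\<rbrakk>
          \<Longrightarrow> (c \<odot>\<^bsub>Hom C X Y\<^esub> f) \<boxdot> g = c \<odot>\<^bsub>Hom C (X \<boxtimes> X') (Y \<boxtimes> Y')\<^esub> (f \<boxdot> g)"
    and Tmor_smult_right: "\<lbrakk>X \<in> Ob C; Y \<in> Ob C; X' \<in> Ob C; Y' \<in> Ob C; c \<in> carrier k;
          f \<in> mor C X Y; g \<in> mor C X' Y'\<rbrakk>
          \<Longrightarrow> f \<boxdot> (c \<odot>\<^bsub>Hom C X' Y'\<^esub> g) = c \<odot>\<^bsub>Hom C (X \<boxtimes> X') (Y \<boxtimes> Y')\<^esub> (f \<boxdot> g)"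
    \<comment> \<open>rigidity: every object has a dual and is itself a dual\<close>
    and left_duals: "X \<in> Ob C \<Longrightarrow> \<exists>Y. is_dual C X Y"
    and right_duals: "X \<in> Ob C \<Longrightarrow> \<exists>Y. is_dual C Y X"
    and Unit_simple: "simple_object C (Unit C)"
    \<comment> \<open>\<open>End(1) \<cong> k\<close> as k-algebras: the only unital k-algebra map is \<open>c \<mapsto> c \<cdot> id\<close>\<close>
    and Unit_End: "bij_betw (\<lambda>c. c \<odot>\<^bsub>Hom C (Unit C) (Unit C)\<^esub> Idm C (Unit C))
          (carrier k) (mor C (Unit C) (Unit C))"

fun Tpow :: "('k, 'o, 'm, 'z) mon_cat_scheme \<Rightarrow> 'o \<Rightarrow> nat \<Rightarrow> 'o"
  where
    "Tpow C X 0 = Unit C"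
  | "Tpow C X (Suc n) = X \<boxtimes>\<^bsub>C\<^esub> Tpow C X n"

section \<open>Functors\<close>

record ('o, 'm, 'p, 'n) fctr =
  Fob :: "'o \<Rightarrow> 'p"
  Fmor :: "'m \<Rightarrow> 'n"

definition is_functor ::
    "('k, 'o, 'm, 'y) lin_cat_scheme \<Rightarrow> ('k, 'p, 'n, 'z) lin_cat_scheme \<Rightarrow> ('o, 'm, 'p, 'n) fctr \<Rightarrow> bool"
  where "is_functor A B F \<longleftrightarrow>
    (\<forall>X \<in> Ob A. Fob F X \<in> Ob B) \<and>
    (\<forall>X \<in> Ob A. \<forall>Y \<in> Ob A. \<forall>f \<in> mor A X Y. Fmor F f \<in> mor B (Fob F X) (Fob F Y)) \<and>
    (\<forall>X \<in> Ob A. Fmor F (Idm A X) = Idm B (Fob F X)) \<and>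
    (\<forall>X \<in> Ob A. \<forall>Y \<in> Ob A. \<forall>Z \<in> Ob A. \<forall>f \<in> mor A X Y. \<forall>g \<in> mor A Y Z.
       Fmor F (g \<cdot>\<^bsub>A\<^esub> f) = Fmor F g \<cdot>\<^bsub>B\<^esub> Fmor F f)"

definition linear_functor ::
    "('k, 'r) ring_scheme \<Rightarrow> ('k, 'o, 'm, 'y) lin_cat_scheme \<Rightarrow> ('k, 'p, 'n, 'z) lin_cat_scheme \<Rightarrow>
     ('o, 'm, 'p, 'n) fctr \<Rightarrow> bool"
  where "linear_functor k A B F \<longleftrightarrow> is_functor A B F \<and>
    (\<forall>X \<in> Ob A. \<forall>Y \<in> Ob A. \<forall>f \<in> mor A X Y. \<forall>g \<in> mor A X Y.
       Fmor F (f \<oplus>\<^bsub>Hom A X Y\<^esub> g) = Fmor F f \<oplus>\<^bsub>Hom B (Fob F X) (Fob F Y)\<^esub> Fmor F g) \<and>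
    (\<forall>X \<in> Ob A. \<forall>Y \<in> Ob A. \<forall>c \<in> carrier k. \<forall>f \<in> mor A X Y.
       Fmor F (c \<odot>\<^bsub>Hom A X Y\<^esub> f) = c \<odot>\<^bsub>Hom B (Fob F X) (Fob F Y)\<^esub> Fmor F f)"

definition exact_functor ::
    "('k, 'o, 'm, 'y) lin_cat_scheme \<Rightarrow> ('k, 'p, 'n, 'z) lin_cat_scheme \<Rightarrow> ('o, 'm, 'p, 'n) fctr \<Rightarrow> bool"
  where "exact_functor A B F \<longleftrightarrow> is_functor A B F \<and>
    (\<forall>X Y Z f g. short_exact A X Y Z f g \<longrightarrow>
       short_exact B (Fob F X) (Fob F Y) (Fob F Z) (Fmor F f) (Fmor F g))"

definition faithful_functor ::
    "('k, 'o, 'm, 'y) lin_cat_scheme \<Rightarrow> ('k, 'p, 'n, 'z) lin_cat_scheme \<Rightarrow> ('o, 'm, 'p, 'n) fctr \<Rightarrow> bool"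
  where "faithful_functor A B F \<longleftrightarrow> is_functor A B F \<and>
    (\<forall>X \<in> Ob A. \<forall>Y \<in> Ob A. inj_on (Fmor F) (mor A X Y))"

text \<open>
  A (strong) monoidal functor between strict monoidal categories: a natural isomorphism
  \<open>J X Y : F X \<boxtimes> F Y \<rightarrow> F (X \<boxtimes> Y)\<close> and an isomorphism \<open>e : 1 \<rightarrow> F 1\<close>,
  coherent with associativity and unit.  F itself need not be strict.
\<close>

definition monoidal_functor ::
    "('k, 'o, 'm, 'y) mon_cat_scheme \<Rightarrow> ('k, 'p, 'n, 'z) mon_cat_scheme \<Rightarrow> ('o, 'm, 'p, 'n) fctr \<Rightarrow>
     ('o \<Rightarrow> 'o \<Rightarrow> 'n) \<Rightarrow> 'n \<Rightarrow> bool"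
  where "monoidal_functor A B F J e \<longleftrightarrow> is_functor A B F \<and>
    (\<forall>X \<in> Ob A. \<forall>Y \<in> Ob A.
       invertible B (Fob F X \<boxtimes>\<^bsub>B\<^esub> Fob F Y) (Fob F (X \<boxtimes>\<^bsub>A\<^esub> Y)) (J X Y)) \<and>
    invertible B (Unit B) (Fob F (Unit A)) e \<and>
    (\<forall>X \<in> Ob A. \<forall>Y \<in> Ob A. \<forall>X' \<in> Ob A. \<forall>Y' \<in> Ob A. \<forall>f \<in> mor A X X'. \<forall>g \<in> mor A Y Y'.
       J X' Y' \<cdot>\<^bsub>B\<^esub> (Fmor F f \<boxdot>\<^bsub>B\<^esub> Fmor F g) = Fmor F (f \<boxdot>\<^bsub>A\<^esub> g) \<cdot>\<^bsub>B\<^esub> J X Y) \<and>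
    (\<forall>X \<in> Ob A. \<forall>Y \<in> Ob A. \<forall>Z \<in> Ob A.
       J (X \<boxtimes>\<^bsub>A\<^esub> Y) Z \<cdot>\<^bsub>B\<^esub> (J X Y \<boxdot>\<^bsub>B\<^esub> Idm B (Fob F Z)) =
       J X (Y \<boxtimes>\<^bsub>A\<^esub> Z) \<cdot>\<^bsub>B\<^esub> (Idm B (Fob F X) \<boxdot>\<^bsub>B\<^esub> J Y Z)) \<and>
    (\<forall>X \<in> Ob A.
       J (Unit A) X \<cdot>\<^bsub>B\<^esub> (e \<boxdot>\<^bsub>B\<^esub> Idm B (Fob F X)) = Idm B (Fob F X) \<and>
       J X (Unit A) \<cdot>\<^bsub>B\<^esub> (Idm B (Fob F X) \<boxdot>\<^bsub>B\<^esub> e) = Idm B (Fob F X))"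

definition has_left_adjoint ::
    "('k, 'o, 'm, 'y) lin_cat_scheme \<Rightarrow> ('k, 'p, 'n, 'z) lin_cat_scheme \<Rightarrow> ('o, 'm, 'p, 'n) fctr \<Rightarrow> bool"
  where "has_left_adjoint A B U \<longleftrightarrow>
    (\<exists>(F :: ('p, 'n, 'o, 'm) fctr) (\<phi> :: 'p \<Rightarrow> 'o \<Rightarrow> 'm \<Rightarrow> 'n). is_functor B A F \<and>
       (\<forall>X \<in> Ob B. \<forall>Y \<in> Ob A. bij_betw (\<phi> X Y) (mor A (Fob F X) Y) (mor B X (Fob U Y))) \<and>
       (\<forall>X \<in> Ob B. \<forall>X' \<in> Ob B. \<forall>Y \<in> Ob A. \<forall>Y' \<in> Ob A.
          \<forall>h \<in> mor B X' X. \<forall>f \<in> mor A (Fob F X) Y. \<forall>g \<in> mor A Y Y'.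
            \<phi> X' Y' (g \<cdot>\<^bsub>A\<^esub> f \<cdot>\<^bsub>A\<^esub> Fmor F h) = Fmor U g \<cdot>\<^bsub>B\<^esub> \<phi> X Y f \<cdot>\<^bsub>B\<^esub> h))"

section \<open>Relative Ext\<close>

definition allowable ::
    "('k, 'o, 'm, 'y) lin_cat_scheme \<Rightarrow> ('k, 'p, 'n, 'z) lin_cat_scheme \<Rightarrow> ('o, 'm, 'p, 'n) fctr \<Rightarrow>
     'o \<Rightarrow> 'o \<Rightarrow> 'm \<Rightarrow> bool"
  where "allowable A B U X Y f \<longleftrightarrow> X \<in> Ob A \<and> Y \<in> Ob A \<and> f \<in> mor A X Y \<and>
    (\<exists>s \<in> mor B (Fob U Y) (Fob U X). Fmor U f \<cdot>\<^bsub>B\<^esub> s \<cdot>\<^bsub>B\<^esub> Fmor U f = Fmor U f)"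

text \<open>The zero morphisms at both ends of a short exact sequence are allowable anyway.\<close>

definition allowable_short_exact ::
    "('k, 'o, 'm, 'y) lin_cat_scheme \<Rightarrow> ('k, 'p, 'n, 'z) lin_cat_scheme \<Rightarrow> ('o, 'm, 'p, 'n) fctr \<Rightarrow>
     'o \<Rightarrow> 'o \<Rightarrow> 'o \<Rightarrow> 'm \<Rightarrow> 'm \<Rightarrow> bool"
  where "allowable_short_exact A B U X Y Z f g \<longleftrightarrow>
    short_exact A X Y Z f g \<and> allowable A B U X Y f \<and> allowable A B U Y Z g"

definition rel_projective ::
    "('k, 'o, 'm, 'y) lin_cat_scheme \<Rightarrow> ('k, 'p, 'n, 'z) lin_cat_scheme \<Rightarrow> ('o, 'm, 'p, 'n) fctr \<Rightarrow>
     'o \<Rightarrow> bool"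
  where "rel_projective A B U P \<longleftrightarrow> P \<in> Ob A \<and>
    (\<forall>X Y g. epic A X Y g \<and> allowable A B U X Y g \<longrightarrow>
       (\<forall>f \<in> mor A P Y. \<exists>h \<in> mor A P X. g \<cdot>\<^bsub>A\<^esub> h = f))"

text \<open>
  An augmented complex \<open>\<dots> \<rightarrow> P\<^sub>1 \<rightarrow> P\<^sub>0 \<rightarrow> V \<rightarrow> 0\<close>: \<open>Rterm\<close> gives the \<open>P\<^sub>n\<close>,
  \<open>Rdiff n : P\<^sub>n\<^sub>+\<^sub>1 \<rightarrow> P\<^sub>n\<close>, and \<open>Raug : P\<^sub>0 \<rightarrow> V\<close>.
\<close>

record ('o, 'm) aug_complex =
  Rterm :: "nat \<Rightarrow> 'o"
  Rdiff :: "nat \<Rightarrow> 'm"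
  Raug :: "'m"

definition rel_proj_resolution ::
    "('k, 'o, 'm, 'y) lin_cat_scheme \<Rightarrow> ('k, 'p, 'n, 'z) lin_cat_scheme \<Rightarrow> ('o, 'm, 'p, 'n) fctr \<Rightarrow>
     'o \<Rightarrow> ('o, 'm) aug_complex \<Rightarrow> bool"
  where "rel_proj_resolution A B U V R \<longleftrightarrow>
    (\<forall>n. rel_projective A B U (Rterm R n)) \<and>
    (\<forall>n. allowable A B U (Rterm R (Suc n)) (Rterm R n) (Rdiff R n)) \<and>
    allowable A B U (Rterm R 0) V (Raug R) \<and>
    epic A (Rterm R 0) V (Raug R) \<and>
    exact_at A (Rterm R 1) (Rterm R 0) V (Rdiff R 0) (Raug R) \<and>
    (\<forall>n. exact_at A (Rterm R (Suc (Suc n))) (Rterm R (Suc n)) (Rterm R n) (Rdiff R (Suc n)) (Rdiff R n))"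

text \<open>The n-th cohomology of \<open>0 \<rightarrow> Hom(P\<^sub>0,W) \<rightarrow> Hom(P\<^sub>1,W) \<rightarrow> \<dots>\<close>, cocycles modulo coboundaries.\<close>

definition hom_cohomology ::
    "('k, 'o, 'm, 'y) lin_cat_scheme \<Rightarrow> ('o, 'm) aug_complex \<Rightarrow> nat \<Rightarrow> 'o \<Rightarrow> ('k, 'm set) module"
  where "hom_cohomology C R n W =
    quot_module
      ((Hom C (Rterm R n) W)\<lparr>carrier :=
         {f \<in> mor C (Rterm R n) W. f \<cdot>\<^bsub>C\<^esub> Rdiff R n = zero_mor C (Rterm R (Suc n)) W}\<rparr>)
      (case n of
         0 \<Rightarrow> {zero_mor C (Rterm R 0) W}
       | Suc m \<Rightarrow> (\<lambda>f. f \<cdot>\<^bsub>C\<^esub> Rdiff R m) ` mor C (Rterm R m) W)"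

text \<open>
  Computed from a chosen resolution; up to isomorphism the result does not depend on the
  choice, and resolutions exist as soon as U has a left adjoint.
\<close>

definition rel_Ext ::
    "('k, 'o, 'm, 'y) lin_cat_scheme \<Rightarrow> ('k, 'p, 'n, 'z) lin_cat_scheme \<Rightarrow> ('o, 'm, 'p, 'n) fctr \<Rightarrow>
     nat \<Rightarrow> 'o \<Rightarrow> 'o \<Rightarrow> ('k, 'm set) module"
  where "rel_Ext A B U n V W = hom_cohomology A (SOME R. rel_proj_resolution A B U V R) n W"

end

theory Submission
  imports Defs
begin

text \<open>
  The theorem is a dimension shift along explicit syzygies.

  Let \<open>0 \<rightarrow> S(m+1) \<rightarrow> P(m) \<rightarrow> S(m) \<rightarrow> 0\<close> be allowable short exact sequences with relatively
  projective \<open>P(m)\<close> and \<open>S(0) = V\<close>.  Spliced together they resolve V, and a cocycle on \<open>P(m+1)\<close> is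
  the same thing as a map on \<open>S(m+1)\<close>.  Hence \<open>Ext\<close> in degree \<open>m+1\<close> is \<open>Hom(S(m+1), W)\<close> modulo
  the maps that extend to \<open>P(m)\<close> (\<open>cohomology_syzygy\<close>).  Relative Ext is computed from an arbitrarily
  chosen resolution, so it matters that this quotient does not depend on the syzygies: those of two
  resolutions are related by maps that are mutually inverse up to maps extending to the
  projectives, and the latter die in the quotient (\<open>stable_retract_syzygy\<close>,
  \<open>syzygy_quot_invariant\<close>).

  In a rigid category one presentation \<open>K \<rightarrow> P \<rightarrow> 1\<close> of the unit yields syzygies of every object.
  Since \<open>- \<boxtimes> X\<close> has adjoints on both sides, it is exact (\<open>tensor_ses\<close>); since U is monoidal, it
  preserves allowable maps (\<open>tensor_allowable\<close>); and \<open>P \<boxtimes> X\<close> is relatively projective because the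
  right adjoint \<open>- \<boxtimes> X\<^sup>\<or>\<close> preserves allowable epimorphisms (\<open>tensor_projective\<close>).  So
  \<open>K \<boxtimes> X \<rightarrow> P \<boxtimes> X \<rightarrow> X\<close> presents X.  Starting with \<open>L \<rightarrow> Q \<rightarrow> V\<close> and repeating this step, the n-th
  syzygy of V is \<open>K \<boxtimes> X\<close> inside \<open>P \<boxtimes> X\<close>, where X is the product of \<open>n-2\<close> copies of K and L.
  For \<open>n = 1\<close> one takes \<open>X = V\<close>.

  It remains to move X to the other side: \<open>Hom(T \<boxtimes> X, W) \<cong> Hom(T, M\<^sub>n)\<close> naturally in T, one dual
  for each factor of X (\<open>internal_hom_tensor\<close>).  Naturality along \<open>j : K \<rightarrow> P\<close> identifies the maps
  that extend to \<open>P \<boxtimes> X\<close> with the image of \<open>j\<^sup>*\<close> (\<open>internal_hom_quot\<close>).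
\<close>

section \<open>Isomorphisms of quotient modules\<close>

definition linear_map ::
    "('k, 'r) ring_scheme \<Rightarrow> ('k, 'm, 'y) module_scheme \<Rightarrow> ('k, 'n, 'z) module_scheme \<Rightarrow> ('m \<Rightarrow> 'n) \<Rightarrow> bool"
  where "linear_map k M M' h \<longleftrightarrow>
    (\<forall>x \<in> carrier M. h x \<in> carrier M') \<and>
    (\<forall>x \<in> carrier M. \<forall>y \<in> carrier M. h (x \<oplus>\<^bsub>M\<^esub> y) = h x \<oplus>\<^bsub>M'\<^esub> h y) \<and>
    (\<forall>c \<in> carrier k. \<forall>x \<in> carrier M. h (c \<odot>\<^bsub>M\<^esub> x) = c \<odot>\<^bsub>M'\<^esub> h x)"

lemma abelian_subgroup_of_submodule:
  assumes "module k M" and "submodule N k M"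
  shows "abelian_subgroup N M"
  using assms abelian_subgroupI3 additive_subgroup_def module.axioms(2) submodule.axioms(1) by blast

lemma linear_map_zero:
  assumes "module k M" and "module k M'" and "linear_map k M M' h"
  shows "h \<zero>\<^bsub>M\<^esub> = \<zero>\<^bsub>M'\<^esub>"
proof -
  interpret M: module k M by (rule assms)
  interpret M': module k M' by (rule assms)
  have h0: "h \<zero>\<^bsub>M\<^esub> \<in> carrier M'" using assms(3) by (simp add: linear_map_def)
  have "h \<zero>\<^bsub>M\<^esub> \<oplus>\<^bsub>M'\<^esub> h \<zero>\<^bsub>M\<^esub> = h (\<zero>\<^bsub>M\<^esub> \<oplus>\<^bsub>M\<^esub> \<zero>\<^bsub>M\<^esub>)"
    using assms(3) unfolding linear_map_def by (metis M.zero_closed)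
  then show ?thesis using h0 by simp
qed

lemma linear_map_minus:
  assumes "module k M" and "module k M'" and "linear_map k M M' h" and "x \<in> carrier M"
  shows "h (\<ominus>\<^bsub>M\<^esub> x) = \<ominus>\<^bsub>M'\<^esub> h x"
proof -
  interpret M: module k M by (rule assms)
  interpret M': module k M' by (rule assms)
  have "h (\<ominus>\<^bsub>M\<^esub> x) \<oplus>\<^bsub>M'\<^esub> h x = h (\<ominus>\<^bsub>M\<^esub> x \<oplus>\<^bsub>M\<^esub> x)"
    using assms(3,4) unfolding linear_map_def by (metis M.a_inv_closed)
  also have "\<dots> = \<zero>\<^bsub>M'\<^esub>"
    using linear_map_zero[OF assms(1-3)] assms(4) by (simp add: M.l_neg)
  finally show ?thesis
    using M'.minus_equality[of "h (\<ominus>\<^bsub>M\<^esub> x)" "h x"] assms(3,4) by (simp add: linear_map_def)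
qed

lemma linear_map_compose:
  assumes "linear_map k M M' f" and "linear_map k M' M'' g"
  shows "linear_map k M M'' (\<lambda>x. g (f x))"
  using assms unfolding linear_map_def by auto

lemma linear_map_image_submodule:
  assumes "module k M" and "module k M'" and "linear_map k M M' h"
  shows "submodule (h ` carrier M) k M'"
proof -
  interpret M: module k M by (rule assms)
  interpret M': module k M' by (rule assms)
  have hc: "\<And>x. x \<in> carrier M \<Longrightarrow> h x \<in> carrier M'"
    and ha: "\<And>x y. x \<in> carrier M \<Longrightarrow> y \<in> carrier M \<Longrightarrow> h x \<oplus>\<^bsub>M'\<^esub> h y = h (x \<oplus>\<^bsub>M\<^esub> y)"
    and hs: "\<And>c x. c \<in> carrier k \<Longrightarrow> x \<in> carrier M \<Longrightarrow> c \<odot>\<^bsub>M'\<^esub> h x = h (c \<odot>\<^bsub>M\<^esub> x)"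
    using assms(3) by (auto simp: linear_map_def)
  have hz: "\<zero>\<^bsub>M'\<^esub> = h \<zero>\<^bsub>M\<^esub>"
    and hm: "\<And>x. x \<in> carrier M \<Longrightarrow> \<ominus>\<^bsub>M'\<^esub> h x = h (\<ominus>\<^bsub>M\<^esub> x)"
    using linear_map_zero[OF assms] linear_map_minus[OF assms] by simp_all
  show ?thesis
    by (rule M'.submoduleI) (auto simp: hc ha hs hz hm)
qed

lemma linear_map_kernel_submodule:
  assumes "module k M" and "module k M'" and "linear_map k M M' h"
  shows "submodule {x \<in> carrier M. h x = \<zero>\<^bsub>M'\<^esub>} k M"
proof -
  interpret M: module k M by (rule assms)
  interpret M': module k M' by (rule assms)
  have ha: "\<And>x y. x \<in> carrier M \<Longrightarrow> y \<in> carrier M \<Longrightarrow> h (x \<oplus>\<^bsub>M\<^esub> y) = h x \<oplus>\<^bsub>M'\<^esub> h y"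
    and hs: "\<And>c x. c \<in> carrier k \<Longrightarrow> x \<in> carrier M \<Longrightarrow> h (c \<odot>\<^bsub>M\<^esub> x) = c \<odot>\<^bsub>M'\<^esub> h x"
    using assms(3) by (auto simp: linear_map_def)
  show ?thesis
    by (rule M.submoduleI) (auto simp: ha hs linear_map_zero[OF assms] linear_map_minus[OF assms])
qed

lemma mem_coset_iff:
  assumes "module k M" and "submodule N k M" and "x \<in> carrier M" and "y \<in> carrier M"
  shows "y \<in> N +>\<^bsub>M\<^esub> x \<longleftrightarrow> y \<ominus>\<^bsub>M\<^esub> x \<in> N"
proof -
  interpret M: module k M by (rule assms)
  interpret N: abelian_subgroup N M by (rule abelian_subgroup_of_submodule[OF assms(1,2)])
  show ?thesis
    unfolding a_r_coset_def'
  proof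
    assume "y \<in> (\<Union>h\<in>N. {h \<oplus>\<^bsub>M\<^esub> x})"
    then obtain n where n: "n \<in> N" "y = n \<oplus>\<^bsub>M\<^esub> x" by blast
    then show "y \<ominus>\<^bsub>M\<^esub> x \<in> N"
      using assms(3) N.a_Hcarr by (simp add: a_minus_def M.a_assoc M.r_neg)
  next
    assume "y \<ominus>\<^bsub>M\<^esub> x \<in> N"
    moreover have "y = (y \<ominus>\<^bsub>M\<^esub> x) \<oplus>\<^bsub>M\<^esub> x"
      using assms(3,4) by (simp add: a_minus_def M.a_assoc M.l_neg)
    ultimately show "y \<in> (\<Union>h\<in>N. {h \<oplus>\<^bsub>M\<^esub> x})" by blast
  qed
qed

lemma coset_eq_iff:
  assumes "module k M" and "submodule N k M" and "x \<in> carrier M" and "y \<in> carrier M"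
  shows "N +>\<^bsub>M\<^esub> x = N +>\<^bsub>M\<^esub> y \<longleftrightarrow> y \<ominus>\<^bsub>M\<^esub> x \<in> N"
proof -
  interpret N: abelian_subgroup N M by (rule abelian_subgroup_of_submodule[OF assms(1,2)])
  show ?thesis
    using mem_coset_iff[OF assms] N.a_repr_independence' N.a_repr_independenceD assms(3,4) by blast
qed

lemma smult_coset:
  assumes "module k M" and "submodule N k M" and "c \<in> carrier k" and "x \<in> carrier M"
  shows "N <+>\<^bsub>M\<^esub> (\<lambda>y. c \<odot>\<^bsub>M\<^esub> y) ` (N +>\<^bsub>M\<^esub> x) = N +>\<^bsub>M\<^esub> (c \<odot>\<^bsub>M\<^esub> x)"
proof -
  interpret M: module k M by (rule assms)
  interpret N: abelian_subgroup N M by (rule abelian_subgroup_of_submodule[OF assms(1,2)])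
  note N = M.submoduleE[OF assms(2)]
  show ?thesis
  proof (intro equalityI subsetI)
    fix z assume "z \<in> N <+>\<^bsub>M\<^esub> (\<lambda>y. c \<odot>\<^bsub>M\<^esub> y) ` (N +>\<^bsub>M\<^esub> x)"
    then obtain n n' where n: "n \<in> N" "n' \<in> N" "z = n \<oplus>\<^bsub>M\<^esub> c \<odot>\<^bsub>M\<^esub> (n' \<oplus>\<^bsub>M\<^esub> x)"
      unfolding set_add_def' a_r_coset_def' by blast
    then have "z = (n \<oplus>\<^bsub>M\<^esub> c \<odot>\<^bsub>M\<^esub> n') \<oplus>\<^bsub>M\<^esub> c \<odot>\<^bsub>M\<^esub> x"
      using assms(3,4) by (simp add: M.smult_r_distr M.a_assoc N.a_Hcarr)
    moreover have "n \<oplus>\<^bsub>M\<^esub> c \<odot>\<^bsub>M\<^esub> n' \<in> N" using n(1,2) N(4,5) assms(3) by simp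
    ultimately show "z \<in> N +>\<^bsub>M\<^esub> (c \<odot>\<^bsub>M\<^esub> x)"
      unfolding a_r_coset_def' by blast
  next
    fix z assume "z \<in> N +>\<^bsub>M\<^esub> (c \<odot>\<^bsub>M\<^esub> x)"
    then obtain n where "n \<in> N" "z = n \<oplus>\<^bsub>M\<^esub> c \<odot>\<^bsub>M\<^esub> x" unfolding a_r_coset_def' by blast
    then show "z \<in> N <+>\<^bsub>M\<^esub> (\<lambda>y. c \<odot>\<^bsub>M\<^esub> y) ` (N +>\<^bsub>M\<^esub> x)"
      using N.a_rcos_self[OF assms(4)] unfolding set_add_def' by blast
  qed
qed

text \<open>
  A linear map that is injective and surjective modulo the two submodules descends to an
  isomorphism of the quotients.  On cosets it is \<open>S \<mapsto> N' + h(S)\<close>, which needs no choice of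
  representatives.
\<close>

lemma quot_module_isomorphicI:
  assumes M: "module k M" and M': "module k M'"
    and N: "submodule N k M" and N': "submodule N' k M'"
    and h: "linear_map k M M' h"
    and ker: "\<And>x. x \<in> carrier M \<Longrightarrow> h x \<in> N' \<longleftrightarrow> x \<in> N"
    and surj: "\<And>y. y \<in> carrier M' \<Longrightarrow> \<exists>x \<in> carrier M. y \<ominus>\<^bsub>M'\<^esub> h x \<in> N'"
  shows "module_isomorphic k (quot_module M N) (quot_module M' N')"
proof -
  interpret M: module k M by (rule M)
  interpret M': module k M' by (rule M')
  interpret N: abelian_subgroup N M by (rule abelian_subgroup_of_submodule[OF M N])
  interpret N': abelian_subgroup N' M' by (rule abelian_subgroup_of_submodule[OF M' N'])
  define H where "H S = N' <+>\<^bsub>M'\<^esub> h ` S" for S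
  have hc: "\<And>x. x \<in> carrier M \<Longrightarrow> h x \<in> carrier M'"
    and ha: "\<And>x y. x \<in> carrier M \<Longrightarrow> y \<in> carrier M \<Longrightarrow> h (x \<oplus>\<^bsub>M\<^esub> y) = h x \<oplus>\<^bsub>M'\<^esub> h y"
    and hs: "\<And>c x. c \<in> carrier k \<Longrightarrow> x \<in> carrier M \<Longrightarrow> h (c \<odot>\<^bsub>M\<^esub> x) = c \<odot>\<^bsub>M'\<^esub> h x"
    using h by (auto simp: linear_map_def)
  have hN: "\<And>n. n \<in> N \<Longrightarrow> h n \<in> N'" using ker N.a_Hcarr by blast
  have H: "H (N +>\<^bsub>M\<^esub> x) = N' +>\<^bsub>M'\<^esub> h x" if x: "x \<in> carrier M" for x
  proof (intro equalityI subsetI)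
    fix z assume "z \<in> H (N +>\<^bsub>M\<^esub> x)"
    then obtain n' n where n: "n' \<in> N'" "n \<in> N" "z = n' \<oplus>\<^bsub>M'\<^esub> h (n \<oplus>\<^bsub>M\<^esub> x)"
      unfolding H_def set_add_def' a_r_coset_def' by blast
    then have "z = (n' \<oplus>\<^bsub>M'\<^esub> h n) \<oplus>\<^bsub>M'\<^esub> h x"
      using x by (simp add: ha hc N.a_Hcarr N'.a_Hcarr M'.a_assoc)
    then show "z \<in> N' +>\<^bsub>M'\<^esub> h x"
      using n hN M'.submoduleE(5)[OF N'] unfolding a_r_coset_def' by blast
  next
    fix z assume "z \<in> N' +>\<^bsub>M'\<^esub> h x"
    then show "z \<in> H (N +>\<^bsub>M\<^esub> x)"
      using N.a_rcos_self[OF x] unfolding H_def set_add_def' a_r_coset_def' by blast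
  qed
  have cosets: "a_rcosets\<^bsub>M\<^esub> N = (\<lambda>x. N +>\<^bsub>M\<^esub> x) ` carrier M"
    "a_rcosets\<^bsub>M'\<^esub> N' = (\<lambda>x. N' +>\<^bsub>M'\<^esub> x) ` carrier M'"
    by (auto simp: A_RCOSETS_def')
  have hdiff: "h y \<ominus>\<^bsub>M'\<^esub> h x = h (y \<ominus>\<^bsub>M\<^esub> x)" if "x \<in> carrier M" "y \<in> carrier M" for x y
    using that by (simp add: a_minus_def ha linear_map_minus[OF M M' h])
  have "inj_on H (a_rcosets\<^bsub>M\<^esub> N)"
    unfolding cosets inj_on_def
    using H coset_eq_iff[OF M N] coset_eq_iff[OF M' N'] hc hdiff ker by auto
  moreover have "H ` (a_rcosets\<^bsub>M\<^esub> N) = a_rcosets\<^bsub>M'\<^esub> N'"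
  proof
    show "H ` (a_rcosets\<^bsub>M\<^esub> N) \<subseteq> a_rcosets\<^bsub>M'\<^esub> N'"
      unfolding cosets using H hc by auto
    show "a_rcosets\<^bsub>M'\<^esub> N' \<subseteq> H ` (a_rcosets\<^bsub>M\<^esub> N)"
    proof
      fix S assume "S \<in> a_rcosets\<^bsub>M'\<^esub> N'"
      then obtain y where y: "y \<in> carrier M'" "S = N' +>\<^bsub>M'\<^esub> y" unfolding cosets by blast
      obtain x where x: "x \<in> carrier M" "y \<ominus>\<^bsub>M'\<^esub> h x \<in> N'" using surj[OF y(1)] by blast
      then have "S = H (N +>\<^bsub>M\<^esub> x)"
        using y hc coset_eq_iff[OF M' N'] H by metis
      then show "S \<in> H ` (a_rcosets\<^bsub>M\<^esub> N)" using x unfolding cosets by blast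
    qed
  qed
  moreover have "H (S <+>\<^bsub>M\<^esub> T) = H S <+>\<^bsub>M'\<^esub> H T"
    if "S \<in> a_rcosets\<^bsub>M\<^esub> N" "T \<in> a_rcosets\<^bsub>M\<^esub> N" for S T
    using that unfolding cosets
    by (auto simp: H N.a_rcos_sum N'.a_rcos_sum hc ha)
  moreover have "H (N <+>\<^bsub>M\<^esub> (\<lambda>x. c \<odot>\<^bsub>M\<^esub> x) ` S) = N' <+>\<^bsub>M'\<^esub> (\<lambda>x. c \<odot>\<^bsub>M'\<^esub> x) ` H S"
    if "c \<in> carrier k" "S \<in> a_rcosets\<^bsub>M\<^esub> N" for c S
    using that unfolding cosets
    by (auto simp: H smult_coset[OF M N] smult_coset[OF M' N'] hc hs)
  ultimately show ?thesis
    unfolding module_isomorphic_def quot_module_def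
    by (intro bexI[of _ H]) (auto simp: iso_def hom_def bij_betw_def)
qed

lemma module_isomorphic_trans:
  assumes "module_isomorphic k M M'" and "module_isomorphic k M' M''"
  shows "module_isomorphic k M M''"
proof -
  obtain f g where f: "f \<in> iso (add_monoid M) (add_monoid M')"
      "\<forall>c \<in> carrier k. \<forall>x \<in> carrier M. f (c \<odot>\<^bsub>M\<^esub> x) = c \<odot>\<^bsub>M'\<^esub> f x"
    and g: "g \<in> iso (add_monoid M') (add_monoid M'')"
      "\<forall>c \<in> carrier k. \<forall>x \<in> carrier M'. g (c \<odot>\<^bsub>M'\<^esub> x) = c \<odot>\<^bsub>M''\<^esub> g x"
    using assms unfolding module_isomorphic_def by blast
  have "\<And>x. x \<in> carrier M \<Longrightarrow> f x \<in> carrier M'"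
    using f(1) by (auto simp: iso_def hom_def)
  then show ?thesis
    unfolding module_isomorphic_def
    using iso_set_trans[OF f(1) g(1)] f(2) g(2) by (intro bexI[of _ "g \<circ> f"]) auto
qed

section \<open>Calculus in linear categories\<close>

context linear_category
begin

text \<open>
  The Hom modules of different pairs of objects are disjoint, so a morphism determines its
  source and target, and two morphisms are composable exactly when \<open>tgt f = src g\<close>.
\<close>

definition arr :: "'m \<Rightarrow> bool"
  where "arr f \<longleftrightarrow> (\<exists>X \<in> Ob C. \<exists>Y \<in> Ob C. f \<in> mor C X Y)"

definition src :: "'m \<Rightarrow> 'o"
  where "src f = (THE X. X \<in> Ob C \<and> (\<exists>Y \<in> Ob C. f \<in> mor C X Y))"

definition tgt :: "'m \<Rightarrow> 'o"
  where "tgt f = (THE Y. Y \<in> Ob C \<and> (\<exists>X \<in> Ob C. f \<in> mor C X Y))"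

lemma src_tgt_eq:
  assumes "X \<in> Ob C" and "Y \<in> Ob C" and "f \<in> mor C X Y"
  shows "src f = X" and "tgt f = Y"
proof -
  have "X' = X \<and> Y' = Y" if "X' \<in> Ob C" "Y' \<in> Ob C" "f \<in> mor C X' Y'" for X' Y'
    using Hom_disjoint[OF that(1,2) assms(1,2) that(3) assms(3)] .
  then show "src f = X" and "tgt f = Y"
    unfolding src_def tgt_def using assms by (blast intro: the_equality)+
qed

lemma mor_iff [simp]:
  assumes "X \<in> Ob C" and "Y \<in> Ob C"
  shows "f \<in> mor C X Y \<longleftrightarrow> arr f \<and> src f = X \<and> tgt f = Y"
proof
  assume "f \<in> mor C X Y"
  then show "arr f \<and> src f = X \<and> tgt f = Y"
    using assms src_tgt_eq[OF assms] unfolding arr_def by blast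
next
  assume f: "arr f \<and> src f = X \<and> tgt f = Y"
  then obtain X' Y' where "X' \<in> Ob C" "Y' \<in> Ob C" "f \<in> mor C X' Y'" unfolding arr_def by blast
  then show "f \<in> mor C X Y" using f src_tgt_eq[of X' Y' f] by metis
qed

lemma Ob_src_tgt [simp]:
  assumes "arr f"
  shows "src f \<in> Ob C" and "tgt f \<in> Ob C"
proof -
  obtain X Y where "X \<in> Ob C" "Y \<in> Ob C" "f \<in> mor C X Y"
    using assms unfolding arr_def by blast
  then show "src f \<in> Ob C" and "tgt f \<in> Ob C" using src_tgt_eq[of X Y f] by metis+
qed

lemma Idm_simps [simp]:
  assumes "X \<in> Ob C"
  shows "arr (Idm C X)" and "src (Idm C X) = X" and "tgt (Idm C X) = X"
  using Id_closed[OF assms] assms by auto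

lemma Comp_simps [simp]:
  assumes "arr f" and "arr g" and "tgt f = src g"
  shows "arr (g \<cdot> f)" and "src (g \<cdot> f) = src f" and "tgt (g \<cdot> f) = tgt g"
  using Comp_closed[of "src f" "src g" "tgt g" f g] assms by auto

lemma assoc [simp]:
  assumes "arr f" and "arr g" and "arr h" and "tgt f = src g" and "tgt g = src h"
  shows "(h \<cdot> g) \<cdot> f = h \<cdot> (g \<cdot> f)"
  using Comp_assoc[of "src f" "src g" "src h" "tgt h" f g h] assms by auto

lemma Idm_left [simp]: "arr f \<Longrightarrow> tgt f = Y \<Longrightarrow> Idm C Y \<cdot> f = f"
  using Id_left[of "src f" Y f] by auto

lemma Idm_right [simp]: "arr f \<Longrightarrow> src f = X \<Longrightarrow> f \<cdot> Idm C X = f"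
  using Id_right[of X "tgt f" f] by auto

lemma Hom_abelian_group: "X \<in> Ob C \<Longrightarrow> Y \<in> Ob C \<Longrightarrow> abelian_group (Hom C X Y)"
  using Hom_module module.axioms(2) by blast

lemma zero_simps [simp]:
  assumes "X \<in> Ob C" and "Y \<in> Ob C"
  shows "arr (zero_mor C X Y)" and "src (zero_mor C X Y) = X" and "tgt (zero_mor C X Y) = Y"
  using abelian_groupE(2)[OF Hom_abelian_group[OF assms]] assms by auto

lemma add_simps [simp]:
  assumes "X \<in> Ob C" and "Y \<in> Ob C"
    and "arr f" "src f = X" "tgt f = Y" and "arr g" "src g = X" "tgt g = Y"
  shows "arr (f \<oplus>\<^bsub>Hom C X Y\<^esub> g)" and "src (f \<oplus>\<^bsub>Hom C X Y\<^esub> g) = X" and "tgt (f \<oplus>\<^bsub>Hom C X Y\<^esub> g) = Y"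
  using abelian_groupE(1)[OF Hom_abelian_group[OF assms(1,2)], of f g] assms by auto

lemma minus_simps [simp]:
  assumes "X \<in> Ob C" and "Y \<in> Ob C"
    and "arr f" "src f = X" "tgt f = Y" and "arr g" "src g = X" "tgt g = Y"
  shows "arr (f \<ominus>\<^bsub>Hom C X Y\<^esub> g)" and "src (f \<ominus>\<^bsub>Hom C X Y\<^esub> g) = X" and "tgt (f \<ominus>\<^bsub>Hom C X Y\<^esub> g) = Y"
  using abelian_group.minus_closed[OF Hom_abelian_group[OF assms(1,2)], of f g] assms by auto

lemma smult_simps [simp]:
  assumes "X \<in> Ob C" and "Y \<in> Ob C" and "c \<in> carrier k" and "arr f" "src f = X" "tgt f = Y"
  shows "arr (c \<odot>\<^bsub>Hom C X Y\<^esub> f)" and "src (c \<odot>\<^bsub>Hom C X Y\<^esub> f) = X" and "tgt (c \<odot>\<^bsub>Hom C X Y\<^esub> f) = Y"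
  using module.smult_closed[OF Hom_module[OF assms(1,2)], of c f] assms by auto

lemma precomp_linear:
  assumes "arr f" and "Z \<in> Ob C"
  shows "linear_map k (Hom C (tgt f) Z) (Hom C (src f) Z) (\<lambda>g. g \<cdot> f)"
  unfolding linear_map_def
  using assms Comp_add_left[of "src f" "tgt f" Z f] Comp_smult_left[of "src f" "tgt f" Z _ f] by auto

lemma postcomp_linear:
  assumes "arr g" and "X \<in> Ob C"
  shows "linear_map k (Hom C X (src g)) (Hom C X (tgt g)) (\<lambda>f. g \<cdot> f)"
  unfolding linear_map_def
  using assms Comp_add_right[of X "src g" "tgt g" _ _ g] Comp_smult_right[of X "src g" "tgt g" _ _ g] by auto

lemma zero_Comp [simp]:
  assumes "arr f" and "tgt f = Y" and "Z \<in> Ob C"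
  shows "zero_mor C Y Z \<cdot> f = zero_mor C (src f) Z"
  using linear_map_zero[OF Hom_module Hom_module precomp_linear] assms by auto

lemma Comp_zero [simp]:
  assumes "arr f" and "src f = Y" and "X \<in> Ob C"
  shows "f \<cdot> zero_mor C X Y = zero_mor C X (tgt f)"
  using linear_map_zero[OF Hom_module Hom_module postcomp_linear] assms by auto

lemma add_Comp:
  assumes "arr f" and "tgt f = Y" and "Z \<in> Ob C"
    and "arr g" "src g = Y" "tgt g = Z" and "arr h" "src h = Y" "tgt h = Z"
  shows "(g \<oplus>\<^bsub>Hom C Y Z\<^esub> h) \<cdot> f = g \<cdot> f \<oplus>\<^bsub>Hom C (src f) Z\<^esub> h \<cdot> f"
  using assms Comp_add_left[of "src f" Y Z f g h] by auto

lemma Comp_add: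
  assumes "arr f" and "src f = Y" and "X \<in> Ob C"
    and "arr g" "src g = X" "tgt g = Y" and "arr h" "src h = X" "tgt h = Y"
  shows "f \<cdot> (g \<oplus>\<^bsub>Hom C X Y\<^esub> h) = f \<cdot> g \<oplus>\<^bsub>Hom C X (tgt f)\<^esub> f \<cdot> h"
  using assms Comp_add_right[of X Y "tgt f" g h f] by auto

lemma minus_Comp:
  assumes "arr f" and "tgt f = Y" and "Z \<in> Ob C"
    and "arr g" "src g = Y" "tgt g = Z" and "arr h" "src h = Y" "tgt h = Z"
  shows "(g \<ominus>\<^bsub>Hom C Y Z\<^esub> h) \<cdot> f = g \<cdot> f \<ominus>\<^bsub>Hom C (src f) Z\<^esub> h \<cdot> f"
proof -
  have "\<ominus>\<^bsub>Hom C Y Z\<^esub> h \<in> mor C Y Z"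
    using assms abelian_group.a_inv_closed[OF Hom_abelian_group[of Y Z]] by auto
  then show ?thesis
    using assms add_Comp[of f Y Z g "\<ominus>\<^bsub>Hom C Y Z\<^esub> h"]
      linear_map_minus[OF Hom_module Hom_module precomp_linear[of f Z], of h]
    by (auto simp: a_minus_def)
qed

lemma Comp_minus:
  assumes "arr f" and "src f = Y" and "X \<in> Ob C"
    and "arr g" "src g = X" "tgt g = Y" and "arr h" "src h = X" "tgt h = Y"
  shows "f \<cdot> (g \<ominus>\<^bsub>Hom C X Y\<^esub> h) = f \<cdot> g \<ominus>\<^bsub>Hom C X (tgt f)\<^esub> f \<cdot> h"
proof -
  have "\<ominus>\<^bsub>Hom C X Y\<^esub> h \<in> mor C X Y"
    using assms abelian_group.a_inv_closed[OF Hom_abelian_group[of X Y]] by auto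
  then show ?thesis
    using assms Comp_add[of f Y X g "\<ominus>\<^bsub>Hom C X Y\<^esub> h"]
      linear_map_minus[OF Hom_module Hom_module postcomp_linear[of f X], of h]
    by (auto simp: a_minus_def)
qed

lemma minus_eq_zero_iff:
  assumes "arr g" and "arr h" and "src g = src h" and "tgt g = tgt h"
  shows "g \<ominus>\<^bsub>Hom C (src h) (tgt h)\<^esub> h = zero_mor C (src h) (tgt h) \<longleftrightarrow> g = h"
proof -
  interpret abelian_group "Hom C (src h) (tgt h)" using assms by (intro Hom_abelian_group) auto
  have gh: "g \<in> mor C (src h) (tgt h)" "h \<in> mor C (src h) (tgt h)" using assms by auto
  show ?thesis
  proof
    assume "g \<ominus>\<^bsub>Hom C (src h) (tgt h)\<^esub> h = zero_mor C (src h) (tgt h)"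
    then have "(g \<ominus>\<^bsub>Hom C (src h) (tgt h)\<^esub> h) \<oplus>\<^bsub>Hom C (src h) (tgt h)\<^esub> h = h"
      using l_zero[OF gh(2)] by (simp only:)
    then show "g = h"
      using a_assoc[OF gh(1) a_inv_closed[OF gh(2)] gh(2)] l_neg[OF gh(2)] r_zero[OF gh(1)]
      by (simp only: a_minus_def)
  next
    assume "g = h"
    then show "g \<ominus>\<^bsub>Hom C (src h) (tgt h)\<^esub> h = zero_mor C (src h) (tgt h)"
      using r_neg[OF gh(2)] by (simp only: a_minus_def)
  qed
qed

lemma monicD:
  assumes "monic C X Y f"
  shows "X \<in> Ob C" and "Y \<in> Ob C" and "arr f" and "src f = X" and "tgt f = Y"
  using assms unfolding monic_def by auto

lemma monic_cancel:
  assumes "monic C X Y f" and "f \<cdot> g = f \<cdot> h" and "arr g" and "arr h" and "src g = src h"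
    and "tgt g = X" and "tgt h = X"
  shows "g = h"
proof -
  have "g \<in> mor C (src g) X" and "h \<in> mor C (src g) X"
    using assms monicD(1)[OF assms(1)] by auto
  then show ?thesis using assms(1-3) unfolding monic_def by (meson Ob_src_tgt(1))
qed

lemma epicD:
  assumes "epic C X Y f"
  shows "X \<in> Ob C" and "Y \<in> Ob C" and "arr f" and "src f = X" and "tgt f = Y"
  using assms unfolding epic_def by auto

lemma epic_cancel:
  assumes "epic C X Y f" and "g \<cdot> f = h \<cdot> f" and "arr g" and "arr h" and "tgt g = tgt h"
    and "src g = Y" and "src h = Y"
  shows "g = h"
proof -
  have "g \<in> mor C Y (tgt g)" and "h \<in> mor C Y (tgt g)"
    using assms epicD(2)[OF assms(1)] by auto
  then show ?thesis using assms(1-3) unfolding epic_def by (meson Ob_src_tgt(2))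
qed

text \<open>
  By additivity it is enough to cancel against zero: apply the criterion to a difference.
\<close>

lemma epicI:
  assumes "arr f" and "src f = X" and "tgt f = Y"
    and "\<And>g. arr g \<Longrightarrow> src g = Y \<Longrightarrow> g \<cdot> f = zero_mor C X (tgt g) \<Longrightarrow> g = zero_mor C Y (tgt g)"
  shows "epic C X Y f"
  unfolding epic_def
proof (intro conjI ballI impI)
  show X: "X \<in> Ob C" and Y: "Y \<in> Ob C" using assms by auto
  show "f \<in> mor C X Y" using assms X Y by auto
  fix T g h assume T: "T \<in> Ob C" and "g \<in> mor C Y T" "h \<in> mor C Y T" and eq: "g \<cdot> f = h \<cdot> f"
  then have gh: "arr g" "src g = Y" "tgt g = T" "arr h" "src h = Y" "tgt h = T" using Y by auto
  have "(g \<ominus>\<^bsub>Hom C Y T\<^esub> h) \<cdot> f = g \<cdot> f \<ominus>\<^bsub>Hom C X T\<^esub> h \<cdot> f"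
    using minus_Comp[of f Y T g h] assms gh T by simp
  also have "\<dots> = zero_mor C X T"
    using minus_eq_zero_iff[of "g \<cdot> f" "h \<cdot> f"] gh assms eq by simp
  finally have "g \<ominus>\<^bsub>Hom C Y T\<^esub> h = zero_mor C Y T"
    using assms(4)[of "g \<ominus>\<^bsub>Hom C Y T\<^esub> h"] gh T Y by simp
  then show "g = h" using minus_eq_zero_iff[of g h] gh by simp
qed

lemma kernelD:
  assumes "is_kernel C X Y f N n"
  shows "X \<in> Ob C" and "Y \<in> Ob C" and "N \<in> Ob C"
    and "arr f" and "src f = X" and "tgt f = Y" and "arr n" and "src n = N" and "tgt n = X"
    and "f \<cdot> n = zero_mor C N Y"
  using assms unfolding is_kernel_def by auto

lemma kernel_factor:
  assumes "is_kernel C X Y f N n" and "arr t" and "tgt t = X" and "f \<cdot> t = zero_mor C (src t) Y"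
  obtains u where "arr u" and "src u = src t" and "tgt u = N" and "n \<cdot> u = t"
proof -
  have "t \<in> mor C (src t) X" "src t \<in> Ob C" "X \<in> Ob C" using assms kernelD(1)[OF assms(1)] by auto
  then obtain u where "u \<in> mor C (src t) N" "n \<cdot> u = t"
    using assms(1,4) unfolding is_kernel_def by meson
  then show thesis using that[of u] assms(2) kernelD(3)[OF assms(1)] by simp
qed

lemma kernel_monic:
  assumes "is_kernel C X Y f N n"
  shows "monic C N X n"
  unfolding monic_def
proof (intro conjI ballI impI)
  note n = kernelD[OF assms]
  show "N \<in> Ob C" "X \<in> Ob C" "n \<in> mor C N X" using n by auto
  fix T g h assume T: "T \<in> Ob C" and gh: "g \<in> mor C T N" "h \<in> mor C T N" "n \<cdot> g = n \<cdot> h"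
  then have g: "arr g" "src g = T" "tgt g = N" using n by auto
  then have "f \<cdot> (n \<cdot> g) = zero_mor C T Y"
    using assoc[of g n f] n by (simp del: assoc)
  moreover have "n \<cdot> g \<in> mor C T X" using g n T by auto
  ultimately have "\<exists>!u. u \<in> mor C T N \<and> n \<cdot> u = n \<cdot> g"
    using assms T unfolding is_kernel_def by blast
  then show "g = h" using gh by metis
qed

lemma kernelI:
  assumes "arr f" and "src f = X" and "tgt f = Y" and n: "monic C N X n" and "f \<cdot> n = zero_mor C N Y"
    and fac: "\<And>t. arr t \<Longrightarrow> tgt t = X \<Longrightarrow> f \<cdot> t = zero_mor C (src t) Y
      \<Longrightarrow> \<exists>u. arr u \<and> src u = src t \<and> tgt u = N \<and> n \<cdot> u = t"
  shows "is_kernel C X Y f N n"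
  unfolding is_kernel_def
proof (intro conjI ballI impI)
  note nD = monicD[OF n]
  show "X \<in> Ob C" "Y \<in> Ob C" using assms by auto
  then show "f \<in> mor C X Y" "n \<in> mor C N X" using nD assms by auto
  fix T t assume t: "T \<in> Ob C" "t \<in> mor C T X" "f \<cdot> t = zero_mor C T Y"
  then obtain u where u: "arr u" "src u = T" "tgt u = N" "n \<cdot> u = t"
    using fac[of t] nD by auto
  show "\<exists>!u. u \<in> mor C T N \<and> n \<cdot> u = t"
  proof (rule ex1I[of _ u])
    show "u \<in> mor C T N \<and> n \<cdot> u = t" using u t nD by auto
    show "v = u" if "v \<in> mor C T N \<and> n \<cdot> v = t" for v
      using that u t nD monic_cancel[OF n, of v u] by auto
  qed
qed (use assms monicD[OF n] in auto)

lemma cokernelD: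
  assumes "is_cokernel C X Y f Q q"
  shows "X \<in> Ob C" and "Y \<in> Ob C" and "Q \<in> Ob C"
    and "arr f" and "src f = X" and "tgt f = Y" and "arr q" and "src q = Y" and "tgt q = Q"
    and "q \<cdot> f = zero_mor C X Q"
  using assms unfolding is_cokernel_def by auto

lemma cokernel_factor:
  assumes "is_cokernel C X Y f Q q" and "arr t" and "src t = Y" and "t \<cdot> f = zero_mor C X (tgt t)"
  obtains u where "arr u" and "src u = Q" and "tgt u = tgt t" and "u \<cdot> q = t"
proof -
  have "t \<in> mor C Y (tgt t)" "tgt t \<in> Ob C" "Y \<in> Ob C" using assms cokernelD(2)[OF assms(1)] by auto
  then obtain u where "u \<in> mor C Q (tgt t)" "u \<cdot> q = t"
    using assms(1,4) unfolding is_cokernel_def by meson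
  then show thesis using that[of u] assms(2) cokernelD(3)[OF assms(1)] by simp
qed

lemma cokernel_epic:
  assumes "is_cokernel C X Y f Q q"
  shows "epic C Y Q q"
  unfolding epic_def
proof (intro conjI ballI impI)
  note q = cokernelD[OF assms]
  show "Q \<in> Ob C" "Y \<in> Ob C" "q \<in> mor C Y Q" using q by auto
  fix T g h assume T: "T \<in> Ob C" and gh: "g \<in> mor C Q T" "h \<in> mor C Q T" "g \<cdot> q = h \<cdot> q"
  then have g: "arr g" "src g = Q" "tgt g = T" using q by auto
  then have "(g \<cdot> q) \<cdot> f = zero_mor C X T"
    using q by simp
  moreover have "g \<cdot> q \<in> mor C Y T" using g q T by auto
  ultimately have "\<exists>!u. u \<in> mor C Q T \<and> u \<cdot> q = g \<cdot> q"
    using assms T unfolding is_cokernel_def by blast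
  then show "g = h" using gh by metis
qed

lemma cokernelI:
  assumes "arr f" and "src f = X" and "tgt f = Y" and q: "epic C Y Q q" and "q \<cdot> f = zero_mor C X Q"
    and fac: "\<And>t. arr t \<Longrightarrow> src t = Y \<Longrightarrow> t \<cdot> f = zero_mor C X (tgt t)
      \<Longrightarrow> \<exists>u. arr u \<and> src u = Q \<and> tgt u = tgt t \<and> u \<cdot> q = t"
  shows "is_cokernel C X Y f Q q"
  unfolding is_cokernel_def
proof (intro conjI ballI impI)
  note qD = epicD[OF q]
  show "X \<in> Ob C" "Y \<in> Ob C" using assms by auto
  then show "f \<in> mor C X Y" "q \<in> mor C Y Q" using qD assms by auto
  fix T t assume t: "T \<in> Ob C" "t \<in> mor C Y T" "t \<cdot> f = zero_mor C X T"
  then obtain u where u: "arr u" "src u = Q" "tgt u = T" "u \<cdot> q = t"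
    using fac[of t] qD by auto
  show "\<exists>!u. u \<in> mor C Q T \<and> u \<cdot> q = t"
  proof (rule ex1I[of _ u])
    show "u \<in> mor C Q T \<and> u \<cdot> q = t" using u t qD by auto
    show "v = u" if "v \<in> mor C Q T \<and> v \<cdot> q = t" for v
      using that u t qD epic_cancel[OF q, of v u] by auto
  qed
qed (use assms epicD[OF q] in auto)

lemma monic_comp:
  assumes "monic C X Y f" and "monic C Y Z g"
  shows "monic C X Z (g \<cdot> f)"
  unfolding monic_def
proof (intro conjI ballI impI)
  note f = monicD[OF assms(1)] and g = monicD[OF assms(2)]
  show "X \<in> Ob C" "Z \<in> Ob C" using f g by auto
  then show "g \<cdot> f \<in> mor C X Z" using f g by auto
  fix T u v assume "T \<in> Ob C" "u \<in> mor C T X" "v \<in> mor C T X" "(g \<cdot> f) \<cdot> u = (g \<cdot> f) \<cdot> v"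
  then show "u = v"
    using f g monic_cancel[OF assms(2), of "f \<cdot> u" "f \<cdot> v"] monic_cancel[OF assms(1), of u v] by auto
qed

text \<open>
  The map whose kernel is n factors through the cokernel of n, hence it kills whatever
  the cokernel kills.
\<close>

lemma kernel_of_cokernel_of_kernel:
  assumes n: "is_kernel C X Y f N n" and q: "is_cokernel C N X n Q q"
  shows "is_kernel C X Q q N n"
proof (rule kernelI[OF _ _ _ kernel_monic[OF n]])
  note nD = kernelD[OF n] and qD = cokernelD[OF q]
  obtain w where w: "arr w" "src w = Q" "tgt w = Y" "w \<cdot> q = f"
    using cokernel_factor[OF q, of f] nD by auto
  fix t assume t: "arr t" "tgt t = X" "q \<cdot> t = zero_mor C (src t) Q"
  have "f \<cdot> t = w \<cdot> (q \<cdot> t)" using t w qD by (simp flip: w(4))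
  then have "f \<cdot> t = zero_mor C (src t) Y" using t w qD by simp
  then show "\<exists>u. arr u \<and> src u = src t \<and> tgt u = N \<and> n \<cdot> u = t"
    using kernel_factor[OF n, of t] t by metis
qed (use cokernelD[OF q] in auto)

lemma cokernel_of_kernel_of_cokernel:
  assumes q: "is_cokernel C X Y f Q q" and n: "is_kernel C Y Q q N n"
  shows "is_cokernel C N Y n Q q"
proof (rule cokernelI[OF _ _ _ cokernel_epic[OF q]])
  note nD = kernelD[OF n] and qD = cokernelD[OF q]
  obtain w where w: "arr w" "src w = X" "tgt w = N" "n \<cdot> w = f"
    using kernel_factor[OF n, of f] qD by auto
  fix t assume t: "arr t" "src t = Y" "t \<cdot> n = zero_mor C N (tgt t)"
  have "t \<cdot> f = (t \<cdot> n) \<cdot> w"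
    unfolding w(4)[symmetric] using t(1,2) w(1-3) nD by simp
  then have "t \<cdot> f = zero_mor C X (tgt t)" unfolding t(3) using t w(1-3) nD by simp
  then show "\<exists>u. arr u \<and> src u = Q \<and> tgt u = tgt t \<and> u \<cdot> q = t"
    using cokernel_factor[OF q, of t] t by metis
qed (use kernelD[OF n] in auto)

text \<open>
  Two kernels n and m of the same g factor through each other, so n can replace m as a
  kernel of any other map h.
\<close>

lemma kernel_unique:
  assumes n: "is_kernel C X Y f N n" and m: "is_kernel C X Z g M m"
    and l: "is_kernel C X Z g N n" and k: "is_kernel C X Y' h M m"
  shows "is_kernel C X Y' h N n"
proof (rule kernelI[OF _ _ _ kernel_monic[OF n]])
  note nD = kernelD[OF l] and mD = kernelD[OF m] and kD = kernelD[OF k]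
  obtain r where r: "arr r" "src r = M" "tgt r = N" "n \<cdot> r = m"
    using kernel_factor[OF l, of m] mD by auto
  obtain s where s: "arr s" "src s = N" "tgt s = M" "m \<cdot> s = n"
    using kernel_factor[OF m, of n] nD by auto
  have "h \<cdot> n = (h \<cdot> m) \<cdot> s" using s kD(1-9) by simp
  then show "h \<cdot> n = zero_mor C N Y'" using s kD by simp
  fix t assume t: "arr t" "tgt t = X" "h \<cdot> t = zero_mor C (src t) Y'"
  then obtain u where u: "arr u" "src u = src t" "tgt u = M" "m \<cdot> u = t"
    using kernel_factor[OF k, of t] by auto
  have "n \<cdot> (r \<cdot> u) = (n \<cdot> r) \<cdot> u" using u r(1-3) nD by simp
  then have "n \<cdot> (r \<cdot> u) = t" using u r by simp
  then show "\<exists>u. arr u \<and> src u = src t \<and> tgt u = N \<and> n \<cdot> u = t"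
    using u r by (intro exI[of _ "r \<cdot> u"]) simp
qed (use kernelD[OF k] in auto)

end

section \<open>Short exact sequences in abelian categories\<close>

context abelian_category
begin

text \<open>
  The two halves of short exactness as universal properties, which is the form in which
  adjoint functors preserve them.
\<close>

definition ses
  where "ses X Y Z f g \<longleftrightarrow> is_kernel C Y Z g X f \<and> is_cokernel C X Y f Z g"

lemma epic_cokernel_of_kernel:
  assumes g: "epic C Y Z g" and f: "is_kernel C Y Z g X f"
  shows "is_cokernel C X Y f Z g"
proof -
  obtain T t where "is_cokernel C T Y t Z g" using epic_normal[OF g] by blast
  then show ?thesis using f by (rule cokernel_of_kernel_of_cokernel)
qed

lemma sesI: "epic C Y Z g \<Longrightarrow> is_kernel C Y Z g X f \<Longrightarrow> ses X Y Z f g"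
  by (simp add: ses_def epic_cokernel_of_kernel)

lemma short_exact_iff_ses: "short_exact C X Y Z f g \<longleftrightarrow> ses X Y Z f g"
proof
  assume se: "short_exact C X Y Z f g"
  then obtain I m Q q where f: "monic C X Y f" and g: "epic C Y Z g"
    and q: "is_cokernel C X Y f Q q" "is_kernel C Y Q q I m" and m: "is_kernel C Y Z g I m"
    unfolding short_exact_def exact_at_def is_image_def by blast
  obtain T z where z: "is_kernel C Y T z X f" using monic_normal[OF f] by blast
  have "is_kernel C Y Q q X f" using kernel_of_cokernel_of_kernel[OF z q(1)] .
  then have "is_kernel C Y Z g X f" by (rule kernel_unique[OF z q(2) _ m])
  then show "ses X Y Z f g" by (rule sesI[OF g])
next
  assume "ses X Y Z f g"
  then have f: "is_kernel C Y Z g X f" and g: "is_cokernel C X Y f Z g" by (auto simp: ses_def)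
  then show "short_exact C X Y Z f g"
    using kernel_monic[OF f] cokernel_epic[OF g]
    unfolding short_exact_def exact_at_def is_image_def by blast
qed

text \<open>
  If g kills e, then the kernel N of g is a subobject of the image m through which the given
  morphism still factors.  Being a kernel itself, the subobject N of Y already contains
  everything killed by the cokernel, in particular the whole image; so g vanishes.
\<close>

lemma image_epic:
  assumes m: "is_image C X Y f I m" and e: "arr e" "src e = X" "tgt e = I" "m \<cdot> e = f"
  shows "epic C X I e"
proof (rule epicI[OF e(1-3)])
  obtain Q q where q: "is_cokernel C X Y f Q q" and mk: "is_kernel C Y Q q I m"
    using m unfolding is_image_def by blast
  note qD = cokernelD[OF q] and mD = kernelD[OF mk]
  fix g assume g: "arr g" "src g = I" "g \<cdot> e = zero_mor C X (tgt g)"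
  obtain N n where n: "is_kernel C I (tgt g) g N n" using has_kernels[of I "tgt g" g] g mD by auto
  note nD = kernelD[OF n]
  obtain e' where e': "arr e'" "src e' = X" "tgt e' = N" "n \<cdot> e' = e"
    using kernel_factor[OF n, of e] e g by auto
  obtain Z z where z: "is_kernel C Y Z z N (m \<cdot> n)"
    using monic_normal[OF monic_comp[OF kernel_monic[OF n] kernel_monic[OF mk]]] by blast
  note zD = kernelD[OF z]
  (* z is zero on the given morphism, so it factors through the cokernel and is zero on m *)
  have "z \<cdot> f = z \<cdot> (m \<cdot> (n \<cdot> e'))" using e e' by simp
  also have "\<dots> = (z \<cdot> (m \<cdot> n)) \<cdot> e'" using e'(1-3) zD(1-6) mD nD by simp
  also have "\<dots> = zero_mor C X Z" using zD e' by simp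
  finally obtain w where w: "arr w" "src w = Q" "tgt w = Z" "w \<cdot> q = z"
    using cokernel_factor[OF q, of z] zD by auto
  have "z \<cdot> m = w \<cdot> (q \<cdot> m)" using w(1-3) qD mD(1-9) by (simp flip: w(4))
  also have "\<dots> = zero_mor C I Z" using w mD by simp
  finally obtain r where r: "arr r" "src r = I" "tgt r = N" "(m \<cdot> n) \<cdot> r = m"
    using kernel_factor[OF z, of m] mD by auto
  have "n \<cdot> r = Idm C I"
    using r nD mD monic_cancel[OF kernel_monic[OF mk], of "n \<cdot> r" "Idm C I"] by simp
  then have "g = g \<cdot> (n \<cdot> r)" using g by simp
  also have "\<dots> = (g \<cdot> n) \<cdot> r" using g nD(1-9) r(1-3) by simp
  also have "\<dots> = zero_mor C I (tgt g)" using r nD by simp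
  finally show "g = zero_mor C I (tgt g)" .
qed

text \<open>
  Composing f with an epimorphism does not change its cokernel, so the spliced map has image f.
\<close>

lemma splice_exact:
  assumes s1: "ses X' Y' X f' g'" and s2: "ses X Y Z f g"
  shows "exact_at C Y' Y Z (f \<cdot> g') g"
proof -
  have k1: "is_kernel C Y Z g X f" and c1: "is_cokernel C X Y f Z g"
    and c2: "is_cokernel C X' Y' f' X g'"
    using s1 s2 unfolding ses_def by auto
  note g = kernelD[OF k1] and g' = cokernelD[OF c2]
  have e': "epic C Y' X g'" by (rule cokernel_epic[OF c2])
  have "is_cokernel C Y' Y (f \<cdot> g') Z g"
  proof (rule cokernelI[OF _ _ _ cokernel_epic[OF c1]])
    have "g \<cdot> (f \<cdot> g') = (g \<cdot> f) \<cdot> g'" using g(1-9) g' by simp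
    then show "g \<cdot> (f \<cdot> g') = zero_mor C Y' Z" using g g' by simp
    fix t assume t: "arr t" "src t = Y" "t \<cdot> (f \<cdot> g') = zero_mor C Y' (tgt t)"
    then have "t \<cdot> f = zero_mor C X (tgt t)"
      using epic_cancel[OF e', of "t \<cdot> f" "zero_mor C X (tgt t)"] g g' by simp
    then show "\<exists>u. arr u \<and> src u = Z \<and> tgt u = tgt t \<and> u \<cdot> g = t"
      using cokernel_factor[OF c1, of t] t by metis
  qed (use g g' in auto)
  then have "is_image C Y' Y (f \<cdot> g') X f" using k1 unfolding is_image_def by blast
  then show ?thesis using k1 unfolding exact_at_def by blast
qed

lemma kernel_monic_comp:
  assumes k: "is_kernel C Y Z g X f" and h: "monic C Z T h"
  shows "is_kernel C Y T (h \<cdot> g) X f"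
proof (rule kernelI[OF _ _ _ kernel_monic[OF k]])
  note g = kernelD[OF k] and hD = monicD[OF h]
  show "arr (h \<cdot> g)" "src (h \<cdot> g) = Y" "tgt (h \<cdot> g) = T" using g hD by simp_all
  show "(h \<cdot> g) \<cdot> f = zero_mor C X T" using g hD by simp
  fix t assume t: "arr t" "tgt t = Y" "(h \<cdot> g) \<cdot> t = zero_mor C (src t) T"
  then have "g \<cdot> t = zero_mor C (src t) Z"
    using monic_cancel[OF h, of "g \<cdot> t" "zero_mor C (src t) Z"] g hD by simp
  then show "\<exists>u. arr u \<and> src u = src t \<and> tgt u = X \<and> f \<cdot> u = t"
    using kernel_factor[OF k, of t] t by metis
qed

lemma exact_at_monic_comp:
  assumes "exact_at C X Y Z f g" and "monic C Z T h"
  shows "exact_at C X Y T f (h \<cdot> g)"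
  using assms kernel_monic_comp unfolding exact_at_def by blast

end

section \<open>Duality as an adjunction\<close>

context strict_tensor_category
begin

lemmas [simp] = Unit_Ob Tob_closed Tob_assoc Tob_Unit_left Tob_Unit_right Tmor_Id

lemma Tmor_simps [simp]:
  assumes "arr f" and "arr g"
  shows "arr (f \<boxdot> g)" and "src (f \<boxdot> g) = src f \<boxtimes> src g" and "tgt (f \<boxdot> g) = tgt f \<boxtimes> tgt g"
  using Tmor_closed[of "src f" "tgt f" "src g" "tgt g" f g] assms by auto

lemma Tmor_assoc' [simp]: "arr f \<Longrightarrow> arr g \<Longrightarrow> arr h \<Longrightarrow> (f \<boxdot> g) \<boxdot> h = f \<boxdot> (g \<boxdot> h)"
  using Tmor_assoc[of "src f" "tgt f" "src g" "tgt g" "src h" "tgt h" f g h] by auto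

lemma Tmor_Unit [simp]: "arr f \<Longrightarrow> Idm C (Unit C) \<boxdot> f = f" "arr f \<Longrightarrow> f \<boxdot> Idm C (Unit C) = f"
  using Tmor_Unit_left[of "src f" "tgt f" f] Tmor_Unit_right[of "src f" "tgt f" f] by auto

lemma interchange:
  assumes "arr f" and "arr g" and "arr f'" and "arr g'" and "tgt f = src g" and "tgt f' = src g'"
  shows "(g \<boxdot> g') \<cdot> (f \<boxdot> f') = (g \<cdot> f) \<boxdot> (g' \<cdot> f')"
  using Tmor_Comp[of "src f" "src g" "tgt g" "src f'" "src g'" "tgt g'" f g f' g'] assms by auto

lemma tensor_right_linear:
  assumes "X \<in> Ob C" and "Y \<in> Ob C" and "V \<in> Ob C"
  shows "linear_map k (Hom C X Y) (Hom C (X \<boxtimes> V) (Y \<boxtimes> V)) (\<lambda>f. f \<boxdot> Idm C V)"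
  unfolding linear_map_def
  using assms Tmor_add_left[of X Y V V _ _ "Idm C V"] Tmor_smult_left[of X Y V V _ _ "Idm C V"] by auto

lemma zero_Tmor:
  assumes "X \<in> Ob C" and "Y \<in> Ob C" and "V \<in> Ob C"
  shows "zero_mor C X Y \<boxdot> Idm C V = zero_mor C (X \<boxtimes> V) (Y \<boxtimes> V)"
  using linear_map_zero[OF Hom_module Hom_module tensor_right_linear] assms by auto

lemma tensor_Comp:
  assumes "arr f" and "arr g" and "tgt f = src g" and "V \<in> Ob C"
  shows "(g \<boxdot> Idm C V) \<cdot> (f \<boxdot> Idm C V) = (g \<cdot> f) \<boxdot> Idm C V"
  using interchange[of f g "Idm C V" "Idm C V"] assms by simp

end

text \<open>
  A chosen dual Xd of X.  The functors \<open>- \<boxtimes> X\<close> and \<open>- \<boxtimes> Xd\<close> are then adjoint; \<open>adj\<close> and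
  \<open>unadj\<close> are the two transpositions.
\<close>

locale dual_pair = strict_tensor_category k C
  for k :: "('k, 'r) ring_scheme" and C :: "('k, 'o, 'm, 'z) mon_cat_scheme" (structure) +
  fixes X Xd :: 'o and ev coev :: 'm
  assumes X: "X \<in> Ob C" and Xd: "Xd \<in> Ob C"
    and ev: "ev \<in> mor C (Xd \<boxtimes> X) (Unit C)" and coev: "coev \<in> mor C (Unit C) (X \<boxtimes> Xd)"
    and zig: "(Idm C X \<boxdot> ev) \<cdot> (coev \<boxdot> Idm C X) = Idm C X"
    and zag: "(ev \<boxdot> Idm C Xd) \<cdot> (Idm C Xd \<boxdot> coev) = Idm C Xd"
begin

lemma data_simps [simp]:
  "X \<in> Ob C" "Xd \<in> Ob C"
  "arr ev" "src ev = Xd \<boxtimes> X" "tgt ev = Unit C"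
  "arr coev" "src coev = Unit C" "tgt coev = X \<boxtimes> Xd"
  using X Xd ev coev by auto

definition adj :: "'o \<Rightarrow> 'm \<Rightarrow> 'm"
  where "adj T f = (f \<boxdot> Idm C Xd) \<cdot> (Idm C T \<boxdot> coev)"

definition unadj :: "'o \<Rightarrow> 'm \<Rightarrow> 'm"
  where "unadj W g = (Idm C W \<boxdot> ev) \<cdot> (g \<boxdot> Idm C X)"

lemma adj_simps [simp]:
  assumes "T \<in> Ob C" and "arr f" and "src f = T \<boxtimes> X"
  shows "arr (adj T f)" and "src (adj T f) = T" and "tgt (adj T f) = tgt f \<boxtimes> Xd"
  using assms by (simp_all add: adj_def)

lemma unadj_simps [simp]:
  assumes "W \<in> Ob C" and "arr g" and "tgt g = W \<boxtimes> Xd"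
  shows "arr (unadj W g)" and "src (unadj W g) = src g \<boxtimes> X" and "tgt (unadj W g) = W"
  using assms by (simp_all add: unadj_def)

lemma adj_linear:
  assumes "T \<in> Ob C" and "W \<in> Ob C"
  shows "linear_map k (Hom C (T \<boxtimes> X) W) (Hom C T (W \<boxtimes> Xd)) (adj T)"
proof -
  have "linear_map k (Hom C (T \<boxtimes> X \<boxtimes> Xd) (W \<boxtimes> Xd)) (Hom C T (W \<boxtimes> Xd)) (\<lambda>g. g \<cdot> (Idm C T \<boxdot> coev))"
    using precomp_linear[of "Idm C T \<boxdot> coev" "W \<boxtimes> Xd"] assms by simp
  then show ?thesis
    unfolding adj_def[abs_def]
    using linear_map_compose[OF tensor_right_linear[of "T \<boxtimes> X" W Xd]] assms by simp
qed

lemma adj_natural: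
  assumes "arr h" and "arr f" and "src f = tgt h \<boxtimes> X"
  shows "adj (src h) (f \<cdot> (h \<boxdot> Idm C X)) = adj (tgt h) f \<cdot> h"
proof -
  have "adj (src h) (f \<cdot> (h \<boxdot> Idm C X))
      = ((f \<boxdot> Idm C Xd) \<cdot> (h \<boxdot> Idm C (X \<boxtimes> Xd))) \<cdot> (Idm C (src h) \<boxdot> coev)"
    using assms interchange[of "h \<boxdot> Idm C X" f "Idm C Xd" "Idm C Xd"] by (simp add: adj_def)
  also have "\<dots> = (f \<boxdot> Idm C Xd) \<cdot> (h \<boxdot> coev)"
    using assms interchange[of "Idm C (src h)" h coev "Idm C (X \<boxtimes> Xd)"] by simp
  also have "h \<boxdot> coev = (Idm C (tgt h) \<boxdot> coev) \<cdot> h"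
    using assms interchange[of h "Idm C (tgt h)" "Idm C (Unit C)" coev] by simp
  finally show ?thesis using assms by (simp add: adj_def)
qed

lemma adj_comp:
  assumes "T \<in> Ob C" and "arr f" and "src f = T \<boxtimes> X" and "arr g" and "src g = tgt f"
  shows "adj T (g \<cdot> f) = (g \<boxdot> Idm C Xd) \<cdot> adj T f"
  using assms tensor_Comp[of f g Xd, symmetric] by (simp add: adj_def)

text \<open>
  Sliding f past ev by the interchange law leaves \<open>f \<cdot> (T \<boxdot> zig)\<close>, where zig is the left-hand
  side of the first zig-zag identity; the second one gives the other composite.
\<close>

lemma unadj_adj:
  assumes "T \<in> Ob C" and "arr f" and "src f = T \<boxtimes> X"
  shows "unadj (tgt f) (adj T f) = f"
proof -
  have "adj T f \<boxdot> Idm C X = (f \<boxdot> Idm C (Xd \<boxtimes> X)) \<cdot> (Idm C T \<boxdot> coev \<boxdot> Idm C X)"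
    using assms tensor_Comp[of "Idm C T \<boxdot> coev" "f \<boxdot> Idm C Xd" X] by (simp add: adj_def)
  then have "unadj (tgt f) (adj T f) =
      ((Idm C (tgt f) \<boxdot> ev) \<cdot> (f \<boxdot> Idm C (Xd \<boxtimes> X))) \<cdot> (Idm C T \<boxdot> coev \<boxdot> Idm C X)"
    using assms by (simp add: unadj_def)
  also have "(Idm C (tgt f) \<boxdot> ev) \<cdot> (f \<boxdot> Idm C (Xd \<boxtimes> X)) = f \<cdot> (Idm C T \<boxdot> Idm C X \<boxdot> ev)"
    using assms interchange[of f "Idm C (tgt f)" "Idm C (Xd \<boxtimes> X)" ev]
      interchange[of "Idm C (T \<boxtimes> X)" f ev "Idm C (Unit C)"]
      Tmor_assoc'[of "Idm C T" "Idm C X" ev]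
    by simp
  also have "\<dots> \<cdot> (Idm C T \<boxdot> coev \<boxdot> Idm C X)
      = f \<cdot> (Idm C T \<boxdot> ((Idm C X \<boxdot> ev) \<cdot> (coev \<boxdot> Idm C X)))"
    using assms interchange[of "Idm C T" "Idm C T" "coev \<boxdot> Idm C X" "Idm C X \<boxdot> ev"] by simp
  also have "\<dots> = f" using assms by (simp add: zig)
  finally show ?thesis .
qed

lemma adj_unadj:
  assumes "W \<in> Ob C" and "arr g" and "tgt g = W \<boxtimes> Xd"
  shows "adj (src g) (unadj W g) = g"
proof -
  have "unadj W g \<boxdot> Idm C Xd = (Idm C W \<boxdot> ev \<boxdot> Idm C Xd) \<cdot> (g \<boxdot> Idm C (X \<boxtimes> Xd))"
    using assms tensor_Comp[of "g \<boxdot> Idm C X" "Idm C W \<boxdot> ev" Xd] by (simp add: unadj_def)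
  then have "adj (src g) (unadj W g) =
      (Idm C W \<boxdot> ev \<boxdot> Idm C Xd) \<cdot> ((g \<boxdot> Idm C (X \<boxtimes> Xd)) \<cdot> (Idm C (src g) \<boxdot> coev))"
    using assms by (simp add: adj_def)
  also have "(g \<boxdot> Idm C (X \<boxtimes> Xd)) \<cdot> (Idm C (src g) \<boxdot> coev) = (Idm C W \<boxdot> Idm C Xd \<boxdot> coev) \<cdot> g"
    using assms interchange[of "Idm C (src g)" g coev "Idm C (X \<boxtimes> Xd)"]
      interchange[of g "Idm C (W \<boxtimes> Xd)" "Idm C (Unit C)" coev]
      Tmor_assoc'[of "Idm C W" "Idm C Xd" coev]
    by simp
  also have "(Idm C W \<boxdot> ev \<boxdot> Idm C Xd) \<cdot> \<dots>
      = ((Idm C W \<boxdot> ev \<boxdot> Idm C Xd) \<cdot> (Idm C W \<boxdot> Idm C Xd \<boxdot> coev)) \<cdot> g"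
    using assms by simp
  also have "\<dots> = (Idm C W \<boxdot> ((ev \<boxdot> Idm C Xd) \<cdot> (Idm C Xd \<boxdot> coev))) \<cdot> g"
    using assms interchange[of "Idm C W" "Idm C W" "Idm C Xd \<boxdot> coev" "ev \<boxdot> Idm C Xd"] by simp
  also have "\<dots> = g" using assms by (simp add: zag)
  finally show ?thesis .
qed

lemma adj_inject:
  assumes "T \<in> Ob C" and "arr f" and "src f = T \<boxtimes> X" and "arr g" and "src g = T \<boxtimes> X"
    and "tgt f = tgt g" and "adj T f = adj T g"
  shows "f = g"
  using unadj_adj[of T f] unadj_adj[of T g] assms by metis

lemma adj_zero_iff:
  assumes "T \<in> Ob C" and "arr f" and "src f = T \<boxtimes> X"
  shows "adj T f = zero_mor C T (tgt f \<boxtimes> Xd) \<longleftrightarrow> f = zero_mor C (T \<boxtimes> X) (tgt f)"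
proof -
  have "adj T (zero_mor C (T \<boxtimes> X) (tgt f)) = zero_mor C T (tgt f \<boxtimes> Xd)"
    using linear_map_zero[OF Hom_module Hom_module adj_linear] assms by simp
  then show ?thesis
    using adj_inject[of T f "zero_mor C (T \<boxtimes> X) (tgt f)"] assms by auto
qed

text \<open>
  \<open>- \<boxtimes> X\<close> is a left adjoint and so preserves cokernels: the universal property transposes to
  that of q.
\<close>

lemma tensor_cokernel:
  assumes q: "is_cokernel C Y Z f Q q"
  shows "is_cokernel C (Y \<boxtimes> X) (Z \<boxtimes> X) (f \<boxdot> Idm C X) (Q \<boxtimes> X) (q \<boxdot> Idm C X)"
proof (rule cokernelI)
  note qD = cokernelD[OF q]
  show "arr (f \<boxdot> Idm C X)" "src (f \<boxdot> Idm C X) = Y \<boxtimes> X" "tgt (f \<boxdot> Idm C X) = Z \<boxtimes> X"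
    using qD by auto
  show "(q \<boxdot> Idm C X) \<cdot> (f \<boxdot> Idm C X) = zero_mor C (Y \<boxtimes> X) (Q \<boxtimes> X)"
    using qD tensor_Comp[of f q X] by (simp add: zero_Tmor)
  show "epic C (Z \<boxtimes> X) (Q \<boxtimes> X) (q \<boxdot> Idm C X)"
  proof (rule epicI)
    fix g assume g: "arr g" "src g = Q \<boxtimes> X" "g \<cdot> (q \<boxdot> Idm C X) = zero_mor C (Z \<boxtimes> X) (tgt g)"
    have "adj Q g \<cdot> q = adj Z (g \<cdot> (q \<boxdot> Idm C X))" using adj_natural[of q g] g qD by simp
    also have "\<dots> = zero_mor C Z (tgt g \<boxtimes> Xd)"
      using adj_zero_iff[of Z "g \<cdot> (q \<boxdot> Idm C X)"] g qD by simp
    finally have "adj Q g = zero_mor C Q (tgt g \<boxtimes> Xd)"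
      using epic_cancel[OF cokernel_epic[OF q], of "adj Q g" "zero_mor C Q (tgt g \<boxtimes> Xd)"] g qD
      by simp
    then show "g = zero_mor C (Q \<boxtimes> X) (tgt g)" using adj_zero_iff[of Q g] g qD by simp
  qed (use qD in auto)
  fix t assume t: "arr t" "src t = Z \<boxtimes> X" "t \<cdot> (f \<boxdot> Idm C X) = zero_mor C (Y \<boxtimes> X) (tgt t)"
  have "adj Z t \<cdot> f = adj Y (t \<cdot> (f \<boxdot> Idm C X))" using adj_natural[of f t] t qD by simp
  also have "\<dots> = zero_mor C Y (tgt t \<boxtimes> Xd)"
    using adj_zero_iff[of Y "t \<cdot> (f \<boxdot> Idm C X)"] t qD by simp
  finally obtain u where u: "arr u" "src u = Q" "tgt u = tgt t \<boxtimes> Xd" "u \<cdot> q = adj Z t"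
    using cokernel_factor[OF q, of "adj Z t"] t qD by auto
  let ?v = "unadj (tgt t) u"
  have "adj Z (?v \<cdot> (q \<boxdot> Idm C X)) = adj Z t"
    using adj_natural[of q ?v] adj_unadj[of "tgt t" u] u qD t(1,2) by simp
  then have "?v \<cdot> (q \<boxdot> Idm C X) = t"
    using adj_inject[of Z "?v \<cdot> (q \<boxdot> Idm C X)" t] u(1-3) qD t(1,2) by simp
  then show "\<exists>u. arr u \<and> src u = Q \<boxtimes> X \<and> tgt u = tgt t \<and> u \<cdot> (q \<boxdot> Idm C X) = t"
    using u t by (intro exI[of _ ?v]) simp
qed

text \<open>
  \<open>- \<boxtimes> Xd\<close> is a right adjoint and so preserves kernels.
\<close>

lemma tensor_dual_kernel:
  assumes n: "is_kernel C Y Z f N n"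
  shows "is_kernel C (Y \<boxtimes> Xd) (Z \<boxtimes> Xd) (f \<boxdot> Idm C Xd) (N \<boxtimes> Xd) (n \<boxdot> Idm C Xd)"
proof (rule kernelI)
  note nD = kernelD[OF n]
  show "arr (f \<boxdot> Idm C Xd)" "src (f \<boxdot> Idm C Xd) = Y \<boxtimes> Xd" "tgt (f \<boxdot> Idm C Xd) = Z \<boxtimes> Xd"
    using nD by auto
  show "(f \<boxdot> Idm C Xd) \<cdot> (n \<boxdot> Idm C Xd) = zero_mor C (N \<boxtimes> Xd) (Z \<boxtimes> Xd)"
    using nD tensor_Comp[of n f Xd] by (simp add: zero_Tmor)
  show "monic C (N \<boxtimes> Xd) (Y \<boxtimes> Xd) (n \<boxdot> Idm C Xd)"
    unfolding monic_def
  proof (intro conjI ballI impI)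
    show "N \<boxtimes> Xd \<in> Ob C" "Y \<boxtimes> Xd \<in> Ob C" "n \<boxdot> Idm C Xd \<in> mor C (N \<boxtimes> Xd) (Y \<boxtimes> Xd)"
      using nD by auto
    fix T g h assume T: "T \<in> Ob C" and "g \<in> mor C T (N \<boxtimes> Xd)" "h \<in> mor C T (N \<boxtimes> Xd)"
      and eq: "(n \<boxdot> Idm C Xd) \<cdot> g = (n \<boxdot> Idm C Xd) \<cdot> h"
    then have gh: "arr g" "src g = T" "tgt g = N \<boxtimes> Xd" "arr h" "src h = T" "tgt h = N \<boxtimes> Xd"
      using nD by auto
    have "n \<cdot> unadj N g = n \<cdot> unadj N h"
      using adj_inject[of T "n \<cdot> unadj N g" "n \<cdot> unadj N h"] adj_comp[of T "unadj N g" n]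
        adj_comp[of T "unadj N h" n] adj_unadj[of N g] adj_unadj[of N h] gh nD T eq
      by simp
    then have "unadj N g = unadj N h"
      using monic_cancel[OF kernel_monic[OF n], of "unadj N g" "unadj N h"] gh nD by simp
    then show "g = h" using adj_unadj[of N g] adj_unadj[of N h] gh nD by metis
  qed
  fix t assume t: "arr t" "tgt t = Y \<boxtimes> Xd" "(f \<boxdot> Idm C Xd) \<cdot> t = zero_mor C (src t) (Z \<boxtimes> Xd)"
  have "adj (src t) (f \<cdot> unadj Y t) = zero_mor C (src t) (Z \<boxtimes> Xd)"
    using adj_comp[of "src t" "unadj Y t" f] adj_unadj[of Y t] t nD by simp
  then have "f \<cdot> unadj Y t = zero_mor C (src t \<boxtimes> X) Z"
    using adj_zero_iff[of "src t" "f \<cdot> unadj Y t"] t nD by simp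
  then obtain u where u: "arr u" "src u = src t \<boxtimes> X" "tgt u = N" "n \<cdot> u = unadj Y t"
    using kernel_factor[OF n, of "unadj Y t"] t nD by auto
  have "(n \<boxdot> Idm C Xd) \<cdot> adj (src t) u = t"
    using adj_comp[of "src t" u n] adj_unadj[of Y t] u t(1,2) nD by simp
  then show "\<exists>u. arr u \<and> src u = src t \<and> tgt u = N \<boxtimes> Xd \<and> (n \<boxdot> Idm C Xd) \<cdot> u = t"
    using u t nD by (intro exI[of _ "adj (src t) u"]) simp
qed

end

context strict_tensor_category
begin

lemma dual_pair_of_is_dual:
  assumes "is_dual C X Xd"
  obtains ev coev where "dual_pair k C X Xd ev coev"
  using assms strict_tensor_category_axioms
  unfolding is_dual_def dual_pair_def dual_pair_axioms_def by blast

text \<open>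
  V has a dual and is a dual, so \<open>- \<boxtimes> V\<close> is a left adjoint as well as a right adjoint.
\<close>

lemma tensor_ses:
  assumes s: "ses X Y Z f g" and V: "V \<in> Ob C"
  shows "ses (X \<boxtimes> V) (Y \<boxtimes> V) (Z \<boxtimes> V) (f \<boxdot> Idm C V) (g \<boxdot> Idm C V)"
proof -
  obtain Vd ev coev where "dual_pair k C V Vd ev coev"
    using left_duals[OF V] dual_pair_of_is_dual by metis
  then interpret L: dual_pair k C V Vd ev coev .
  obtain V' ev' coev' where "dual_pair k C V' V ev' coev'"
    using right_duals[OF V] dual_pair_of_is_dual by metis
  then interpret R: dual_pair k C V' V ev' coev' .
  show ?thesis
    using s L.tensor_cokernel R.tensor_dual_kernel unfolding ses_def by blast
qed

text \<open>
  The object N represents the functor \<open>T \<mapsto> Hom(T \<boxtimes> X, W)\<close>.  Naturality is asked in T only: W is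
  fixed, while the comparison of maps on K with maps on P is naturality in T along \<open>j : K \<rightarrow> P\<close>.
\<close>

definition internal_hom
  where "internal_hom X W N \<longleftrightarrow> X \<in> Ob C \<and> W \<in> Ob C \<and> N \<in> Ob C \<and>
    (\<exists>\<phi>. (\<forall>T \<in> Ob C. linear_map k (Hom C (T \<boxtimes> X) W) (Hom C T N) (\<phi> T) \<and>
            bij_betw (\<phi> T) (mor C (T \<boxtimes> X) W) (mor C T N)) \<and>
      (\<forall>h f. arr h \<and> arr f \<and> src f = tgt h \<boxtimes> X \<and> tgt f = W \<longrightarrow>
         \<phi> (src h) (f \<cdot> (h \<boxdot> Idm C X)) = \<phi> (tgt h) f \<cdot> h))"

lemma dual_internal_hom:
  assumes d: "is_dual C X Xd" and W: "W \<in> Ob C"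
  shows "internal_hom X W (W \<boxtimes> Xd)"
proof -
  obtain ev coev where "dual_pair k C X Xd ev coev" using dual_pair_of_is_dual[OF d] .
  then interpret dual_pair k C X Xd ev coev .
  have "bij_betw (adj T) (mor C (T \<boxtimes> X) W) (mor C T (W \<boxtimes> Xd))" if "T \<in> Ob C" for T
    using that W unadj_adj[of T] adj_unadj[of W] by (intro bij_betw_byWitness[of _ "unadj W"]) auto
  then show ?thesis
    unfolding internal_hom_def using W adj_linear[OF _ W] adj_natural
    by (intro conjI exI[of _ adj]) auto
qed

text \<open>
  The factor of \<open>X \<boxtimes> Y\<close> next to W in \<open>T \<boxtimes> X \<boxtimes> Y \<rightarrow> W\<close> is moved across first.  This is why the
  duals of a product appear in reverse order.
\<close>

lemma internal_hom_tensor: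
  assumes Y: "internal_hom Y W N" and X: "internal_hom X N N'"
  shows "internal_hom (X \<boxtimes> Y) W N'"
proof -
  obtain \<phi> where \<phi>: "\<And>T. T \<in> Ob C \<Longrightarrow> linear_map k (Hom C (T \<boxtimes> Y) W) (Hom C T N) (\<phi> T)"
      "\<And>T. T \<in> Ob C \<Longrightarrow> bij_betw (\<phi> T) (mor C (T \<boxtimes> Y) W) (mor C T N)"
      "\<And>h f. \<lbrakk>arr h; arr f; src f = tgt h \<boxtimes> Y; tgt f = W\<rbrakk> \<Longrightarrow>
         \<phi> (src h) (f \<cdot> (h \<boxdot> Idm C Y)) = \<phi> (tgt h) f \<cdot> h"
    using Y unfolding internal_hom_def by blast
  obtain \<psi> where \<psi>: "\<And>T. T \<in> Ob C \<Longrightarrow> linear_map k (Hom C (T \<boxtimes> X) N) (Hom C T N') (\<psi> T)"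
      "\<And>T. T \<in> Ob C \<Longrightarrow> bij_betw (\<psi> T) (mor C (T \<boxtimes> X) N) (mor C T N')"
      "\<And>h f. \<lbrakk>arr h; arr f; src f = tgt h \<boxtimes> X; tgt f = N\<rbrakk> \<Longrightarrow>
         \<psi> (src h) (f \<cdot> (h \<boxdot> Idm C X)) = \<psi> (tgt h) f \<cdot> h"
    using X unfolding internal_hom_def by blast
  have ob: "X \<in> Ob C" "Y \<in> Ob C" "W \<in> Ob C" "N \<in> Ob C" "N' \<in> Ob C"
    using X Y unfolding internal_hom_def by blast+
  define \<chi> where "\<chi> T f = \<psi> T (\<phi> (T \<boxtimes> X) f)" for T f
  have "linear_map k (Hom C (T \<boxtimes> X \<boxtimes> Y) W) (Hom C T N') (\<chi> T) \<and>
      bij_betw (\<chi> T) (mor C (T \<boxtimes> X \<boxtimes> Y) W) (mor C T N')" if T: "T \<in> Ob C" for T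
    unfolding \<chi>_def[abs_def]
    using linear_map_compose[OF \<phi>(1)[of "T \<boxtimes> X"] \<psi>(1)[of T]]
      bij_betw_trans[OF \<phi>(2)[of "T \<boxtimes> X"] \<psi>(2)[of T]] T ob
    by (simp add: comp_def del: mor_iff)
  moreover have "\<chi> (src h) (f \<cdot> (h \<boxdot> Idm C (X \<boxtimes> Y))) = \<chi> (tgt h) f \<cdot> h"
    if h: "arr h" "arr f" "src f = tgt h \<boxtimes> (X \<boxtimes> Y)" "tgt f = W" for h f
  proof -
    have \<phi>f: "arr (\<phi> (tgt h \<boxtimes> X) f)" "src (\<phi> (tgt h \<boxtimes> X) f) = tgt h \<boxtimes> X" "tgt (\<phi> (tgt h \<boxtimes> X) f) = N"
      using \<phi>(1)[of "tgt h \<boxtimes> X"] h ob by (auto simp: linear_map_def)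
    have "\<phi> (src h \<boxtimes> X) (f \<cdot> (h \<boxdot> Idm C (X \<boxtimes> Y))) = \<phi> (tgt h \<boxtimes> X) f \<cdot> (h \<boxdot> Idm C X)"
      using \<phi>(3)[of "h \<boxdot> Idm C X" f] h ob by simp
    then show ?thesis
      unfolding \<chi>_def using \<psi>(3)[of h "\<phi> (tgt h \<boxtimes> X) f"] h ob \<phi>f by simp
  qed
  ultimately show ?thesis
    unfolding internal_hom_def using ob by (intro conjI exI[of _ \<chi>]) auto
qed

lemma Tpow_Ob [simp]: "X \<in> Ob C \<Longrightarrow> Tpow C X m \<in> Ob C"
  by (induction m) auto

lemma Tpow_commute: "X \<in> Ob C \<Longrightarrow> Tpow C X m \<boxtimes> X = X \<boxtimes> Tpow C X m"
  by (induction m) auto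

text \<open>
  Naturality along h makes the representing bijection carry the maps that extend along \<open>h \<boxdot> X\<close>
  onto the maps that extend along h.
\<close>

lemma internal_hom_quot:
  assumes ih: "internal_hom X W N" and h: "arr h"
  shows "module_isomorphic k
    (quot_module (Hom C (src h \<boxtimes> X) W) ((\<lambda>f. f \<cdot> (h \<boxdot> Idm C X)) ` mor C (tgt h \<boxtimes> X) W))
    (quot_module (Hom C (src h) N) ((\<lambda>f. f \<cdot> h) ` mor C (tgt h) N))"
proof -
  have ob: "X \<in> Ob C" "W \<in> Ob C" "N \<in> Ob C" "src h \<in> Ob C" "tgt h \<in> Ob C"
    using ih h unfolding internal_hom_def by auto
  obtain \<phi> where lin: "\<And>T. T \<in> Ob C \<Longrightarrow> linear_map k (Hom C (T \<boxtimes> X) W) (Hom C T N) (\<phi> T)"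
    and bij: "\<And>T. T \<in> Ob C \<Longrightarrow> bij_betw (\<phi> T) (mor C (T \<boxtimes> X) W) (mor C T N)"
    and nat: "\<And>f. f \<in> mor C (tgt h \<boxtimes> X) W \<Longrightarrow> \<phi> (src h) (f \<cdot> (h \<boxdot> Idm C X)) = \<phi> (tgt h) f \<cdot> h"
    using ih h unfolding internal_hom_def by auto
  let ?N = "(\<lambda>f. f \<cdot> (h \<boxdot> Idm C X)) ` mor C (tgt h \<boxtimes> X) W"
  have "(\<lambda>f. f \<cdot> h) ` mor C (tgt h) N = (\<lambda>f. f \<cdot> h) ` \<phi> (tgt h) ` mor C (tgt h \<boxtimes> X) W"
    using bij[of "tgt h"] ob by (simp add: bij_betw_def del: mor_iff)
  also have "\<dots> = \<phi> (src h) ` ?N"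
    unfolding image_image using nat by (intro image_cong) auto
  finally have im: "(\<lambda>f. f \<cdot> h) ` mor C (tgt h) N = \<phi> (src h) ` ?N" .
  have sub: "?N \<subseteq> mor C (src h \<boxtimes> X) W" using h ob by auto
  have "linear_map k (Hom C (tgt h \<boxtimes> X) W) (Hom C (src h \<boxtimes> X) W) (\<lambda>f. f \<cdot> (h \<boxdot> Idm C X))"
    using precomp_linear[of "h \<boxdot> Idm C X" W] h ob by simp
  then have sm: "submodule ?N k (Hom C (src h \<boxtimes> X) W)"
    using linear_map_image_submodule[OF Hom_module Hom_module] ob by (simp del: mor_iff)
  have "linear_map k (Hom C (tgt h) N) (Hom C (src h) N) (\<lambda>f. f \<cdot> h)"
    using precomp_linear[of h N] h ob by simp
  then have sm': "submodule ((\<lambda>f. f \<cdot> h) ` mor C (tgt h) N) k (Hom C (src h) N)"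
    using linear_map_image_submodule[OF Hom_module Hom_module] ob by (simp del: mor_iff)
  show ?thesis
  proof (rule quot_module_isomorphicI[OF _ _ sm sm' lin])
    fix x assume x: "x \<in> mor C (src h \<boxtimes> X) W"
    show "\<phi> (src h) x \<in> (\<lambda>f. f \<cdot> h) ` mor C (tgt h) N \<longleftrightarrow> x \<in> ?N"
      unfolding im using inj_on_image_mem_iff[OF bij_betw_imp_inj_on[OF bij[OF ob(4)]] x sub] .
  next
    fix y assume y: "y \<in> mor C (src h) N"
    interpret Hm: module k "Hom C (src h) N" using Hom_module ob by simp
    have "y \<in> \<phi> (src h) ` mor C (src h \<boxtimes> X) W"
      using bij_betw_imp_surj_on[OF bij[OF ob(4)]] y by (simp only:)
    then obtain x where x: "x \<in> mor C (src h \<boxtimes> X) W" "\<phi> (src h) x = y" by (elim imageE) simp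
    have "y \<ominus>\<^bsub>Hom C (src h) N\<^esub> \<phi> (src h) x = \<zero>\<^bsub>Hom C (src h) N\<^esub>"
      using y x(2) Hm.r_neg[OF y] by (simp only: a_minus_def)
    then show "\<exists>x \<in> mor C (src h \<boxtimes> X) W. y \<ominus>\<^bsub>Hom C (src h) N\<^esub> \<phi> (src h) x
        \<in> (\<lambda>f. f \<cdot> h) ` mor C (tgt h) N"
      using x(1) subgroup.one_closed[OF submodule.axioms(1)[OF sm']] by (intro bexI[of _ x]) simp_all
  qed (use Hom_module ob in auto)
qed

end

section \<open>Syzygies in relative homological algebra\<close>

locale relative_setting = A: abelian_category k A + B: abelian_category k B
  for k :: "('k, 'r) ring_scheme"
    and A :: "('k, 'oa, 'ma, 'za) lin_cat_scheme" (structure)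
    and B :: "('k, 'ob, 'mb, 'zb) lin_cat_scheme" +
  fixes U :: "('oa, 'ma, 'ob, 'mb) fctr"
  assumes U_functor: "is_functor A B U" and U_exact: "exact_functor A B U"
begin

lemma U_Ob [simp]: "X \<in> Ob A \<Longrightarrow> Fob U X \<in> Ob B"
  using U_functor by (simp add: is_functor_def)

lemma U_simps [simp]:
  assumes "A.arr f"
  shows "B.arr (Fmor U f)" and "B.src (Fmor U f) = Fob U (A.src f)" and "B.tgt (Fmor U f) = Fob U (A.tgt f)"
proof -
  have "f \<in> mor A (A.src f) (A.tgt f)" using assms by simp
  then have "Fmor U f \<in> mor B (Fob U (A.src f)) (Fob U (A.tgt f))"
    using U_functor assms A.Ob_src_tgt unfolding is_functor_def by blast
  then show "B.arr (Fmor U f)" and "B.src (Fmor U f) = Fob U (A.src f)"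
    and "B.tgt (Fmor U f) = Fob U (A.tgt f)" using assms by auto
qed

lemma U_Comp [simp]:
  assumes "A.arr f" and "A.arr g" and "A.tgt f = A.src g"
  shows "Fmor U (g \<cdot> f) = Fmor U g \<cdot>\<^bsub>B\<^esub> Fmor U f"
proof -
  have "f \<in> mor A (A.src f) (A.src g)" and "g \<in> mor A (A.src g) (A.tgt g)" using assms by auto
  then show ?thesis
    using U_functor assms A.Ob_src_tgt unfolding is_functor_def by blast
qed

lemma U_Idm [simp]: "X \<in> Ob A \<Longrightarrow> Fmor U (Idm A X) = Idm B (Fob U X)"
  using U_functor by (simp add: is_functor_def)

lemma U_ses:
  assumes "A.ses X Y Z f g"
  shows "B.ses (Fob U X) (Fob U Y) (Fob U Z) (Fmor U f) (Fmor U g)"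
  using assms U_exact unfolding exact_functor_def A.short_exact_iff_ses B.short_exact_iff_ses by blast

lemma allowableD:
  assumes "allowable A B U X Y f"
  obtains s where "A.arr f" and "A.src f = X" and "A.tgt f = Y" and "X \<in> Ob A" and "Y \<in> Ob A"
    and "B.arr s" and "B.src s = Fob U Y" and "B.tgt s = Fob U X"
    and "Fmor U f \<cdot>\<^bsub>B\<^esub> s \<cdot>\<^bsub>B\<^esub> Fmor U f = Fmor U f"
  using assms unfolding allowable_def by auto

lemma allowableI:
  assumes "A.arr f" and "A.src f = X" and "A.tgt f = Y"
    and "B.arr s" and "B.src s = Fob U Y" and "B.tgt s = Fob U X"
    and "Fmor U f \<cdot>\<^bsub>B\<^esub> s \<cdot>\<^bsub>B\<^esub> Fmor U f = Fmor U f"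
  shows "allowable A B U X Y f"
  using assms unfolding allowable_def by (auto intro!: bexI[of _ s])

text \<open>
  U preserves epimorphisms by exactness, so the middle factor in \<open>U(g) s U(g) = U(g)\<close> can be
  cancelled on the right: s is a section of \<open>U(g)\<close>.
\<close>

lemma allowable_section:
  assumes "A.ses X Y Z f g" and "allowable A B U Y Z g"
  obtains s where "B.arr s" and "B.src s = Fob U Z" and "B.tgt s = Fob U Y"
    and "Fmor U g \<cdot>\<^bsub>B\<^esub> s = Idm B (Fob U Z)"
proof -
  have e: "epic B (Fob U Y) (Fob U Z) (Fmor U g)"
    using U_ses[OF assms(1)] B.cokernel_epic unfolding B.ses_def by blast
  obtain s where s: "A.arr g" "A.src g = Y" "A.tgt g = Z" "Y \<in> Ob A" "Z \<in> Ob A"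
      "B.arr s" "B.src s = Fob U Z" "B.tgt s = Fob U Y"
      "Fmor U g \<cdot>\<^bsub>B\<^esub> s \<cdot>\<^bsub>B\<^esub> Fmor U g = Fmor U g"
    using allowableD[OF assms(2)] by metis
  have "Fmor U g \<cdot>\<^bsub>B\<^esub> s = Idm B (Fob U Z)"
    using B.epic_cancel[OF e, of "Fmor U g \<cdot>\<^bsub>B\<^esub> s" "Idm B (Fob U Z)"] s by simp
  then show thesis using that s by blast
qed

text \<open>
  If t is a section of \<open>U(g')\<close> and s splits \<open>U(f)\<close>, then t s splits the composite.
\<close>

lemma allowable_comp:
  assumes s1: "allowable_short_exact A B U X' Y' X f' g'" and s2: "allowable_short_exact A B U X Y Z f g"
  shows "allowable A B U Y' Y (f \<cdot> g')"
proof -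
  have "A.ses X' Y' X f' g'" "allowable A B U Y' X g'"
    using s1 by (auto simp: allowable_short_exact_def A.short_exact_iff_ses)
  from allowable_section[OF this] obtain t where t: "B.arr t" "B.src t = Fob U X"
      "B.tgt t = Fob U Y'" "Fmor U g' \<cdot>\<^bsub>B\<^esub> t = Idm B (Fob U X)" .
  have g': "A.arr g'" "A.src g' = Y'" "A.tgt g' = X" "Y' \<in> Ob A" "X \<in> Ob A"
    using s1 unfolding allowable_short_exact_def allowable_def by auto
  obtain s where s: "A.arr f" "A.src f = X" "A.tgt f = Y" "X \<in> Ob A" "Y \<in> Ob A"
      "B.arr s" "B.src s = Fob U Y" "B.tgt s = Fob U X"
      "Fmor U f \<cdot>\<^bsub>B\<^esub> s \<cdot>\<^bsub>B\<^esub> Fmor U f = Fmor U f"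
    using s2 allowableD unfolding allowable_short_exact_def by metis
  have "Fmor U f \<cdot>\<^bsub>B\<^esub> Fmor U g' \<cdot>\<^bsub>B\<^esub> t \<cdot>\<^bsub>B\<^esub> s \<cdot>\<^bsub>B\<^esub> Fmor U f \<cdot>\<^bsub>B\<^esub> Fmor U g'
      = Fmor U f \<cdot>\<^bsub>B\<^esub> (Fmor U g' \<cdot>\<^bsub>B\<^esub> t) \<cdot>\<^bsub>B\<^esub> s \<cdot>\<^bsub>B\<^esub> Fmor U f \<cdot>\<^bsub>B\<^esub> Fmor U g'"
    using t(1-3) s(1-8) g' by simp
  also have "\<dots> = (Fmor U f \<cdot>\<^bsub>B\<^esub> s \<cdot>\<^bsub>B\<^esub> Fmor U f) \<cdot>\<^bsub>B\<^esub> Fmor U g'"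
    unfolding t(4) using s(1-8) g' by simp
  also have "\<dots> = Fmor U f \<cdot>\<^bsub>B\<^esub> Fmor U g'" unfolding s(9) ..
  finally show ?thesis
    using t(1-3) s(1-8) g' by (intro allowableI[of _ _ _ "t \<cdot>\<^bsub>B\<^esub> s"]) simp_all
qed

text \<open>
  U keeps the epimorphism g' epic and the monomorphism f monic, so either factor can be
  cancelled from \<open>U(f g') s U(f g') = U(f g')\<close>.
\<close>

lemma allowable_factors:
  assumes s1: "A.ses X' Y' X f' g'" and s2: "A.ses X Y Z f g" and a: "allowable A B U Y' Y (f \<cdot> g')"
  shows "allowable A B U Y' X g'" and "allowable A B U X Y f"
proof -
  have e: "epic B (Fob U Y') (Fob U X) (Fmor U g')"
    using U_ses[OF s1] B.cokernel_epic unfolding B.ses_def by blast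
  have m: "monic B (Fob U X) (Fob U Y) (Fmor U f)"
    using U_ses[OF s2] B.kernel_monic unfolding B.ses_def by blast
  have fg: "A.arr g'" "A.src g' = Y'" "A.tgt g' = X" "A.arr f" "A.src f = X" "A.tgt f = Y" "X \<in> Ob A"
    using s1 s2 A.cokernelD[of X' Y' f' X g'] A.kernelD[of Y Z g X f] unfolding A.ses_def by auto
  obtain s where s: "B.arr s" "B.src s = Fob U Y" "B.tgt s = Fob U Y'"
      "Fmor U (f \<cdot> g') \<cdot>\<^bsub>B\<^esub> s \<cdot>\<^bsub>B\<^esub> Fmor U (f \<cdot> g') = Fmor U (f \<cdot> g')"
    using allowableD[OF a] by metis
  have "Fmor U g' \<cdot>\<^bsub>B\<^esub> (s \<cdot>\<^bsub>B\<^esub> Fmor U f) \<cdot>\<^bsub>B\<^esub> Fmor U g' = Fmor U g'"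
    using B.monic_cancel[OF m, of "Fmor U g' \<cdot>\<^bsub>B\<^esub> (s \<cdot>\<^bsub>B\<^esub> Fmor U f) \<cdot>\<^bsub>B\<^esub> Fmor U g'" "Fmor U g'"]
      s fg by simp
  then show "allowable A B U Y' X g'"
    using s(1-3) fg by (intro allowableI[of _ _ _ "s \<cdot>\<^bsub>B\<^esub> Fmor U f"]) simp_all
  have "Fmor U f \<cdot>\<^bsub>B\<^esub> (Fmor U g' \<cdot>\<^bsub>B\<^esub> s) \<cdot>\<^bsub>B\<^esub> Fmor U f = Fmor U f"
    using B.epic_cancel[OF e, of "Fmor U f \<cdot>\<^bsub>B\<^esub> (Fmor U g' \<cdot>\<^bsub>B\<^esub> s) \<cdot>\<^bsub>B\<^esub> Fmor U f" "Fmor U f"]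
      s fg by simp
  then show "allowable A B U X Y f"
    using s(1-3) fg by (intro allowableI[of _ _ _ "Fmor U g' \<cdot>\<^bsub>B\<^esub> s"]) simp_all
qed

text \<open>
  A resolution cut into allowable short exact sequences \<open>0 \<rightarrow> S(m+1) \<rightarrow> P(m) \<rightarrow> S(m) \<rightarrow> 0\<close>.  With
  \<open>S 0 = V\<close>, the object \<open>S (Suc m)\<close> is the kernel inside \<open>P m\<close>.
\<close>

definition syzygies
  where "syzygies V S P \<iota> \<pi> \<longleftrightarrow> S 0 = V \<and>
    (\<forall>m::nat. allowable_short_exact A B U (S (Suc m)) (P m) (S m) (\<iota> m) (\<pi> m) \<and> rel_projective A B U (P m))"

lemma syzygiesD:
  assumes "syzygies V S P \<iota> \<pi>"
  shows "A.ses (S (Suc m)) (P m) (S m) (\<iota> m) (\<pi> m)" and "allowable A B U (P m) (S m) (\<pi> m)"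
    and "rel_projective A B U (P m)" and "is_cokernel A (S (Suc m)) (P m) (\<iota> m) (S m) (\<pi> m)"
    and "is_kernel A (P m) (S m) (\<pi> m) (S (Suc m)) (\<iota> m)"
    and "allowable_short_exact A B U (S (Suc m)) (P m) (S m) (\<iota> m) (\<pi> m)"
  using assms unfolding syzygies_def allowable_short_exact_def A.short_exact_iff_ses A.ses_def by auto

lemma syzygies_simps:
  assumes "syzygies V S P \<iota> \<pi>"
  shows "S m \<in> Ob A" and "P m \<in> Ob A"
    and "A.arr (\<iota> m)" and "A.src (\<iota> m) = S (Suc m)" and "A.tgt (\<iota> m) = P m"
    and "A.arr (\<pi> m)" and "A.src (\<pi> m) = P m" and "A.tgt (\<pi> m) = S m"
    and "\<pi> m \<cdot> \<iota> m = zero_mor A (S (Suc m)) (S m)"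
    and "epic A (P m) (S m) (\<pi> m)" and "monic A (S (Suc m)) (P m) (\<iota> m)"
  using A.cokernelD[OF syzygiesD(4)[OF assms, of m]] A.cokernel_epic[OF syzygiesD(4)[OF assms, of m]]
    A.kernel_monic[OF syzygiesD(5)[OF assms, of m]] by simp_all

lemma resolution_of_syzygies:
  assumes s: "syzygies V S P \<iota> \<pi>"
  shows "rel_proj_resolution A B U V \<lparr>Rterm = P, Rdiff = \<lambda>m. \<iota> m \<cdot> \<pi> (Suc m), Raug = \<pi> 0\<rparr>"
proof -
  note D = syzygiesD[OF s] and simps = syzygies_simps[OF s]
  have V: "S 0 = V" using s by (simp add: syzygies_def)
  have "exact_at A (P (Suc (Suc m))) (P (Suc m)) (P m) (\<iota> (Suc m) \<cdot> \<pi> (Suc (Suc m))) (\<iota> m \<cdot> \<pi> (Suc m))" for m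
    using A.exact_at_monic_comp[OF A.splice_exact[OF D(1) D(1)] simps(11)] .
  moreover have "exact_at A (P 1) (P 0) V (\<iota> 0 \<cdot> \<pi> (Suc 0)) (\<pi> 0)"
    using A.splice_exact[OF D(1)[of "Suc 0"] D(1)[of 0]] V by simp
  ultimately show ?thesis
    unfolding rel_proj_resolution_def
    using D(2)[of 0] D(3) V simps(10)[of 0] allowable_comp[OF D(6) D(6)] by auto
qed

text \<open>
  Take for \<open>S (Suc m)\<close> the image of the m-th differential, which by exactness is the kernel of
  the previous map.  The differential then factors through its image by an epimorphism, and this
  factor has the same kernel because the inclusion of the image is monic.
\<close>

lemma syzygies_of_resolution:
  assumes R: "rel_proj_resolution A B U V R"
  obtains S \<iota> \<pi> where "syzygies V S (Rterm R) \<iota> \<pi>" and "\<And>m. Rdiff R m = \<iota> m \<cdot> \<pi> (Suc m)"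
proof -
  let ?P = "Rterm R" and ?d = "Rdiff R"
  (* the augmentation counts as the zeroth map, so that all exactness conditions have one form *)
  define T where "T m = (case m of 0 \<Rightarrow> V | Suc i \<Rightarrow> ?P i)" for m
  define \<delta> where "\<delta> m = (case m of 0 \<Rightarrow> Raug R | Suc i \<Rightarrow> ?d i)" for m
  have ex: "exact_at A (?P (Suc m)) (?P m) (T m) (?d m) (\<delta> m)" for m
    using R unfolding rel_proj_resolution_def T_def \<delta>_def by (cases m) auto
  then have "\<forall>m. \<exists>I i. is_image A (?P (Suc m)) (?P m) (?d m) I i \<and> is_kernel A (?P m) (T m) (\<delta> m) I i"
    unfolding exact_at_def by blast
  then obtain I \<iota> where im: "\<And>m. is_image A (?P (Suc m)) (?P m) (?d m) (I m) (\<iota> m)"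
    and ker: "\<And>m. is_kernel A (?P m) (T m) (\<delta> m) (I m) (\<iota> m)"
    by metis
  note kD = A.kernelD[OF ker]
  have "\<exists>q. A.arr q \<and> A.src q = ?P (Suc m) \<and> A.tgt q = I m \<and> \<iota> m \<cdot> q = ?d m" for m
  proof -
    obtain Q q where q: "is_cokernel A (?P (Suc m)) (?P m) (?d m) Q q" "is_kernel A (?P m) Q q (I m) (\<iota> m)"
      using im[of m] unfolding is_image_def by blast
    show ?thesis
      using A.kernel_factor[OF q(2), of "?d m"] A.cokernelD[OF q(1)] by metis
  qed
  then obtain \<rho> where \<rho>: "\<And>m. A.arr (\<rho> m)" "\<And>m. A.src (\<rho> m) = ?P (Suc m)" "\<And>m. A.tgt (\<rho> m) = I m"
      "\<And>m. \<iota> m \<cdot> \<rho> m = ?d m"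
    by metis
  define S where "S m = (case m of 0 \<Rightarrow> V | Suc i \<Rightarrow> I i)" for m
  define \<pi> where "\<pi> m = (case m of 0 \<Rightarrow> Raug R | Suc i \<Rightarrow> \<rho> i)" for m
  have ses: "A.ses (S (Suc m)) (?P m) (S m) (\<iota> m) (\<pi> m)" for m
  proof (cases m)
    case 0
    then show ?thesis
      using ker[of 0] R A.sesI unfolding S_def \<pi>_def T_def \<delta>_def rel_proj_resolution_def by simp
  next
    case (Suc i)
    have k: "is_kernel A (?P (Suc i)) (?P i) (?d i) (I (Suc i)) (\<iota> (Suc i))"
      using ker[of "Suc i"] by (simp add: T_def \<delta>_def)
    have "is_kernel A (?P (Suc i)) (I i) (\<rho> i) (I (Suc i)) (\<iota> (Suc i))"
    proof (rule A.kernelI[OF _ _ _ A.kernel_monic[OF k]])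
      show "A.arr (\<rho> i)" "A.src (\<rho> i) = ?P (Suc i)" "A.tgt (\<rho> i) = I i" using \<rho> by auto
      have "\<iota> i \<cdot> (\<rho> i \<cdot> \<iota> (Suc i)) = ?d i \<cdot> \<iota> (Suc i)"
        unfolding \<rho>(4)[symmetric] using \<rho>(1-3) kD by simp
      then show "\<rho> i \<cdot> \<iota> (Suc i) = zero_mor A (I (Suc i)) (I i)"
        using A.monic_cancel[OF A.kernel_monic[OF ker[of i]], of "\<rho> i \<cdot> \<iota> (Suc i)" "zero_mor A (I (Suc i)) (I i)"]
          \<rho>(1-3) kD(1-9) A.kernelD(10)[OF k] by simp
      fix t assume t: "A.arr t" "A.tgt t = ?P (Suc i)" "\<rho> i \<cdot> t = zero_mor A (A.src t) (I i)"
      have "?d i \<cdot> t = \<iota> i \<cdot> (\<rho> i \<cdot> t)"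
        unfolding \<rho>(4)[symmetric] using \<rho>(1-3) kD(1-9) t(1,2) by simp
      then have "?d i \<cdot> t = zero_mor A (A.src t) (?P i)" using t kD(1-9) by simp
      then show "\<exists>u. A.arr u \<and> A.src u = A.src t \<and> A.tgt u = I (Suc i) \<and> \<iota> (Suc i) \<cdot> u = t"
        using A.kernel_factor[OF k, of t] t by metis
    qed
    then show ?thesis
      using A.image_epic[OF im \<rho>] A.sesI Suc by (simp add: S_def \<pi>_def)
  qed
  have d: "?d m = \<iota> m \<cdot> \<pi> (Suc m)" for m by (simp add: \<pi>_def \<rho>)
  have al: "allowable A B U (?P (Suc m)) (?P m) (\<iota> m \<cdot> \<pi> (Suc m))" for m
    using R unfolding rel_proj_resolution_def d by blast
  have "allowable A B U (?P m) (S m) (\<pi> m)" for m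
  proof (cases m)
    case 0
    then show ?thesis using R by (simp add: rel_proj_resolution_def S_def \<pi>_def)
  next
    case (Suc i)
    then show ?thesis using allowable_factors(1)[OF ses ses al[of i]] by simp
  qed
  moreover have "allowable A B U (S (Suc m)) (?P m) (\<iota> m)" for m
    using allowable_factors(2)[OF ses ses al] .
  moreover have "S 0 = V" by (simp add: S_def)
  moreover have "rel_projective A B U (?P m)" for m using R by (simp add: rel_proj_resolution_def)
  ultimately have "syzygies V S ?P \<iota> \<pi>"
    unfolding syzygies_def allowable_short_exact_def A.short_exact_iff_ses using ses by blast
  then show thesis using that d by blast
qed

text \<open>
  Relative projectivity of P lifts a p along the allowable epimorphism p', and the lift maps
  the kernel of p into the kernel of p'.
\<close>

lemma cover:
  assumes s: "A.ses Y P X i p" and P: "rel_projective A B U P"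
    and s': "A.ses Y' P' X' i' p'" and al': "allowable A B U P' X' p'"
    and a: "A.arr a" "A.src a = X" "A.tgt a = X'"
  obtains \<alpha> a' where "A.arr \<alpha>" "A.src \<alpha> = P" "A.tgt \<alpha> = P'" "p' \<cdot> \<alpha> = a \<cdot> p"
    and "A.arr a'" "A.src a' = Y" "A.tgt a' = Y'" "i' \<cdot> a' = \<alpha> \<cdot> i"
proof -
  have k: "is_kernel A P X p Y i" and k': "is_kernel A P' X' p' Y' i'"
    and e': "epic A P' X' p'"
    using s s' A.cokernel_epic unfolding A.ses_def by auto
  note kD = A.kernelD[OF k] and kD' = A.kernelD[OF k']
  have "a \<cdot> p \<in> mor A P X'" using a kD kD' by simp
  then obtain \<alpha> where \<alpha>: "A.arr \<alpha>" "A.src \<alpha> = P" "A.tgt \<alpha> = P'" "p' \<cdot> \<alpha> = a \<cdot> p"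
    using P e' al' kD(1) kD'(1) unfolding rel_projective_def by (metis A.mor_iff)
  have "p' \<cdot> (\<alpha> \<cdot> i) = (p' \<cdot> \<alpha>) \<cdot> i" using \<alpha>(1-3) kD(1-9) kD'(1-9) by simp
  also have "\<dots> = zero_mor A Y X'" unfolding \<alpha>(4) using a kD by simp
  finally obtain a' where "A.arr a'" "A.src a' = Y" "A.tgt a' = Y'" "i' \<cdot> a' = \<alpha> \<cdot> i"
    using A.kernel_factor[OF k', of "\<alpha> \<cdot> i"] \<alpha> kD kD' by auto
  then show thesis using that \<alpha> by blast
qed

text \<open>
  Suppose b a differs from the identity of X by a map through a relatively projective Z.  Lifting
  the part \<open>v : Z \<rightarrow> X\<close> to P produces an endomorphism q of P that covers the identity of X.  Hence
  \<open>1 - q\<close> lands in the kernel Y; the resulting map \<open>h : P \<rightarrow> Y\<close> measures the defect of b' a' on Y,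
  because the summand through Z vanishes on Y.
\<close>

lemma cover_homotopy:
  assumes s: "A.ses Y P X i p" and al: "allowable A B U P X p"
    and s': "A.ses Y' P' X' i' p'"
    and a: "A.arr a" "A.src a = X" "A.tgt a = X'" and b: "A.arr b" "A.src b = X'" "A.tgt b = X"
    and \<alpha>: "A.arr \<alpha>" "A.src \<alpha> = P" "A.tgt \<alpha> = P'" "p' \<cdot> \<alpha> = a \<cdot> p"
    and a': "A.arr a'" "A.src a' = Y" "A.tgt a' = Y'" "i' \<cdot> a' = \<alpha> \<cdot> i"
    and \<beta>: "A.arr \<beta>" "A.src \<beta> = P'" "A.tgt \<beta> = P" "p \<cdot> \<beta> = b \<cdot> p'"
    and b': "A.arr b'" "A.src b' = Y'" "A.tgt b' = Y" "i \<cdot> b' = \<beta> \<cdot> i'"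
    and Z: "rel_projective A B U Z" and v: "A.arr v" "A.src v = Z" "A.tgt v = X"
    and u: "A.arr u" "A.src u = X" "A.tgt u = Z"
    and id: "Idm A X = (b \<cdot> a) \<oplus>\<^bsub>Hom A X X\<^esub> (v \<cdot> u)"
  obtains h where "A.arr h" "A.src h = P" "A.tgt h = Y"
    and "Idm A Y = (b' \<cdot> a') \<oplus>\<^bsub>Hom A Y Y\<^esub> (h \<cdot> i)"
proof -
  have k: "is_kernel A P X p Y i" and k': "is_kernel A P' X' p' Y' i'"
    and e: "epic A P X p"
    using s s' A.cokernel_epic unfolding A.ses_def by auto
  note kD = A.kernelD[OF k] and kD' = A.kernelD[OF k']
  have "v \<in> mor A Z X" using v kD by auto
  then obtain w where w: "A.arr w" "A.src w = Z" "A.tgt w = P" "p \<cdot> w = v"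
    using Z e al kD(1) unfolding rel_projective_def by (metis A.mor_iff)
  define q where "q = (\<beta> \<cdot> \<alpha>) \<oplus>\<^bsub>Hom A P P\<^esub> (w \<cdot> (u \<cdot> p))"
  have q: "A.arr q" "A.src q = P" "A.tgt q = P"
    unfolding q_def using \<alpha> \<beta> w u kD by simp_all
  have "p \<cdot> q = (p \<cdot> (\<beta> \<cdot> \<alpha>)) \<oplus>\<^bsub>Hom A P X\<^esub> (p \<cdot> (w \<cdot> (u \<cdot> p)))"
    unfolding q_def using A.Comp_add[of p P P "\<beta> \<cdot> \<alpha>" "w \<cdot> (u \<cdot> p)"] \<alpha>(1-3) \<beta>(1-3) w(1-3) u kD(1-9) by simp
  also have "p \<cdot> (\<beta> \<cdot> \<alpha>) = (p \<cdot> \<beta>) \<cdot> \<alpha>" using \<alpha>(1-3) \<beta>(1-3) kD(1-9) by simp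
  also have "\<dots> = b \<cdot> (p' \<cdot> \<alpha>)" unfolding \<beta>(4) using b \<alpha>(1-3) kD'(1-9) by simp
  also have "\<dots> = (b \<cdot> a) \<cdot> p" unfolding \<alpha>(4) using b a kD(1-9) by simp
  also have "p \<cdot> (w \<cdot> (u \<cdot> p)) = (p \<cdot> w) \<cdot> (u \<cdot> p)" using w(1-3) u kD(1-9) by simp
  also have "\<dots> = (v \<cdot> u) \<cdot> p" unfolding w(4) using v u kD(1-9) by simp
  also have "((b \<cdot> a) \<cdot> p) \<oplus>\<^bsub>Hom A P X\<^esub> ((v \<cdot> u) \<cdot> p) = Idm A X \<cdot> p"
    unfolding id using A.add_Comp[of p X X "b \<cdot> a" "v \<cdot> u"] a b v u kD(1-9) by simp
  also have "\<dots> = p" using kD by simp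
  finally have pq: "p \<cdot> q = p" .
  have "p \<cdot> (Idm A P \<ominus>\<^bsub>Hom A P P\<^esub> q) = p \<ominus>\<^bsub>Hom A P X\<^esub> p"
    using A.Comp_minus[of p P P "Idm A P" q] q kD(1-9) pq by simp
  also have "\<dots> = zero_mor A P X" using A.minus_eq_zero_iff[of p p] kD by simp
  finally obtain h where h: "A.arr h" "A.src h = P" "A.tgt h = Y" "i \<cdot> h = Idm A P \<ominus>\<^bsub>Hom A P P\<^esub> q"
    using A.kernel_factor[OF k, of "Idm A P \<ominus>\<^bsub>Hom A P P\<^esub> q"] q kD by auto
  have "q \<cdot> i = ((\<beta> \<cdot> \<alpha>) \<cdot> i) \<oplus>\<^bsub>Hom A Y P\<^esub> ((w \<cdot> (u \<cdot> p)) \<cdot> i)"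
    unfolding q_def using A.add_Comp[of i P P "\<beta> \<cdot> \<alpha>" "w \<cdot> (u \<cdot> p)"] \<alpha>(1-3) \<beta>(1-3) w(1-3) u kD(1-9) by simp
  also have "(w \<cdot> (u \<cdot> p)) \<cdot> i = zero_mor A Y P" using w(1-3) u kD by simp
  also have "(\<beta> \<cdot> \<alpha>) \<cdot> i = \<beta> \<cdot> (\<alpha> \<cdot> i)" using \<alpha>(1-3) \<beta>(1-3) kD(1-9) by simp
  also have "\<dots> = (\<beta> \<cdot> i') \<cdot> a'" unfolding a'(4)[symmetric] using \<beta>(1-3) a'(1-3) kD'(1-9) by simp
  also have "\<dots> = i \<cdot> (b' \<cdot> a')" unfolding b'(4)[symmetric] using b'(1-3) a'(1-3) kD(1-9) by simp
  finally have qi: "q \<cdot> i = i \<cdot> (b' \<cdot> a')"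
    using abelian_monoid.r_zero[OF abelian_group.axioms(1)[OF A.Hom_abelian_group[of Y P]], of "i \<cdot> (b' \<cdot> a')"]
      a'(1-3) b'(1-3) kD(1-9) by simp
  interpret H: abelian_group "Hom A Y P" using A.Hom_abelian_group kD by simp
  have "i \<cdot> (h \<cdot> i) = (i \<cdot> h) \<cdot> i" using h(1-3) kD(1-9) by simp
  also have "\<dots> = i \<ominus>\<^bsub>Hom A Y P\<^esub> (i \<cdot> (b' \<cdot> a'))"
    unfolding h(4) using A.minus_Comp[of i P P "Idm A P" q] q kD(1-9) qi by simp
  finally have ihi: "i \<cdot> (h \<cdot> i) = i \<ominus>\<^bsub>Hom A Y P\<^esub> (i \<cdot> (b' \<cdot> a'))" .
  have m: "i \<in> mor A Y P" "i \<cdot> (b' \<cdot> a') \<in> mor A Y P" using a'(1-3) b'(1-3) kD by simp_all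
  have "i \<cdot> ((b' \<cdot> a') \<oplus>\<^bsub>Hom A Y Y\<^esub> (h \<cdot> i)) = (i \<cdot> (b' \<cdot> a')) \<oplus>\<^bsub>Hom A Y P\<^esub> (i \<cdot> (h \<cdot> i))"
    using A.Comp_add[of i Y Y "b' \<cdot> a'" "h \<cdot> i"] a'(1-3) b'(1-3) h(1-3) kD(1-9) by simp
  also have "\<dots> = i"
    unfolding ihi a_minus_def
    using H.r_neg2[OF m(2,1)] H.a_comm[OF m(1) H.a_inv_closed[OF m(2)]]
      H.a_lcomm[OF m(2) m(1) H.a_inv_closed[OF m(2)]] H.r_neg[OF m(2)] H.r_zero[OF m(1)]
    by (simp only:)
  finally have "i \<cdot> Idm A Y = i \<cdot> ((b' \<cdot> a') \<oplus>\<^bsub>Hom A Y Y\<^esub> (h \<cdot> i))" using kD by simp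
  then have "Idm A Y = (b' \<cdot> a') \<oplus>\<^bsub>Hom A Y Y\<^esub> (h \<cdot> i)"
    by (rule A.monic_cancel[OF A.kernel_monic[OF k]]) (use a'(1-3) b'(1-3) h(1-3) kD in simp_all)
  then show thesis using that h by blast
qed

end

section \<open>Comparison of syzygies\<close>

context relative_setting
begin

text \<open>
  \<open>b \<cdot> a = 1\<close> in the stable category, where maps that factor through a relatively projective
  object are zero.
\<close>

definition stable_retract
  where "stable_retract X X' a b \<longleftrightarrow> X \<in> Ob A \<and> X' \<in> Ob A \<and> a \<in> mor A X X' \<and> b \<in> mor A X' X \<and>
    (\<exists>Z v u. rel_projective A B U Z \<and> v \<in> mor A Z X \<and> u \<in> mor A X Z \<and>
      Idm A X = (b \<cdot> a) \<oplus>\<^bsub>Hom A X X\<^esub> (v \<cdot> u))"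

text \<open>
  Passing to syzygies preserves stable isomorphism.  The defect on the syzygies even factors
  through the inclusion into P, and P is relatively projective, so the step can be iterated.
\<close>

lemma stable_retract_syzygy:
  assumes s: "A.ses Y P X i p" and al: "allowable A B U P X p" and P: "rel_projective A B U P"
    and s': "A.ses Y' P' X' i' p'" and al': "allowable A B U P' X' p'" and P': "rel_projective A B U P'"
    and ab: "stable_retract X X' a b" and ba: "stable_retract X' X b a"
  obtains a' b' \<alpha> \<beta> h h' where "a' \<in> mor A Y Y'" and "b' \<in> mor A Y' Y"
    and "\<alpha> \<in> mor A P P'" and "\<beta> \<in> mor A P' P" and "h \<in> mor A P Y" and "h' \<in> mor A P' Y'"
    and "i' \<cdot> a' = \<alpha> \<cdot> i" and "i \<cdot> b' = \<beta> \<cdot> i'"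
    and "Idm A Y = (b' \<cdot> a') \<oplus>\<^bsub>Hom A Y Y\<^esub> (h \<cdot> i)"
    and "Idm A Y' = (a' \<cdot> b') \<oplus>\<^bsub>Hom A Y' Y'\<^esub> (h' \<cdot> i')"
    and "stable_retract Y Y' a' b'" and "stable_retract Y' Y b' a'"
proof -
  have ob: "X \<in> Ob A" "P \<in> Ob A" "Y \<in> Ob A" "X' \<in> Ob A" "P' \<in> Ob A" "Y' \<in> Ob A"
    and i: "i \<in> mor A Y P" "i' \<in> mor A Y' P'"
    using s s' unfolding A.ses_def is_kernel_def by auto
  have a: "A.arr a" "A.src a = X" "A.tgt a = X'" and b: "A.arr b" "A.src b = X'" "A.tgt b = X"
    using ab ob unfolding stable_retract_def by auto
  obtain \<alpha> a' where \<alpha>: "A.arr \<alpha>" "A.src \<alpha> = P" "A.tgt \<alpha> = P'" "p' \<cdot> \<alpha> = a \<cdot> p"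
    and a': "A.arr a'" "A.src a' = Y" "A.tgt a' = Y'" "i' \<cdot> a' = \<alpha> \<cdot> i"
    using cover[OF s P s' al' a] by metis
  obtain \<beta> b' where \<beta>: "A.arr \<beta>" "A.src \<beta> = P'" "A.tgt \<beta> = P" "p \<cdot> \<beta> = b \<cdot> p'"
    and b': "A.arr b'" "A.src b' = Y'" "A.tgt b' = Y" "i \<cdot> b' = \<beta> \<cdot> i'"
    using cover[OF s' P' s al b] by metis
  obtain Z v u where Z: "rel_projective A B U Z" and "v \<in> mor A Z X" "u \<in> mor A X Z"
    and id: "Idm A X = (b \<cdot> a) \<oplus>\<^bsub>Hom A X X\<^esub> (v \<cdot> u)"
    using ab unfolding stable_retract_def by blast
  then have vu: "A.arr v" "A.src v = Z" "A.tgt v = X" "A.arr u" "A.src u = X" "A.tgt u = Z"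
    using ob by (auto simp: rel_projective_def)
  obtain h where h: "A.arr h" "A.src h = P" "A.tgt h = Y"
    and idY: "Idm A Y = (b' \<cdot> a') \<oplus>\<^bsub>Hom A Y Y\<^esub> (h \<cdot> i)"
    using cover_homotopy[OF s al s' a b \<alpha> a' \<beta> b' Z vu id] by metis
  obtain Z' v' u' where Z': "rel_projective A B U Z'" and "v' \<in> mor A Z' X'" "u' \<in> mor A X' Z'"
    and id': "Idm A X' = (a \<cdot> b) \<oplus>\<^bsub>Hom A X' X'\<^esub> (v' \<cdot> u')"
    using ba unfolding stable_retract_def by blast
  then have vu': "A.arr v'" "A.src v' = Z'" "A.tgt v' = X'" "A.arr u'" "A.src u' = X'" "A.tgt u' = Z'"
    using ob by (auto simp: rel_projective_def)
  obtain h' where h': "A.arr h'" "A.src h' = P'" "A.tgt h' = Y'"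
    and idY': "Idm A Y' = (a' \<cdot> b') \<oplus>\<^bsub>Hom A Y' Y'\<^esub> (h' \<cdot> i')"
    using cover_homotopy[OF s' al' s b a \<beta> b' \<alpha> a' Z' vu' id'] by metis
  have m: "a' \<in> mor A Y Y'" "b' \<in> mor A Y' Y" "\<alpha> \<in> mor A P P'" "\<beta> \<in> mor A P' P"
      "h \<in> mor A P Y" "h' \<in> mor A P' Y'"
    using a' b' \<alpha> \<beta> h h' ob by simp_all
  have "stable_retract Y Y' a' b'" "stable_retract Y' Y b' a'"
    unfolding stable_retract_def using m i ob P P' idY idY' by blast+
  then show thesis using that m a'(4) b'(4) idY idY' by blast
qed

lemma syzygies_comparison:
  assumes s: "syzygies V S P \<iota> \<pi>" and s': "syzygies V S' P' \<iota>' \<pi>'"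
  obtains a b \<alpha> \<beta> h h' where "a \<in> mor A (S (Suc m)) (S' (Suc m))" and "b \<in> mor A (S' (Suc m)) (S (Suc m))"
    and "\<alpha> \<in> mor A (P m) (P' m)" and "\<beta> \<in> mor A (P' m) (P m)"
    and "h \<in> mor A (P m) (S (Suc m))" and "h' \<in> mor A (P' m) (S' (Suc m))"
    and "\<iota>' m \<cdot> a = \<alpha> \<cdot> \<iota> m" and "\<iota> m \<cdot> b = \<beta> \<cdot> \<iota>' m"
    and "Idm A (S (Suc m)) = (b \<cdot> a) \<oplus>\<^bsub>Hom A (S (Suc m)) (S (Suc m))\<^esub> (h \<cdot> \<iota> m)"
    and "Idm A (S' (Suc m)) = (a \<cdot> b) \<oplus>\<^bsub>Hom A (S' (Suc m)) (S' (Suc m))\<^esub> (h' \<cdot> \<iota>' m)"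
proof -
  note D = syzygiesD[OF s] and D' = syzygiesD[OF s']
  have V: "S 0 = V" "S' 0 = V" using s s' by (auto simp: syzygies_def)
  have V_Ob: "V \<in> Ob A" using V(1) syzygies_simps(1)[OF s] by metis
  have "\<exists>a b. stable_retract (S m) (S' m) a b \<and> stable_retract (S' m) (S m) b a" for m
  proof (induction m)
    case 0
    interpret H: abelian_group "Hom A V V" using A.Hom_abelian_group V_Ob by simp
    have P: "P 0 \<in> Ob A" using syzygies_simps[OF s] by simp
    have "Idm A V = (Idm A V \<cdot> Idm A V) \<oplus>\<^bsub>Hom A V V\<^esub> (zero_mor A (P 0) V \<cdot> zero_mor A V (P 0))"
      using V_Ob P H.r_zero[of "Idm A V"] by simp
    then have "stable_retract V V (Idm A V) (Idm A V)"
      unfolding stable_retract_def using V_Ob P D(3)[of 0]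
      by (intro conjI exI[of _ "P 0"] exI[of _ "zero_mor A (P 0) V"] exI[of _ "zero_mor A V (P 0)"]) simp_all
    then show ?case using V by metis
  next
    case (Suc m)
    then obtain a b where ab: "stable_retract (S m) (S' m) a b" "stable_retract (S' m) (S m) b a" by blast
    show ?case
      by (rule stable_retract_syzygy[OF D(1-3)[of m] D'(1-3)[of m] ab]) blast
  qed
  then obtain a b where ab: "stable_retract (S m) (S' m) a b" "stable_retract (S' m) (S m) b a" by blast
  show thesis
    by (rule stable_retract_syzygy[OF D(1-3)[of m] D'(1-3)[of m] ab]) (rule that)
qed

lemma coboundary_submodule:
  assumes "A.arr f" and "W \<in> Ob A"
  shows "submodule ((\<lambda>g. g \<cdot> f) ` mor A (A.tgt f) W) k (Hom A (A.src f) W)"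
  using assms linear_map_image_submodule[OF A.Hom_module A.Hom_module A.precomp_linear[OF assms]]
  by (simp del: A.mor_iff)

lemma minus_of_sum:
  assumes "X \<in> Ob A" and "Y \<in> Ob A" and "f \<in> mor A X Y" and "g \<in> mor A X Y"
  shows "(f \<oplus>\<^bsub>Hom A X Y\<^esub> g) \<ominus>\<^bsub>Hom A X Y\<^esub> f = g"
proof -
  interpret H: abelian_group "Hom A X Y" using A.Hom_abelian_group assms by simp
  show ?thesis
    unfolding a_minus_def
    using H.a_comm[OF assms(3,4)] H.a_assoc[OF assms(4,3) H.a_inv_closed[OF assms(3)]]
      H.r_neg[OF assms(3)] H.r_zero[OF assms(4)]
    by (simp only:)
qed

text \<open>
  Precomposition with the comparison map b is bijective modulo coboundaries: composed with
  precomposition with a it differs from the identity by \<open>f \<mapsto> f \<cdot> h \<cdot> \<iota>\<close>, which extends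
  along \<open>\<iota>\<close>.
\<close>

lemma syzygy_quot_invariant:
  assumes s: "syzygies V S P \<iota> \<pi>" and s': "syzygies V S' P' \<iota>' \<pi>'" and W: "W \<in> Ob A"
  shows "module_isomorphic k
    (quot_module (Hom A (S (Suc m)) W) ((\<lambda>f. f \<cdot> \<iota> m) ` mor A (P m) W))
    (quot_module (Hom A (S' (Suc m)) W) ((\<lambda>f. f \<cdot> \<iota>' m) ` mor A (P' m) W))"
proof -
  let ?X = "S (Suc m)" and ?X' = "S' (Suc m)"
  let ?N = "(\<lambda>f. f \<cdot> \<iota> m) ` mor A (P m) W" and ?N' = "(\<lambda>f. f \<cdot> \<iota>' m) ` mor A (P' m) W"
  note S = syzygies_simps[OF s] and S' = syzygies_simps[OF s']
  obtain a b \<alpha> \<beta> h h' where mm: "a \<in> mor A ?X ?X'" "b \<in> mor A ?X' ?X"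
      "\<alpha> \<in> mor A (P m) (P' m)" "\<beta> \<in> mor A (P' m) (P m)" "h \<in> mor A (P m) ?X" "h' \<in> mor A (P' m) ?X'"
    and eq: "\<iota>' m \<cdot> a = \<alpha> \<cdot> \<iota> m" "\<iota> m \<cdot> b = \<beta> \<cdot> \<iota>' m"
    and id: "Idm A ?X = (b \<cdot> a) \<oplus>\<^bsub>Hom A ?X ?X\<^esub> (h \<cdot> \<iota> m)"
    and id': "Idm A ?X' = (a \<cdot> b) \<oplus>\<^bsub>Hom A ?X' ?X'\<^esub> (h' \<cdot> \<iota>' m)"
    by (rule syzygies_comparison[OF s s', of m])
  have a: "A.arr a" "A.src a = ?X" "A.tgt a = ?X'" and b: "A.arr b" "A.src b = ?X'" "A.tgt b = ?X"
    and \<alpha>: "A.arr \<alpha>" "A.src \<alpha> = P m" "A.tgt \<alpha> = P' m" and \<beta>: "A.arr \<beta>" "A.src \<beta> = P' m" "A.tgt \<beta> = P m"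
    and h: "A.arr h" "A.src h = P m" "A.tgt h = ?X" and h': "A.arr h'" "A.src h' = P' m" "A.tgt h' = ?X'"
    using mm S(1,2) S'(1,2) by simp_all
  have lin: "linear_map k (Hom A ?X W) (Hom A ?X' W) (\<lambda>f. f \<cdot> b)"
    using A.precomp_linear[of b W] b W by simp
  have sub: "submodule ?N k (Hom A ?X W)" and sub': "submodule ?N' k (Hom A ?X' W)"
    using coboundary_submodule[of "\<iota> m" W] coboundary_submodule[of "\<iota>' m" W] S(3-5) S'(3-5) W
    by (simp_all del: A.mor_iff)
  show ?thesis
  proof (rule quot_module_isomorphicI[OF _ _ sub sub' lin])
    fix f assume "f \<in> mor A ?X W"
    then have f: "A.arr f" "A.src f = ?X" "A.tgt f = W" using S(1) W by auto
    show "f \<cdot> b \<in> ?N' \<longleftrightarrow> f \<in> ?N"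
    proof
      assume "f \<in> ?N"
      then obtain g where "g \<in> mor A (P m) W" and fg: "f = g \<cdot> \<iota> m" by blast
      then have g: "A.arr g" "A.src g = P m" "A.tgt g = W" using S(2) W by auto
      have "f \<cdot> b = g \<cdot> (\<iota> m \<cdot> b)" unfolding fg using g b S(3-5) by simp
      also have "\<dots> = (g \<cdot> \<beta>) \<cdot> \<iota>' m" unfolding eq using g \<beta> S'(3-5) by simp
      finally show "f \<cdot> b \<in> ?N'" using g \<beta> S'(2) W by (intro image_eqI[of _ _ "g \<cdot> \<beta>"]) simp_all
    next
      assume "f \<cdot> b \<in> ?N'"
      then obtain g where "g \<in> mor A (P' m) W" and fg: "f \<cdot> b = g \<cdot> \<iota>' m" by blast
      then have g: "A.arr g" "A.src g = P' m" "A.tgt g = W" using S'(2) W by auto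
      have "f = f \<cdot> Idm A ?X" using f by simp
      also have "\<dots> = (f \<cdot> (b \<cdot> a)) \<oplus>\<^bsub>Hom A ?X W\<^esub> (f \<cdot> (h \<cdot> \<iota> m))"
        unfolding id using A.Comp_add[of f ?X ?X "b \<cdot> a" "h \<cdot> \<iota> m"] f a b h S(1-5) by simp
      also have "f \<cdot> (b \<cdot> a) = (f \<cdot> b) \<cdot> a" using f a b by simp
      also have "\<dots> = g \<cdot> (\<iota>' m \<cdot> a)" unfolding fg using g a S'(3-5) by simp
      also have "\<dots> = (g \<cdot> \<alpha>) \<cdot> \<iota> m" unfolding eq using g \<alpha> S(3-5) by simp
      also have "f \<cdot> (h \<cdot> \<iota> m) = (f \<cdot> h) \<cdot> \<iota> m" using f h S(3-5) by simp
      also have "((g \<cdot> \<alpha>) \<cdot> \<iota> m) \<oplus>\<^bsub>Hom A ?X W\<^esub> ((f \<cdot> h) \<cdot> \<iota> m)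
          = ((g \<cdot> \<alpha>) \<oplus>\<^bsub>Hom A (P m) W\<^esub> (f \<cdot> h)) \<cdot> \<iota> m"
        using A.add_Comp[of "\<iota> m" "P m" W "g \<cdot> \<alpha>" "f \<cdot> h"] g \<alpha> f h S(3-5) W by simp
      finally show "f \<in> ?N"
        using g \<alpha> f h S(2) W by (intro image_eqI[of _ _ "(g \<cdot> \<alpha>) \<oplus>\<^bsub>Hom A (P m) W\<^esub> (f \<cdot> h)"]) simp_all
    qed
  next
    fix y assume ym: "y \<in> mor A ?X' W"
    then have y: "A.arr y" "A.src y = ?X'" "A.tgt y = W" using S'(1) W by auto
    have "y = y \<cdot> Idm A ?X'" using y by simp
    also have "\<dots> = ((y \<cdot> a) \<cdot> b) \<oplus>\<^bsub>Hom A ?X' W\<^esub> ((y \<cdot> h') \<cdot> \<iota>' m)"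
      unfolding id' using A.Comp_add[of y ?X' ?X' "a \<cdot> b" "h' \<cdot> \<iota>' m"] y a b h' S'(1-5) by simp
    finally have "y \<ominus>\<^bsub>Hom A ?X' W\<^esub> ((y \<cdot> a) \<cdot> b) = (y \<cdot> h') \<cdot> \<iota>' m"
      using minus_of_sum[of ?X' W "(y \<cdot> a) \<cdot> b" "(y \<cdot> h') \<cdot> \<iota>' m"] y a b h' S'(1-5) W by simp
    then have "y \<ominus>\<^bsub>Hom A ?X' W\<^esub> ((y \<cdot> a) \<cdot> b) \<in> ?N'"
      using y h' S'(2) W by (intro image_eqI[of _ _ "y \<cdot> h'"]) simp_all
    then show "\<exists>x \<in> mor A ?X W. y \<ominus>\<^bsub>Hom A ?X' W\<^esub> (x \<cdot> b) \<in> ?N'"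
      using y a S(1) W by (intro bexI[of _ "y \<cdot> a"]) simp_all
  qed (use A.Hom_module S(1) S'(1) W in auto)
qed

text \<open>
  A map on \<open>P (Suc m)\<close> is a cocycle iff it vanishes on \<open>S (Suc (Suc m))\<close>, iff it factors
  through \<open>\<pi> (Suc m)\<close>.  The factor is a map on \<open>S (Suc m)\<close>, and under this correspondence a
  coboundary is a map that extends along \<open>\<iota> m\<close>.
\<close>

lemma cohomology_syzygy:
  assumes s: "syzygies V S (Rterm R) \<iota> \<pi>" and d: "\<And>m. Rdiff R m = \<iota> m \<cdot> \<pi> (Suc m)" and W: "W \<in> Ob A"
  shows "module_isomorphic k (hom_cohomology A R (Suc m) W)
    (quot_module (Hom A (S (Suc m)) W) ((\<lambda>f. f \<cdot> \<iota> m) ` mor A (Rterm R m) W))"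
proof -
  let ?P = "Rterm R" and ?d = "Rdiff R"
  let ?X = "S (Suc m)" and ?N = "(\<lambda>f. f \<cdot> \<iota> m) ` mor A (?P m) W"
  note S = syzygies_simps[OF s]
  define Z where "Z = (Hom A (?P (Suc m)) W)\<lparr>carrier :=
      {f \<in> mor A (?P (Suc m)) W. f \<cdot> ?d (Suc m) = zero_mor A (?P (Suc (Suc m))) W}\<rparr>"
  have dm: "A.arr (?d i)" "A.src (?d i) = ?P (Suc i)" "A.tgt (?d i) = ?P i" for i
    unfolding d using S by simp_all
  have Zc: "f \<in> carrier Z \<longleftrightarrow> A.arr f \<and> A.src f = ?P (Suc m) \<and> A.tgt f = W \<and>
      f \<cdot> ?d (Suc m) = zero_mor A (?P (Suc (Suc m))) W" for f
    unfolding Z_def using S(2) W by auto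
  have Zm: "module k Z"
    unfolding Z_def
    using submodule.submodule_is_module[OF linear_map_kernel_submodule[OF A.Hom_module A.Hom_module
          A.precomp_linear[OF dm(1)[of "Suc m"] W]]] A.Hom_module S(2) W dm(2,3)[of "Suc m"]
    by simp
  have "linear_map k (Hom A (?P m) W) Z (\<lambda>f. f \<cdot> ?d m)"
  proof -
    have "linear_map k (Hom A (?P m) W) (Hom A (?P (Suc m)) W) (\<lambda>f. f \<cdot> ?d m)"
      using A.precomp_linear[OF dm(1)[of m] W] dm by simp
    moreover have "f \<cdot> ?d m \<in> carrier Z" if "f \<in> mor A (?P m) W" for f
    proof -
      have f: "A.arr f" "A.src f = ?P m" "A.tgt f = W" using that S(2) W by auto
      have "?d m \<cdot> ?d (Suc m) = \<iota> m \<cdot> ((\<pi> (Suc m) \<cdot> \<iota> (Suc m)) \<cdot> \<pi> (Suc (Suc m)))"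
        unfolding d using S(1-8) by simp
      then have "?d m \<cdot> ?d (Suc m) = zero_mor A (?P (Suc (Suc m))) (?P m)" using S by simp
      then show ?thesis unfolding Zc using f dm W S(2) by simp
    qed
    ultimately show ?thesis unfolding linear_map_def Z_def by simp
  qed
  then have sub: "submodule ((\<lambda>f. f \<cdot> ?d m) ` mor A (?P m) W) k Z"
    using linear_map_image_submodule[OF A.Hom_module Zm] S(2) W by (simp del: A.mor_iff)
  have sub': "submodule ?N k (Hom A ?X W)"
    using coboundary_submodule[of "\<iota> m" W] S(3-5) W by (simp del: A.mor_iff)
  define \<psi> where "\<psi> f = (SOME g. A.arr g \<and> A.src g = ?X \<and> A.tgt g = W \<and> g \<cdot> \<pi> (Suc m) = f)" for f
  have \<psi>: "A.arr (\<psi> f) \<and> A.src (\<psi> f) = ?X \<and> A.tgt (\<psi> f) = W \<and> \<psi> f \<cdot> \<pi> (Suc m) = f"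
    if "f \<in> carrier Z" for f
  proof -
    have f: "A.arr f" "A.src f = ?P (Suc m)" "A.tgt f = W"
        "f \<cdot> (\<iota> (Suc m) \<cdot> \<pi> (Suc (Suc m))) = zero_mor A (?P (Suc (Suc m))) W"
      using that Zc d by auto
    have "f \<cdot> \<iota> (Suc m) = zero_mor A (S (Suc (Suc m))) W"
      using A.epic_cancel[OF S(10)[of "Suc (Suc m)"], of "f \<cdot> \<iota> (Suc m)" "zero_mor A (S (Suc (Suc m))) W"]
        f S(1-8) W by simp
    then have "\<exists>g. A.arr g \<and> A.src g = ?X \<and> A.tgt g = W \<and> g \<cdot> \<pi> (Suc m) = f"
      using A.cokernel_factor[OF syzygiesD(4)[OF s, of "Suc m"], of f] f(1-3) by metis
    then show ?thesis unfolding \<psi>_def by (rule someI_ex)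
  qed
  have \<psi>_eq: "\<psi> (g \<cdot> \<pi> (Suc m)) = g" and \<pi>_Z: "g \<cdot> \<pi> (Suc m) \<in> carrier Z"
    if "A.arr g" "A.src g = ?X" "A.tgt g = W" for g
  proof -
    have "g \<cdot> (\<pi> (Suc m) \<cdot> (\<iota> (Suc m) \<cdot> \<pi> (Suc (Suc m))))
        = g \<cdot> ((\<pi> (Suc m) \<cdot> \<iota> (Suc m)) \<cdot> \<pi> (Suc (Suc m)))"
      using that S(1-8) by simp
    then show *: "g \<cdot> \<pi> (Suc m) \<in> carrier Z" unfolding Zc d using that S W by simp
    show "\<psi> (g \<cdot> \<pi> (Suc m)) = g"
      using A.epic_cancel[OF S(10)[of "Suc m"], of "\<psi> (g \<cdot> \<pi> (Suc m))" g] \<psi>[OF *] that by simp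
  qed
  have lin: "linear_map k Z (Hom A ?X W) \<psi>"
  proof -
    have "linear_map k (Hom A ?X W) (Hom A (?P (Suc m)) W) (\<lambda>g. g \<cdot> \<pi> (Suc m))"
      using A.precomp_linear[of "\<pi> (Suc m)" W] S W by simp
    then have add: "(g \<oplus>\<^bsub>Hom A ?X W\<^esub> g') \<cdot> \<pi> (Suc m) = g \<cdot> \<pi> (Suc m) \<oplus>\<^bsub>Z\<^esub> g' \<cdot> \<pi> (Suc m)"
      and smult: "c \<in> carrier k \<Longrightarrow> (c \<odot>\<^bsub>Hom A ?X W\<^esub> g) \<cdot> \<pi> (Suc m) = c \<odot>\<^bsub>Z\<^esub> (g \<cdot> \<pi> (Suc m))"
      if "A.arr g" "A.src g = ?X" "A.tgt g = W" "A.arr g'" "A.src g' = ?X" "A.tgt g' = W" for c g g'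
      using that S(1) W unfolding linear_map_def Z_def by simp_all
    show ?thesis
      unfolding linear_map_def
    proof (intro conjI ballI)
      fix f f' assume f: "f \<in> carrier Z" "f' \<in> carrier Z"
      show "\<psi> f \<in> mor A ?X W" using \<psi>[OF f(1)] S(1) W by simp
      have "f \<oplus>\<^bsub>Z\<^esub> f' = (\<psi> f \<oplus>\<^bsub>Hom A ?X W\<^esub> \<psi> f') \<cdot> \<pi> (Suc m)"
        using add[of "\<psi> f" "\<psi> f'"] \<psi>[OF f(1)] \<psi>[OF f(2)] by simp
      then show "\<psi> (f \<oplus>\<^bsub>Z\<^esub> f') = \<psi> f \<oplus>\<^bsub>Hom A ?X W\<^esub> \<psi> f'"
        using \<psi>_eq \<psi>[OF f(1)] \<psi>[OF f(2)] S(1) W by simp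
    next
      fix c f assume c: "c \<in> carrier k" and f: "f \<in> carrier Z"
      have "c \<odot>\<^bsub>Z\<^esub> f = (c \<odot>\<^bsub>Hom A ?X W\<^esub> \<psi> f) \<cdot> \<pi> (Suc m)"
        using smult[of "\<psi> f" "\<psi> f" c] \<psi>[OF f] c by simp
      then show "\<psi> (c \<odot>\<^bsub>Z\<^esub> f) = c \<odot>\<^bsub>Hom A ?X W\<^esub> \<psi> f"
        using \<psi>_eq \<psi>[OF f] S(1) W c by simp
    qed
  qed
  have "module_isomorphic k (quot_module Z ((\<lambda>f. f \<cdot> ?d m) ` mor A (?P m) W)) (quot_module (Hom A ?X W) ?N)"
  proof (rule quot_module_isomorphicI[OF Zm _ sub sub' lin])
    fix f assume f: "f \<in> carrier Z"
    show "\<psi> f \<in> ?N \<longleftrightarrow> f \<in> (\<lambda>f. f \<cdot> ?d m) ` mor A (?P m) W"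
    proof
      assume "\<psi> f \<in> ?N"
      then obtain g where gm: "g \<in> mor A (?P m) W" and "\<psi> f = g \<cdot> \<iota> m" by blast
      then have "f = g \<cdot> ?d m" using \<psi>[OF f] S W unfolding d by auto
      then show "f \<in> (\<lambda>f. f \<cdot> ?d m) ` mor A (?P m) W" using gm by blast
    next
      assume "f \<in> (\<lambda>f. f \<cdot> ?d m) ` mor A (?P m) W"
      then obtain g where gm: "g \<in> mor A (?P m) W" and fg: "f = g \<cdot> ?d m" by blast
      then have "f = (g \<cdot> \<iota> m) \<cdot> \<pi> (Suc m)" using S W unfolding d by simp
      then have "\<psi> f = g \<cdot> \<iota> m" using \<psi>_eq[of "g \<cdot> \<iota> m"] gm S W by simp
      then show "\<psi> f \<in> ?N" using gm by blast
    qed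
  next
    fix y assume ym: "y \<in> mor A ?X W"
    then have y: "A.arr y" "A.src y = ?X" "A.tgt y = W" using S(1) W by auto
    have "y \<ominus>\<^bsub>Hom A ?X W\<^esub> \<psi> (y \<cdot> \<pi> (Suc m)) = zero_mor A ?X W"
      using A.minus_eq_zero_iff[of y y] \<psi>_eq[OF y] y by simp
    then show "\<exists>x \<in> carrier Z. y \<ominus>\<^bsub>Hom A ?X W\<^esub> \<psi> x \<in> ?N"
      using \<pi>_Z[OF y] subgroup.one_closed[OF submodule.axioms(1)[OF sub']]
      by (intro bexI[of _ "y \<cdot> \<pi> (Suc m)"]) simp_all
  qed (use A.Hom_module S(1) W in auto)
  then show ?thesis by (simp add: hom_cohomology_def Z_def)
qed

text \<open>
  The given syzygies serve twice: they show that resolutions of V exist, so that the one chosen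
  in the definition of relative Ext is a resolution, and they are then compared with its syzygies.
\<close>

lemma rel_Ext_syzygy:
  assumes s: "syzygies V S P \<iota> \<pi>" and W: "W \<in> Ob A"
  shows "module_isomorphic k (rel_Ext A B U (Suc m) V W)
    (quot_module (Hom A (S (Suc m)) W) ((\<lambda>f. f \<cdot> \<iota> m) ` mor A (P m) W))"
proof -
  define R where "R = (SOME R. rel_proj_resolution A B U V R)"
  have "rel_proj_resolution A B U V R"
    unfolding R_def using resolution_of_syzygies[OF s] by (rule someI)
  then obtain S' \<iota>' \<pi>' where s': "syzygies V S' (Rterm R) \<iota>' \<pi>'" and d: "\<And>m. Rdiff R m = \<iota>' m \<cdot> \<pi>' (Suc m)"
    using syzygies_of_resolution by metis
  show ?thesis
    unfolding rel_Ext_def R_def[symmetric]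
    by (rule module_isomorphic_trans[OF cohomology_syzygy[OF s' d W] syzygy_quot_invariant[OF s' s W]])
qed

end

section \<open>Tensoring allowable sequences\<close>

locale monoidal_setting = A: strict_tensor_category k A + B: strict_tensor_category k B
  for k :: "('k, 'r) ring_scheme"
    and A :: "('k, 'oa, 'ma, 'za) mon_cat_scheme" (structure)
    and B :: "('k, 'ob, 'mb, 'zb) mon_cat_scheme" +
  fixes U :: "('oa, 'ma, 'ob, 'mb) fctr" and J :: "'oa \<Rightarrow> 'oa \<Rightarrow> 'mb" and e :: 'mb
  assumes U_exact: "exact_functor A B U" and U_monoidal: "monoidal_functor A B U J e"

sublocale monoidal_setting \<subseteq> relative_setting k A B U
  using U_exact by unfold_locales (auto simp: exact_functor_def)

context monoidal_setting
begin

lemma J_inverse: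
  assumes "X \<in> Ob A" and "Y \<in> Ob A"
  obtains K where "B.arr (J X Y)" and "B.src (J X Y) = Fob U X \<boxtimes>\<^bsub>B\<^esub> Fob U Y"
    and "B.tgt (J X Y) = Fob U (X \<boxtimes> Y)"
    and "B.arr K" and "B.src K = Fob U (X \<boxtimes> Y)" and "B.tgt K = Fob U X \<boxtimes>\<^bsub>B\<^esub> Fob U Y"
    and "K \<cdot>\<^bsub>B\<^esub> J X Y = Idm B (Fob U X \<boxtimes>\<^bsub>B\<^esub> Fob U Y)" and "J X Y \<cdot>\<^bsub>B\<^esub> K = Idm B (Fob U (X \<boxtimes> Y))"
proof -
  have "invertible B (Fob U X \<boxtimes>\<^bsub>B\<^esub> Fob U Y) (Fob U (X \<boxtimes> Y)) (J X Y)"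
    using U_monoidal assms unfolding monoidal_functor_def by blast
  then show thesis using that assms unfolding invertible_def by auto
qed

lemma J_natural:
  assumes "A.arr f" and "V \<in> Ob A"
  shows "J (A.tgt f) V \<cdot>\<^bsub>B\<^esub> (Fmor U f \<boxdot>\<^bsub>B\<^esub> Idm B (Fob U V)) = Fmor U (f \<boxdot> Idm A V) \<cdot>\<^bsub>B\<^esub> J (A.src f) V"
proof -
  have "f \<in> mor A (A.src f) (A.tgt f)" "Idm A V \<in> mor A V V" "A.src f \<in> Ob A" "A.tgt f \<in> Ob A"
    using assms by auto
  then have "J (A.tgt f) V \<cdot>\<^bsub>B\<^esub> (Fmor U f \<boxdot>\<^bsub>B\<^esub> Fmor U (Idm A V)) = Fmor U (f \<boxdot> Idm A V) \<cdot>\<^bsub>B\<^esub> J (A.src f) V"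
    using U_monoidal assms(2) unfolding monoidal_functor_def by blast
  then show ?thesis using assms by simp
qed

text \<open>
  Up to the isomorphisms J, the map \<open>U(f \<boxdot> V)\<close> is \<open>U(f) \<boxdot> U(V)\<close>, which is split by
  \<open>s \<boxdot> U(V)\<close>.
\<close>

lemma tensor_allowable:
  assumes al: "allowable A B U X Y f" and V: "V \<in> Ob A"
  shows "allowable A B U (X \<boxtimes> V) (Y \<boxtimes> V) (f \<boxdot> Idm A V)"
proof -
  obtain s where f: "A.arr f" "A.src f = X" "A.tgt f = Y" "X \<in> Ob A" "Y \<in> Ob A"
    and s: "B.arr s" "B.src s = Fob U Y" "B.tgt s = Fob U X"
      "Fmor U f \<cdot>\<^bsub>B\<^esub> s \<cdot>\<^bsub>B\<^esub> Fmor U f = Fmor U f"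
    using allowableD[OF al] by metis
  obtain K where JX: "B.arr (J X V)" "B.src (J X V) = Fob U X \<boxtimes>\<^bsub>B\<^esub> Fob U V"
      "B.tgt (J X V) = Fob U (X \<boxtimes> V)"
    and K: "B.arr K" "B.src K = Fob U (X \<boxtimes> V)" "B.tgt K = Fob U X \<boxtimes>\<^bsub>B\<^esub> Fob U V"
      "K \<cdot>\<^bsub>B\<^esub> J X V = Idm B (Fob U X \<boxtimes>\<^bsub>B\<^esub> Fob U V)" "J X V \<cdot>\<^bsub>B\<^esub> K = Idm B (Fob U (X \<boxtimes> V))"
    using J_inverse[OF f(4) V] .
  obtain L where JY: "B.arr (J Y V)" "B.src (J Y V) = Fob U Y \<boxtimes>\<^bsub>B\<^esub> Fob U V"
      "B.tgt (J Y V) = Fob U (Y \<boxtimes> V)"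
    and L: "B.arr L" "B.src L = Fob U (Y \<boxtimes> V)" "B.tgt L = Fob U Y \<boxtimes>\<^bsub>B\<^esub> Fob U V"
      "L \<cdot>\<^bsub>B\<^esub> J Y V = Idm B (Fob U Y \<boxtimes>\<^bsub>B\<^esub> Fob U V)" "J Y V \<cdot>\<^bsub>B\<^esub> L = Idm B (Fob U (Y \<boxtimes> V))"
    using J_inverse[OF f(5) V] .
  define \<phi> where "\<phi> = Fmor U f \<boxdot>\<^bsub>B\<^esub> Idm B (Fob U V)"
  define \<sigma> where "\<sigma> = s \<boxdot>\<^bsub>B\<^esub> Idm B (Fob U V)"
  have \<phi>: "B.arr \<phi>" "B.src \<phi> = Fob U X \<boxtimes>\<^bsub>B\<^esub> Fob U V" "B.tgt \<phi> = Fob U Y \<boxtimes>\<^bsub>B\<^esub> Fob U V"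
    and \<sigma>: "B.arr \<sigma>" "B.src \<sigma> = Fob U Y \<boxtimes>\<^bsub>B\<^esub> Fob U V" "B.tgt \<sigma> = Fob U X \<boxtimes>\<^bsub>B\<^esub> Fob U V"
    unfolding \<phi>_def \<sigma>_def using f s(1-3) V by simp_all
  have split: "\<phi> \<cdot>\<^bsub>B\<^esub> \<sigma> \<cdot>\<^bsub>B\<^esub> \<phi> = \<phi>"
    unfolding \<phi>_def \<sigma>_def using f s V by (simp add: B.tensor_Comp)
  let ?F = "Fmor U (f \<boxdot> Idm A V)"
  have F: "B.arr ?F" "B.src ?F = Fob U (X \<boxtimes> V)" "B.tgt ?F = Fob U (Y \<boxtimes> V)" using f V by simp_all
  have "?F = ?F \<cdot>\<^bsub>B\<^esub> (J X V \<cdot>\<^bsub>B\<^esub> K)" using F K(5) by simp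
  also have "\<dots> = (J Y V \<cdot>\<^bsub>B\<^esub> \<phi>) \<cdot>\<^bsub>B\<^esub> K"
    using J_natural[OF f(1) V] f(2,3) F JX K(1-3) unfolding \<phi>_def by simp
  also have "\<dots> = J Y V \<cdot>\<^bsub>B\<^esub> \<phi> \<cdot>\<^bsub>B\<^esub> K" using JY \<phi> K(1-3) by simp
  finally have F_eq: "?F = J Y V \<cdot>\<^bsub>B\<^esub> \<phi> \<cdot>\<^bsub>B\<^esub> K" .
  have "?F \<cdot>\<^bsub>B\<^esub> (J X V \<cdot>\<^bsub>B\<^esub> \<sigma> \<cdot>\<^bsub>B\<^esub> L) \<cdot>\<^bsub>B\<^esub> ?F
      = J Y V \<cdot>\<^bsub>B\<^esub> \<phi> \<cdot>\<^bsub>B\<^esub> (K \<cdot>\<^bsub>B\<^esub> J X V) \<cdot>\<^bsub>B\<^esub> \<sigma> \<cdot>\<^bsub>B\<^esub> (L \<cdot>\<^bsub>B\<^esub> J Y V) \<cdot>\<^bsub>B\<^esub> \<phi> \<cdot>\<^bsub>B\<^esub> K"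
    unfolding F_eq using JX JY \<phi> \<sigma> K(1-3) L(1-3) by simp
  also have "\<dots> = J Y V \<cdot>\<^bsub>B\<^esub> (\<phi> \<cdot>\<^bsub>B\<^esub> \<sigma> \<cdot>\<^bsub>B\<^esub> \<phi>) \<cdot>\<^bsub>B\<^esub> K"
    unfolding K(4) L(4) using JX JY \<phi> \<sigma> K(1-3) L(1-3) by simp
  also have "\<dots> = ?F" unfolding split F_eq ..
  finally show ?thesis
    using f V F JX \<sigma> L(1-3) by (intro allowableI[of _ _ _ "J X V \<cdot>\<^bsub>B\<^esub> \<sigma> \<cdot>\<^bsub>B\<^esub> L"]) simp_all
qed

lemma tensor_allowable_short_exact:
  assumes "allowable_short_exact A B U X Y Z f g" and "V \<in> Ob A"
  shows "allowable_short_exact A B U (X \<boxtimes> V) (Y \<boxtimes> V) (Z \<boxtimes> V) (f \<boxdot> Idm A V) (g \<boxdot> Idm A V)"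
  using assms tensor_allowable A.tensor_ses
  unfolding allowable_short_exact_def A.short_exact_iff_ses by blast

lemma tensor_epic:
  assumes g: "epic A X Y g" and V: "V \<in> Ob A"
  shows "epic A (X \<boxtimes> V) (Y \<boxtimes> V) (g \<boxdot> Idm A V)"
proof -
  obtain N n where "is_kernel A X Y g N n" using A.has_kernels[of X Y g] A.epicD[OF g] by auto
  then have "A.ses N X Y n g" using A.sesI[OF g] by blast
  then show ?thesis using A.tensor_ses[OF _ V] A.cokernel_epic unfolding A.ses_def by blast
qed

text \<open>
  \<open>- \<boxtimes> V\<close> has the right adjoint \<open>- \<boxtimes> Vd\<close>, which preserves allowable epimorphisms; so a lifting
  problem for \<open>P \<boxtimes> V\<close> transposes to one for P.
\<close>

lemma tensor_projective:
  assumes P: "rel_projective A B U P" and V: "V \<in> Ob A"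
  shows "rel_projective A B U (P \<boxtimes> V)"
  unfolding rel_projective_def
proof (intro conjI allI impI ballI)
  have P_Ob: "P \<in> Ob A" using P by (simp add: rel_projective_def)
  then show "P \<boxtimes> V \<in> Ob A" using V by simp
  fix X Y g f assume g: "epic A X Y g \<and> allowable A B U X Y g" and "f \<in> mor A (P \<boxtimes> V) Y"
  note gD = A.epicD[OF conjunct1[OF g]]
  have f: "A.arr f" "A.src f = P \<boxtimes> V" "A.tgt f = Y"
    using \<open>f \<in> mor A (P \<boxtimes> V) Y\<close> gD P_Ob V by auto
  obtain Vd where "is_dual A V Vd" using A.left_duals[OF V] by blast
  then obtain ev coev where "dual_pair k A V Vd ev coev" by (rule A.dual_pair_of_is_dual)
  then interpret D: dual_pair k A V Vd ev coev .
  have "epic A (X \<boxtimes> Vd) (Y \<boxtimes> Vd) (g \<boxdot> Idm A Vd)" "allowable A B U (X \<boxtimes> Vd) (Y \<boxtimes> Vd) (g \<boxdot> Idm A Vd)"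
    using g tensor_epic tensor_allowable D.Xd by blast+
  moreover have "D.adj P f \<in> mor A P (Y \<boxtimes> Vd)" using f P_Ob gD by simp
  ultimately obtain h where "h \<in> mor A P (X \<boxtimes> Vd)" and gh: "(g \<boxdot> Idm A Vd) \<cdot> h = D.adj P f"
    using P unfolding rel_projective_def by blast
  then have h: "A.arr h" "A.src h = P" "A.tgt h = X \<boxtimes> Vd" using P_Ob gD by auto
  have "D.adj P (g \<cdot> D.unadj X h) = D.adj P f"
    using D.adj_comp[of P "D.unadj X h" g] D.adj_unadj[of X h] h gD P_Ob gh by simp
  then have "g \<cdot> D.unadj X h = f"
    using D.adj_inject[of P "g \<cdot> D.unadj X h" f] f h gD P_Ob by simp
  then show "\<exists>h \<in> mor A (P \<boxtimes> V) X. g \<cdot> h = f"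
    using h gD P_Ob V by (intro bexI[of _ "D.unadj X h"]) simp_all
qed

text \<open>
  Tensoring the presentation of the unit with X presents X itself, with kernel \<open>K \<boxtimes> X\<close>.
  Iterated from L on, this gives the syzygies \<open>K \<boxtimes> \<dots> \<boxtimes> K \<boxtimes> L\<close> of V.
\<close>

lemma tensor_syzygies:
  assumes K: "allowable_short_exact A B U K P (Unit A) j \<pi>" and P: "rel_projective A B U P"
    and L: "allowable_short_exact A B U L Q V i p" and Q: "rel_projective A B U Q"
  shows "syzygies V (case_nat V (\<lambda>m. (Tob A K ^^ m) L)) (case_nat Q (\<lambda>m. P \<boxtimes> (Tob A K ^^ m) L))
    (case_nat i (\<lambda>m. j \<boxdot> Idm A ((Tob A K ^^ m) L))) (case_nat p (\<lambda>m. \<pi> \<boxdot> Idm A ((Tob A K ^^ m) L)))"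
proof -
  have "K \<in> Ob A" "L \<in> Ob A" using K L by (simp_all add: allowable_short_exact_def allowable_def)
  then have X: "(Tob A K ^^ m) L \<in> Ob A" for m by (induction m) simp_all
  have "allowable_short_exact A B U (K \<boxtimes> (Tob A K ^^ m) L) (P \<boxtimes> (Tob A K ^^ m) L) ((Tob A K ^^ m) L)
      (j \<boxdot> Idm A ((Tob A K ^^ m) L)) (\<pi> \<boxdot> Idm A ((Tob A K ^^ m) L))" for m
    using tensor_allowable_short_exact[OF K X] X by simp
  then show ?thesis
    unfolding syzygies_def using L Q tensor_projective[OF P X] by (auto split: nat.split)
qed

lemma rel_Ext_internal_hom:
  assumes s: "syzygies V S R \<iota> \<rho>" and j: "j \<in> mor A K P" and K: "K \<in> Ob A" and P: "P \<in> Ob A"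
    and X: "S (Suc m) = K \<boxtimes> X" "R m = P \<boxtimes> X" "\<iota> m = j \<boxdot> Idm A X"
    and ih: "A.internal_hom X W N"
  shows "module_isomorphic k (rel_Ext A B U (Suc m) V W)
    (quot_module (Hom A K N) ((\<lambda>f. f \<cdot> j) ` mor A P N))"
proof -
  have W: "W \<in> Ob A" using ih by (simp add: A.internal_hom_def)
  have j': "A.arr j" "A.src j = K" "A.tgt j = P" using j K P by auto
  show ?thesis
    using module_isomorphic_trans[OF rel_Ext_syzygy[OF s W, of m, unfolded X]
        A.internal_hom_quot[OF ih j'(1), unfolded j'(2,3)]] .
qed

end

theorem proposition3p4:
  fixes k :: "('k, 'r) ring_scheme"
    and A :: "('k, 'oa, 'ma, 'za) mon_cat_scheme"
    and B :: "('k, 'ob, 'mb, 'zb) mon_cat_scheme"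
    and U :: "('oa, 'ma, 'ob, 'mb) fctr"
    and J :: "'oa \<Rightarrow> 'oa \<Rightarrow> 'mb" and e :: "'mb"
    and V W K P L Q Vd Kd Ld :: "'oa" and j \<pi> i p :: "'ma"
    and M :: "nat \<Rightarrow> 'oa" and n :: nat
  assumes "strict_tensor_category k A" and "strict_tensor_category k B"
    and "linear_functor k A B U" and "exact_functor A B U" and "faithful_functor A B U"
    and "monoidal_functor A B U J e" and "has_left_adjoint A B U"
    and "V \<in> Ob A" and "W \<in> Ob A"
    and "allowable_short_exact A B U K P (Unit A) j \<pi>"
    and "allowable_short_exact A B U L Q V i p"
    and "rel_projective A B U P" and "rel_projective A B U Q"
    and "is_dual A V Vd" and "is_dual A K Kd" and "is_dual A L Ld"
    and "M 1 = W \<boxtimes>\<^bsub>A\<^esub> Vd"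
    and "\<And>m. m \<ge> 2 \<Longrightarrow> M m = W \<boxtimes>\<^bsub>A\<^esub> Ld \<boxtimes>\<^bsub>A\<^esub> Tpow A Kd (m - 2)"
    and "n \<ge> 1"
  shows "module_isomorphic k (rel_Ext A B U n V W)
           (quot_module (Hom A K (M n)) ((\<lambda>f. f \<cdot>\<^bsub>A\<^esub> j) ` mor A P (M n)))"
proof -
  interpret monoidal_setting k A B U J e
    using assms(1,2,4,6) by (simp add: monoidal_setting_def monoidal_setting_axioms_def)
  note KP = assms(10) and LQ = assms(11) and P = assms(12) and Q = assms(13)
  have j: "j \<in> mor A K P" and K: "K \<in> Ob A" and P_Ob: "P \<in> Ob A"
    using KP by (simp_all add: allowable_short_exact_def allowable_def)
  have Kd: "Kd \<in> Ob A" and Ld: "Ld \<in> Ob A" using assms(15,16) by (simp_all add: is_dual_def)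
  consider "n = 1" | m where "n = Suc (Suc m)" using assms(19) by (metis One_nat_def not0_implies_Suc not_one_le_zero)
  then show ?thesis
  proof cases
    case 1
    (* \<open>K \<boxtimes> V \<rightarrow> P \<boxtimes> V \<rightarrow> V\<close> takes the place of \<open>L \<rightarrow> Q \<rightarrow> V\<close> here, as its first syzygy has a factor K *)
    have KV: "allowable_short_exact A B U (K \<boxtimes>\<^bsub>A\<^esub> V) (P \<boxtimes>\<^bsub>A\<^esub> V) V (j \<boxdot>\<^bsub>A\<^esub> Idm A V) (\<pi> \<boxdot>\<^bsub>A\<^esub> Idm A V)"
      using tensor_allowable_short_exact[OF KP assms(8)] assms(8) by simp
    show ?thesis
      using rel_Ext_internal_hom[OF tensor_syzygies[OF KP P KV tensor_projective[OF P assms(8)]] j K P_Ob,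
          of 0 V W "M 1"] A.dual_internal_hom[OF assms(14,9)] assms(17) 1
      by simp
  next
    case (2 m)
    have ih: "A.internal_hom ((Tob A K ^^ m) L) W (W \<boxtimes>\<^bsub>A\<^esub> Ld \<boxtimes>\<^bsub>A\<^esub> Tpow A Kd m)"
    proof (induction m)
      case 0
      show ?case using A.dual_internal_hom[OF assms(16,9)] Ld by simp
    next
      case (Suc m)
      have "(W \<boxtimes>\<^bsub>A\<^esub> Ld \<boxtimes>\<^bsub>A\<^esub> Tpow A Kd m) \<boxtimes>\<^bsub>A\<^esub> Kd = W \<boxtimes>\<^bsub>A\<^esub> Ld \<boxtimes>\<^bsub>A\<^esub> Tpow A Kd (Suc m)"
        using assms(9) Ld Kd by (simp add: A.Tpow_commute)
      then show ?case
        using A.internal_hom_tensor[OF Suc A.dual_internal_hom[OF assms(15)]] assms(9) Ld Kd by simp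
    qed
    show ?thesis
      using rel_Ext_internal_hom[OF tensor_syzygies[OF KP P LQ Q] j K P_Ob _ _ _ ih, of "Suc m"]
        assms(18)[of n] 2 by simp
  qed
qed

end
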